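(* Let $H=\sum_{i=1}^{[\frac{n-1}{2}]}H_{2i+1}$, where each $H_{2i+1}$ is a closed $(2i+1)$-form on $M$, let $t\geq 1$ and let $[x_p]_{2t+3}\in E_{2t+3}^{p,q}$. Then the differential $d_{2t+3}:E_{2t+3}^{p,q}\to E_{2t+3}^{p+2t+3,q-2t-2}$ of the spectral sequence $\{E_r^{p,q},d_r\}$ is given by $$d_{2t+3}[x_p]_{2t+3}=(-1)^t\,[\langle \underbrace{H_3,\cdots,H_3}_{t+1},x_p\rangle_{A}]_{2t+3},$$ where $A$ is any admissible defining system (as defined in the context) for the $(t+2)$-fold Massey product $\langle \underbrace{H_3,\cdots,H_3}_{t+1},x_p\rangle$, and the class $[\langle \underbrace{H_3,\cdots,H_3}_{t+1},x_p\rangle_{A}]_{2t+3}$ is independent of the choice of the admissible defining system $A$.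
   Context: $M$ is a smooth compact closed manifold of dimension $n$; $\Omega^{*}(M)$ is the space of real smooth differential forms, $d$ the exterior derivative, $H^*(M)$ de Rham cohomology; $[r]$ for a real number $r$ is its integer part. Forms of degree $>n$ are zero (in particular $H_{2i+1}=0$ when $2i+1>n$). Put $D=d+H$, where $H$ acts by $w\mapsto H\wedge w$; then $D^2=0$. Spectral sequence. Let $K_p=\bigoplus_{i\geq p}\Omega^i(M)$ (so $K_p=\Omega^*(M)$ for $p\le 0$); $D(K_p)\subset K_p$. Each of $K_p$, $K_p/K_{p+1}$ splits into an even-degree and an odd-degree part interchanged by $D$; $H_D^i(\cdot)$ denotes the $D$-cohomology at the even part if $i$ is even and at the odd part if $i$ is odd. The exact couple is $D_1^{p,q}=H_D^{p+q}(K_p)$, $E_1^{p,q}=H_D^{p+q}(K_p/K_{p+1})$, with $i_1,j_1,k_1$ the maps $i^*$, $j^*$, $\delta$ of the long exact sequence of $0\to K_{p+1}\to K_p\to K_p/K_{p+1}\to 0$. The spectral sequence comes from its iterated derived couples: $d_r=j_rk_r$, $E_{r+1}=H_{d_r}(E_r)$, $D_{r+1}=i_r(D_r)$, $i_{r+1}=i_r|_{D_{r+1}}$, $j_{r+1}(i_ra)=[j_ra]$, $k_{r+1}[b]=k_rb$; $d_r$ has bidegree $(r,1-r)$. One has $E_1^{p,q}\cong\Omega^p(M)$ with $d_1=d$ for $q$ even (via $K_p/K_{p+1}\cong\Omega^p(M)$) and $E_1^{p,q}=0$ for $q$ odd, so $E_2^{p,q}\cong H^p(M)$ for $q$ even.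 For $x_p\in\Omega^p(M)\cong E_1^{p,q}$ ($q$ even) surviving to $E_r^{p,q}$, $[x_p]_r$ denotes its class there; likewise, for a class in $H^{m}(M)$, viewed in $E_2^{m,*}$, that survives to $E_r$, $[\,\cdot\,]_r$ denotes its class in $E_r$. Massey products. For a form $x$ write $\bar x=(-1)^{1+\deg x}x$. For closed forms $x_1,\dots,x_N$ of degrees $r_1,\dots,r_N$, a defining system for the $N$-fold Massey product $\langle x_1,\dots,x_N\rangle$ is a collection $A=(a_{i,j})$, $1\le i\le j\le N$, $(i,j)\ne(1,N)$, with $a_{i,j}\in\Omega^{r_i+\cdots+r_j-j+i}(M)$, $a_{i,i}=x_i$ and $d(a_{i,j})=\sum_{r=i}^{j-1}\bar a_{i,r}\wedge a_{r+1,j}$. Its related cocycle is $c(A)=\sum_{r=1}^{N-1}\bar a_{1,r}\wedge a_{r+1,N}\in\Omega^{r_1+\cdots+r_N-N+2}(M)$. Admissible defining systems. Let $x_p$ be the given representative (so $dx_p=0$). Choose forms $x_{p+2i}^{(t)}\in\Omega^{p+2i}(M)$, $1\le i\le t$, and put $x_p^{(t)}=x_p$, such that $$dx_{p+2j}^{(t)}+\sum_{i=1}^{j}H_{2i+1}\wedge x_{p+2(j-i)}^{(t)}=0\qquad(1\le j\le t)$$ (the paper shows that such forms exist). The associated admissible defining system $A=(a_{i,j})$ for $\langle \underbrace{H_3,\cdots,H_3}_{t+1},x_p\rangle$ (so $N=t+2$) is $a_{t+2,t+2}=x_p$; $a_{i,i+k}=(-1)^kH_{2k+3}$ for $0\le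 k\le t$, $1\le i\le t+1-k$; $a_{i,t+2}=(-1)^{t+2-i}x_{p+2(t+2-i)}^{(t)}$ for $2\le i\le t+1$. Finally $\langle \underbrace{H_3,\cdots,H_3}_{t+1},x_p\rangle_A:=[c(A)]\in H^{p+2t+3}(M)$. *)

theory Defs
  imports "HOL-Analysis.Analysis" "HOL-Library.Function_Algebras" "HOL-Library.Set_Algebras"
begin

text \<open>
  Conventions.  Functions are added and multiplied pointwise (Function-Algebras).
  In particular a power of \<open>-1\<close> multiplying a form is the corresponding constant sign.
  Cosets are sets, \<open>x +o B\<close> is the coset of \<open>x\<close> and \<open>+\<close> on sets is elementwise
  (Set-Algebras).  A quotient \<open>Z/B\<close> is the set of cosets \<open>z +o B\<close>
  with \<open>z\<close> in \<open>Z\<close>.  A quotient of quotients \<open>(Z/B)/(B'/B)\<close> is always identified with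
  \<open>Z/B'\<close>, i.e. a set of cosets is replaced by its union; hence elements of all groups below
  are sets of differential forms.
\<close>

section \<open>Compact smooth manifolds\<close>

definition partial_deriv :: "nat \<Rightarrow> ((nat \<Rightarrow> real) \<Rightarrow> real) \<Rightarrow> (nat \<Rightarrow> real) \<Rightarrow> real" where
  "partial_deriv i f x = deriv (\<lambda>s. f (x(i := s))) (x i)"

text \<open>\<open>Ck_on n k W f\<close>: \<open>f\<close> is of class \<open>C^k\<close> on the open subset \<open>W\<close> of \<open>n\<close>-space.\<close>

primrec Ck_on :: "nat \<Rightarrow> nat \<Rightarrow> (nat \<Rightarrow> real) set \<Rightarrow> ((nat \<Rightarrow> real) \<Rightarrow> real) \<Rightarrow> bool" where
  "Ck_on n 0 W f \<longleftrightarrow> continuous_map (subtopology (Euclidean_space n) W) euclideanreal f"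
| "Ck_on n (Suc k) W f \<longleftrightarrow>
     continuous_map (subtopology (Euclidean_space n) W) euclideanreal f \<and>
     (\<forall>i<n. (\<forall>x\<in>W. (\<lambda>s. f (x(i := s))) field_differentiable (at (x i))) \<and>
            Ck_on n k W (partial_deriv i f))"

definition smooth_on :: "nat \<Rightarrow> (nat \<Rightarrow> real) set \<Rightarrow> ((nat \<Rightarrow> real) \<Rightarrow> real) \<Rightarrow> bool" where
  "smooth_on n W f \<longleftrightarrow> (\<forall>k. Ck_on n k W f)"

type_synonym 'm chart = "'m set \<times> ('m \<Rightarrow> nat \<Rightarrow> real)"

definition is_chart :: "nat \<Rightarrow> 'm topology \<Rightarrow> 'm chart \<Rightarrow> bool" where
  "is_chart n M c \<longleftrightarrow> (case c of (U, \<phi>) \<Rightarrow>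
     openin M U \<and> openin (Euclidean_space n) (\<phi> ` U) \<and>
     homeomorphic_map (subtopology M U) (subtopology (Euclidean_space n) (\<phi> ` U)) \<phi>)"

definition smooth_atlas :: "nat \<Rightarrow> 'm topology \<Rightarrow> 'm chart set \<Rightarrow> bool" where
  "smooth_atlas n M \<A> \<longleftrightarrow>
     (\<forall>c\<in>\<A>. is_chart n M c) \<and> (\<Union>(U, \<phi>)\<in>\<A>. U) = topspace M \<and>
     (\<forall>(U, \<phi>)\<in>\<A>. \<forall>(V, \<psi>)\<in>\<A>. \<forall>i<n.
        smooth_on n (\<phi> ` (U \<inter> V)) (\<lambda>y. \<psi> (inv_into U \<phi> y) i))"

definition closed_smooth_manifold :: "nat \<Rightarrow> 'm topology \<Rightarrow> 'm chart set \<Rightarrow> bool" where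
  "closed_smooth_manifold n M \<A> \<longleftrightarrow>
     Hausdorff_space M \<and> second_countable M \<and> compact_space M \<and> smooth_atlas n M \<A>"

text \<open>Smooth functions are normalised to vanish outside the carrier of \<open>M\<close>.\<close>

definition smooth_functions :: "nat \<Rightarrow> 'm topology \<Rightarrow> 'm chart set \<Rightarrow> ('m \<Rightarrow> real) set" where
  "smooth_functions n M \<A> = {f. (\<forall>m. m \<notin> topspace M \<longrightarrow> f m = 0) \<and>
     (\<forall>(U, \<phi>)\<in>\<A>. smooth_on n (\<phi> ` U) (\<lambda>y. f (inv_into U \<phi> y)))}"

section \<open>Vector fields and differential forms\<close>

text \<open>
  As in Helgason's book, a vector field is a derivation of the algebra \<open>C\<close> of smooth functions,
  and a \<open>p\<close>-form is an alternating \<open>C\<close>-multilinear map from \<open>p\<close>-tuples of vector fields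
  to \<open>C\<close>.  Both are extended by \<open>0\<close> outside their domain, so that equality is equality of
  functions.  A form takes a list of vector fields; as the length of the list reveals the degree,
  an inhomogeneous form is again such a function, and the sum of its homogeneous components.
\<close>

type_synonym 'm vfield = "('m \<Rightarrow> real) \<Rightarrow> ('m \<Rightarrow> real)"

type_synonym 'm form = "'m vfield list \<Rightarrow> ('m \<Rightarrow> real)"

definition vector_fields :: "('m \<Rightarrow> real) set \<Rightarrow> 'm vfield set" where
  "vector_fields C = {X.
     (\<forall>f\<in>C. X f \<in> C) \<and> (\<forall>f. f \<notin> C \<longrightarrow> X f = 0) \<and>
     (\<forall>f\<in>C. \<forall>g\<in>C. X (f + g) = X f + X g) \<and>
     (\<forall>f\<in>C. \<forall>a::real. X (\<lambda>m. a * f m) = (\<lambda>m. a * X f m)) \<and>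
     (\<forall>f\<in>C. \<forall>g\<in>C. X (f * g) = X f * g + f * X g)}"

definition lie_bracket :: "'m vfield \<Rightarrow> 'm vfield \<Rightarrow> 'm vfield" where
  "lie_bracket X Y = (\<lambda>f. X (Y f) - Y (X f))"

definition Omega :: "('m \<Rightarrow> real) set \<Rightarrow> int \<Rightarrow> 'm form set" where
  "Omega C p = {w.
     (\<forall>Xs. int (length Xs) \<noteq> p \<or> \<not> set Xs \<subseteq> vector_fields C \<longrightarrow> w Xs = 0) \<and>
     (\<forall>Xs. set Xs \<subseteq> vector_fields C \<longrightarrow>
        w Xs \<in> C \<and>
        (\<forall>i j. i < j \<and> j < length Xs \<and> Xs ! i = Xs ! j \<longrightarrow> w Xs = 0) \<and>
        (\<forall>i<length Xs. \<forall>X\<in>vector_fields C.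
           (\<forall>Y\<in>vector_fields C. w (Xs[i := X + Y]) = w (Xs[i := X]) + w (Xs[i := Y])) \<and>
           (\<forall>f\<in>C. w (Xs[i := (\<lambda>g. f * X g)]) = f * w (Xs[i := X]))))}"

definition hom_part :: "int \<Rightarrow> 'm form \<Rightarrow> 'm form" where
  "hom_part k w = (\<lambda>Xs. if int (length Xs) = k then w Xs else 0)"

text \<open>The direct sum of all \<open>Omega C k\<close>.\<close>

definition Omega_all :: "('m \<Rightarrow> real) set \<Rightarrow> 'm form set" where
  "Omega_all C = {w. (\<forall>k. hom_part k w \<in> Omega C k) \<and> finite {k. hom_part k w \<noteq> 0}}"

text \<open>
  The wedge product by the sum over shuffles; \<open>S\<close> is the set of positions of the arguments of the
  left factor, and the sign is that of the shuffle moving them to the front.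
\<close>

definition shuffle_inversions :: "nat set \<Rightarrow> nat \<Rightarrow> nat" where
  "shuffle_inversions S N = card {(i, j). i \<in> S \<and> j \<notin> S \<and> j < i \<and> i < N}"

definition wedge :: "'m form \<Rightarrow> 'm form \<Rightarrow> 'm form"  (infixr \<open>\<and>\<^sub>w\<close> 75) where
  "v \<and>\<^sub>w w = (\<lambda>Xs. \<Sum>S\<in>Pow {..<length Xs}.
     (-1) ^ shuffle_inversions S (length Xs) * v (nths Xs S) * w (nths Xs (- S)))"

text \<open>The exterior derivative by the invariant (Koszul) formula, with positions counted from 0.\<close>

definition ext_d :: "('m \<Rightarrow> real) set \<Rightarrow> 'm form \<Rightarrow> 'm form" where
  "ext_d C w = (\<lambda>Xs. if set Xs \<subseteq> vector_fields C then
       (\<Sum>i<length Xs. (-1) ^ i * (Xs ! i) (w (nths Xs (- {i})))) +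
       (\<Sum>(i, j)\<in>{(i, j). i < j \<and> j < length Xs}.
          (-1) ^ (i + j) * w (lie_bracket (Xs ! i) (Xs ! j) # nths Xs (- {i, j})))
     else 0)"

definition deRham_class :: "('m \<Rightarrow> real) set \<Rightarrow> int \<Rightarrow> 'm form \<Rightarrow> 'm form set" where
  "deRham_class C m z = z +o (ext_d C ` Omega C (m - 1))"

definition deRham :: "('m \<Rightarrow> real) set \<Rightarrow> int \<Rightarrow> 'm form set set" where
  "deRham C m = deRham_class C m ` {z \<in> Omega C m. ext_d C z = 0}"

section \<open>Exact couples\<close>

text \<open>
  An exact couple of bigraded groups of cosets; the maps are indexed by the bidegree of their
  source.  The bidegrees of \<open>imap\<close>, \<open>jmap\<close>, \<open>kmap\<close> are \<open>(-1,1)\<close>,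
  \<open>(jdeg,-jdeg)\<close> and \<open>(1,0)\<close>.  An element of an \<open>Egrp\<close> is zero iff, as a coset, it
  contains \<open>0\<close>.
\<close>

record 'a couple =
  Dgrp :: "int \<Rightarrow> int \<Rightarrow> 'a set set"
  Egrp :: "int \<Rightarrow> int \<Rightarrow> 'a set set"
  imap :: "int \<Rightarrow> int \<Rightarrow> 'a set \<Rightarrow> 'a set"
  jmap :: "int \<Rightarrow> int \<Rightarrow> 'a set \<Rightarrow> 'a set"
  kmap :: "int \<Rightarrow> int \<Rightarrow> 'a set \<Rightarrow> 'a set"
  jdeg :: int

definition dmap :: "'a couple \<Rightarrow> int \<Rightarrow> int \<Rightarrow> 'a set \<Rightarrow> 'a set" where
  "dmap Q p q e = jmap Q (p + 1) q (kmap Q p q e)"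

text \<open>
  The class of a cycle \<open>b\<close> in the homology of \<open>Egrp Q\<close>: the union of the coset of \<open>b\<close> modulo
  the image of \<open>dmap Q\<close>.
\<close>

definition hclass :: "'a::ab_group_add couple \<Rightarrow> int \<Rightarrow> int \<Rightarrow> 'a set \<Rightarrow> 'a set" where
  "hclass Q p q b = (\<Union>e \<in> Egrp Q (p - 1 - jdeg Q) (q + jdeg Q).
     b + dmap Q (p - 1 - jdeg Q) (q + jdeg Q) e)"

definition ecycles :: "'a::ab_group_add couple \<Rightarrow> int \<Rightarrow> int \<Rightarrow> 'a set set" where
  "ecycles Q p q = {b \<in> Egrp Q p q. 0 \<in> dmap Q p q b}"

definition derived_couple :: "'a::ab_group_add couple \<Rightarrow> 'a couple" where
  "derived_couple Q = \<lparr>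
     Dgrp = (\<lambda>p q. imap Q (p + 1) (q - 1) ` Dgrp Q (p + 1) (q - 1)),
     Egrp = (\<lambda>p q. hclass Q p q ` ecycles Q p q),
     imap = imap Q,
     jmap = (\<lambda>p q c. THE e. \<exists>a \<in> Dgrp Q (p + 1) (q - 1). imap Q (p + 1) (q - 1) a = c \<and>
               e = hclass Q (p + 1 + jdeg Q) (q - 1 - jdeg Q) (jmap Q (p + 1) (q - 1) a)),
     kmap = (\<lambda>p q e. THE c. \<exists>b \<in> ecycles Q p q. hclass Q p q b = e \<and> c = kmap Q p q b),
     jdeg = jdeg Q + 1 \<rparr>"

section \<open>The spectral sequence of \<open>D = d + H\<close>\<close>

definition twisted_d :: "('m \<Rightarrow> real) set \<Rightarrow> 'm form \<Rightarrow> 'm form \<Rightarrow> 'm form" where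
  "twisted_d C h w = ext_d C w + h \<and>\<^sub>w w"

text \<open>\<open>K C p i\<close> is the part of \<open>K_p\<close> whose degrees have the parity of \<open>i\<close>.\<close>

definition K :: "('m \<Rightarrow> real) set \<Rightarrow> int \<Rightarrow> int \<Rightarrow> 'm form set" where
  "K C p i = {w \<in> Omega_all C. \<forall>k. k < p \<or> odd (k - i) \<longrightarrow> hom_part k w = 0}"

text \<open>The map between quotients induced by \<open>f\<close>, with target a quotient by \<open>B\<close>.\<close>

definition induced :: "('a \<Rightarrow> 'a) \<Rightarrow> 'a::ab_group_add set \<Rightarrow> 'a set \<Rightarrow> 'a set" where
  "induced f B c = (\<Union>z\<in>c. f z +o B)"

text \<open>Coboundaries of \<open>K_p\<close> in parity \<open>i\<close>, and of \<open>K_p/K_{p+1}\<close> (together with \<open>K_{p+1}\<close>).\<close>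

definition BD :: "('m \<Rightarrow> real) set \<Rightarrow> 'm form \<Rightarrow> int \<Rightarrow> int \<Rightarrow> 'm form set" where
  "BD C h p i = twisted_d C h ` K C p (i - 1)"

definition BE :: "('m \<Rightarrow> real) set \<Rightarrow> 'm form \<Rightarrow> int \<Rightarrow> int \<Rightarrow> 'm form set" where
  "BE C h p i = twisted_d C h ` K C p (i - 1) + K C (p + 1) i"

definition couple1 :: "('m \<Rightarrow> real) set \<Rightarrow> 'm form \<Rightarrow> 'm form couple" where
  "couple1 C h = \<lparr>
     Dgrp = (\<lambda>p q. (\<lambda>z. z +o BD C h p (p + q)) ` {z \<in> K C p (p + q). twisted_d C h z = 0}),
     Egrp = (\<lambda>p q. (\<lambda>z. z +o BE C h p (p + q)) `
               {z \<in> K C p (p + q). twisted_d C h z \<in> K C (p + 1) (p + q + 1)}),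
     imap = (\<lambda>p q. induced (\<lambda>z. z) (BD C h (p - 1) (p + q))),
     jmap = (\<lambda>p q. induced (\<lambda>z. z) (BE C h p (p + q))),
     kmap = (\<lambda>p q. induced (twisted_d C h) (BD C h (p + 1) (p + q + 1))),
     jdeg = 0 \<rparr>"

text \<open>\<open>ss C h r\<close> is the \<open>r\<close>-th couple, \<open>r \<ge> 1\<close>.\<close>

definition ss :: "('m \<Rightarrow> real) set \<Rightarrow> 'm form \<Rightarrow> nat \<Rightarrow> 'm form couple" where
  "ss C h r = (derived_couple ^^ (r - 1)) (couple1 C h)"

text \<open>
  For \<open>b\<close> in \<open>E_s^{p,q}\<close> and \<open>r \<ge> s\<close>: the class of \<open>b\<close> in \<open>E_r^{p,q}\<close>, and whether \<open>b\<close>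
  survives to \<open>E_r^{p,q}\<close>.
\<close>

definition class_at :: "('m \<Rightarrow> real) set \<Rightarrow> 'm form \<Rightarrow> int \<Rightarrow> int \<Rightarrow> nat \<Rightarrow> 'm form set \<Rightarrow> nat \<Rightarrow> 'm form set" where
  "class_at C h p q s b r = fold (\<lambda>u. hclass (ss C h u) p q) [s..<r] b"

definition survives :: "('m \<Rightarrow> real) set \<Rightarrow> 'm form \<Rightarrow> int \<Rightarrow> int \<Rightarrow> nat \<Rightarrow> 'm form set \<Rightarrow> nat \<Rightarrow> bool" where
  "survives C h p q s b r \<longleftrightarrow> b \<in> Egrp (ss C h s) p q \<and>
     (\<forall>u\<in>{s..<r}. 0 \<in> dmap (ss C h u) p q (class_at C h p q s b u))"

text \<open>
  For \<open>q\<close> even, the isomorphisms from \<open>Omega C p\<close> to \<open>E_1^{p,q}\<close> and from \<open>H^p(M)\<close> to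
  \<open>E_2^{p,q}\<close>; the latter sends the class of \<open>z\<close> to the class of \<open>form_to_E1 C h p q z\<close>
  (the union is over the representatives \<open>z\<close>, which all give the same element).
\<close>

definition form_to_E1 :: "('m \<Rightarrow> real) set \<Rightarrow> 'm form \<Rightarrow> int \<Rightarrow> int \<Rightarrow> 'm form \<Rightarrow> 'm form set" where
  "form_to_E1 C h p q z = z +o BE C h p (p + q)"

definition deRham_to_E2 :: "('m \<Rightarrow> real) set \<Rightarrow> 'm form \<Rightarrow> int \<Rightarrow> int \<Rightarrow> 'm form set \<Rightarrow> 'm form set" where
  "deRham_to_E2 C h p q c = (\<Union>z\<in>c. class_at C h p q 1 (form_to_E1 C h p q z) 2)"

section \<open>Massey products\<close>

definition bar :: "'m form \<Rightarrow> 'm form" where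
  "bar w = (\<lambda>Xs. (-1) ^ (1 + length Xs) * w Xs)"

text \<open>The value of \<open>A\<close> at \<open>(1, N)\<close> is irrelevant: it is not part of the defining system.\<close>

definition defining_system ::
  "('m \<Rightarrow> real) set \<Rightarrow> nat \<Rightarrow> (nat \<Rightarrow> int) \<Rightarrow> (nat \<Rightarrow> 'm form) \<Rightarrow> (nat \<Rightarrow> nat \<Rightarrow> 'm form) \<Rightarrow> bool" where
  "defining_system C N r x A \<longleftrightarrow>
     (\<forall>i j. 1 \<le> i \<and> i \<le> j \<and> j \<le> N \<and> (i, j) \<noteq> (1, N) \<longrightarrow>
        A i j \<in> Omega C ((\<Sum>k=i..j. r k) - int j + int i) \<and>
        (i = j \<longrightarrow> A i j = x i) \<and>
        ext_d C (A i j) = (\<Sum>s=i..<j. bar (A i s) \<and>\<^sub>w A (s + 1) j))"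

definition related_cocycle :: "nat \<Rightarrow> (nat \<Rightarrow> nat \<Rightarrow> 'm form) \<Rightarrow> 'm form" where
  "related_cocycle N A = (\<Sum>s=1..<N. bar (A 1 s) \<and>\<^sub>w A (s + 1) N)"

text \<open>
  The family \<open>H\<close> is indexed by the degree of the forms; \<open>x i\<close> below is \<open>x_{p+2i}^{(t)}\<close>.
\<close>

definition admissible_system ::
  "('m \<Rightarrow> real) set \<Rightarrow> (nat \<Rightarrow> 'm form) \<Rightarrow> nat \<Rightarrow> int \<Rightarrow> 'm form \<Rightarrow> (nat \<Rightarrow> nat \<Rightarrow> 'm form) \<Rightarrow> bool" where
  "admissible_system C H t p xp A \<longleftrightarrow> (\<exists>x.
     x 0 = xp \<and>
     (\<forall>i\<in>{1..t}. x i \<in> Omega C (p + 2 * int i)) \<and>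
     (\<forall>j\<in>{1..t}. ext_d C (x j) + (\<Sum>i=1..j. H (2 * i + 1) \<and>\<^sub>w x (j - i)) = 0) \<and>
     A (t + 2) (t + 2) = xp \<and>
     (\<forall>k\<le>t. \<forall>i\<in>{1..t + 1 - k}. A i (i + k) = (-1) ^ k * H (2 * k + 3)) \<and>
     (\<forall>i\<in>{2..t + 1}. A i (t + 2) = (-1) ^ (t + 2 - i) * x (t + 2 - i)))"

definition massey_class ::
  "('m \<Rightarrow> real) set \<Rightarrow> nat \<Rightarrow> (nat \<Rightarrow> int) \<Rightarrow> (nat \<Rightarrow> nat \<Rightarrow> 'm form) \<Rightarrow> 'm form set" where
  "massey_class C N r A = deRham_class C ((\<Sum>k=1..N. r k) - int N + 2) (related_cocycle N A)"

text \<open>The degrees and the entries of \<open>H_3, \<dots>, H_3, x_p\<close> with \<open>t + 1\<close> copies of \<open>H_3\<close>.\<close>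

definition H3_degrees :: "nat \<Rightarrow> int \<Rightarrow> nat \<Rightarrow> int" where
  "H3_degrees t p i = (if i \<le> t + 1 then 3 else p)"

definition H3_entries :: "(nat \<Rightarrow> 'm form) \<Rightarrow> nat \<Rightarrow> 'm form \<Rightarrow> nat \<Rightarrow> 'm form" where
  "H3_entries H t xp i = (if i \<le> t + 1 then H 3 else xp)"

end

(*
  Unwinding the iterated derived couples, E_r^{p,q} consists of the cosets z + B_r with
  z in Z_r = {z in K_p. D z in K_{p+r}} and B_r = D(K_{p-r+1}) \<inter> K_p + K_{p+1}, and d_r sends
  z + B_r to D z + B_r.  For an admissible system the sum z of the forms x_{p+2j}^{(t)} lies in
  Z_{2t+3}, represents x_p, and the leading term of the closed form D z is, up to the sign
  (-1)^t, the related cocycle of the Massey product.  Conversely the homogeneous components of any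
  representative z in Z_{2t+3} of x_p form an admissible system.

  The facts about forms (the graded Leibniz rule, d d = 0, d and the wedge product preserve
  alternating multilinear maps) all follow by induction on the list of arguments, from the recursion
  for the interior product of a wedge product and from Cartan's formula
  i_X d = L_X - d i_X.
*)
theory Submission
  imports Defs
begin

text \<open>Forms are multilinear on global vector fields, so the calculus is algebra over a
  function algebra \<open>C\<close> and its derivations. Contraction with the head of the argument
  list, together with the grading involution in place of degrees, lets identities be proved one
  argument at a time for forms of mixed degree. The page number 2t+3 comes from parity: if z has
  components in degrees p, p+2, ... only, then \<open>D z\<close> lives in p+1, p+3, ..., and the
  t+1 equations for j = 0, ..., t remove exactly p+1, ..., p+2t+1. The lowest remaining component is
  closed for d but in general not for \<open>D\<close>; it differs from \<open>D z\<close> by an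
  element of K_(p+2t+4), which is zero on every page in that filtration, and this is why its class
  survives. A surviving x_p need not itself satisfy the condition defining Z_r; only its coset has a
  representative that does, and this representative is first corrected so that its degree p
  component is x_p itself. Independence of A is then a corollary: the differential of the class of
  x_p does not mention A, and a sign can be cancelled.\<close>

section \<open>The wedge product as a recursion on the arguments\<close>

text \<open>The method \<open>induction\<close> may eta-expand a form, and the pointwise rules would then
  evaluate it under the binders.  Hence they are only used explicitly.\<close>

declare plus_fun_apply [simp del] times_fun_apply [simp del] zero_fun_apply [simp del]
  one_fun_apply [simp del] uminus_apply [simp del] minus_apply [simp del]

lemma form_apply:
  fixes u v :: "'m form"
  shows "(u + v) Xs = u Xs + v Xs" "(u - v) Xs = u Xs - v Xs" "(- u) Xs = - u Xs" "(0 :: 'm form) Xs = 0"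
  by (simp_all add: plus_fun_apply minus_apply uminus_apply zero_fun_apply)

lemmas pointwise = plus_fun_apply times_fun_apply zero_fun_apply uminus_apply minus_apply

section \<open>Contraction, grading involution and the shuffle recursion\<close>

definition iprod :: "'m vfield \<Rightarrow> 'm form \<Rightarrow> 'm form" where
  "iprod X w = (\<lambda>Xs. w (X # Xs))"

text \<open>The grading involution. It replaces the Koszul signs (-1)^deg, so that sign rules make
  sense for forms of mixed degree.\<close>

definition grade_inv :: "'m form \<Rightarrow> 'm form" where
  "grade_inv w = (\<lambda>Xs. (-1) ^ length Xs * w Xs)"

definition smul :: "('m \<Rightarrow> real) \<Rightarrow> 'm form \<Rightarrow> 'm form" where
  "smul f w = (\<lambda>Xs. f * w Xs)"

definition fmul :: "('m \<Rightarrow> real) \<Rightarrow> 'm vfield \<Rightarrow> 'm vfield" where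
  "fmul f X = (\<lambda>g. f * X g)"

lemma Cons_iprod: "w (X # Xs) = iprod X w Xs"
  by (simp add: iprod_def)

lemma iprod_add [simp]: "iprod X (v + w) = iprod X v + iprod X w"
  and iprod_uminus [simp]: "iprod X (- w) = - iprod X w"
  and iprod_diff [simp]: "iprod X (v - w) = iprod X v - iprod X w"
  and iprod_zero [simp]: "iprod X 0 = 0"
  and iprod_smul [simp]: "iprod X (smul f w) = smul f (iprod X w)"
  and iprod_grade_inv [simp]: "iprod X (grade_inv w) = - grade_inv (iprod X w)"
  by (rule ext, simp add: form_apply iprod_def smul_def grade_inv_def)+

lemma grade_inv_add [simp]: "grade_inv (v + w) = grade_inv v + grade_inv w"
  and grade_inv_uminus [simp]: "grade_inv (- w) = - grade_inv w"
  and grade_inv_diff [simp]: "grade_inv (v - w) = grade_inv v - grade_inv w"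
  and grade_inv_zero [simp]: "grade_inv 0 = 0"
  by (rule ext, simp add: form_apply smul_def grade_inv_def algebra_simps)+

lemma grade_inv_smul [simp]: "grade_inv (smul f w) = smul f (grade_inv w)"
  by (rule ext) (simp add: grade_inv_def smul_def mult_ac)

lemma grade_inv_Nil [simp]: "grade_inv w [] = w []" and smul_Nil [simp]: "smul f w [] = f * w []"
  by (simp_all add: smul_def grade_inv_def)

lemma grade_inv_grade_inv [simp]: "grade_inv (grade_inv w) = w"
  by (rule ext, simp add: form_apply grade_inv_def flip: mult.assoc power_add)

lemma smul_add [simp]: "smul f (v + w) = smul f v + smul f w"
  and smul_uminus [simp]: "smul f (- w) = - smul f w"
  and smul_diff [simp]: "smul f (v - w) = smul f v - smul f w"
  and smul_zero [simp]: "smul f 0 = 0"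
  and smul_zero_left [simp]: "smul 0 w = 0"
  and smul_uminus_left: "smul (- f) w = - smul f w"
  and smul_smul: "smul f (smul g w) = smul (f * g) w"
  by (rule ext, simp add: form_apply smul_def algebra_simps)+

lemma wedge_add_left [simp]: "(u + v) \<and>\<^sub>w w = u \<and>\<^sub>w w + v \<and>\<^sub>w w"
  and wedge_add_right [simp]: "w \<and>\<^sub>w (u + v) = w \<and>\<^sub>w u + w \<and>\<^sub>w v"
  by (rule ext, simp add: form_apply wedge_def algebra_simps sum.distrib)+

lemma wedge_uminus_left [simp]: "(- v) \<and>\<^sub>w w = - (v \<and>\<^sub>w w)"
  and wedge_uminus_right [simp]: "v \<and>\<^sub>w (- w) = - (v \<and>\<^sub>w w)"
  by (rule ext, simp add: form_apply wedge_def sum_negf)+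

lemma wedge_diff_left [simp]: "(u - v) \<and>\<^sub>w w = u \<and>\<^sub>w w - v \<and>\<^sub>w w"
  and wedge_diff_right [simp]: "w \<and>\<^sub>w (u - v) = w \<and>\<^sub>w u - w \<and>\<^sub>w v"
  by (simp_all only: diff_conv_add_uminus wedge_add_left wedge_add_right wedge_uminus_left wedge_uminus_right)

lemma wedge_zero_left [simp]: "0 \<and>\<^sub>w w = 0"
  and wedge_zero_right [simp]: "v \<and>\<^sub>w 0 = 0"
  by (rule ext, simp add: form_apply wedge_def)+

lemma wedge_smul_left [simp]: "smul f v \<and>\<^sub>w w = smul f (v \<and>\<^sub>w w)"
  and wedge_smul_right [simp]: "v \<and>\<^sub>w smul f w = smul f (v \<and>\<^sub>w w)"
  by (rule ext, simp add: form_apply wedge_def smul_def sum_distrib_left mult_ac)+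

lemma wedge_sum_left: "(\<Sum>i\<in>I. v i) \<and>\<^sub>w w = (\<Sum>i\<in>I. v i \<and>\<^sub>w w)"
  using sum_comp_morphism[of "\<lambda>v. v \<and>\<^sub>w w" v I] by (simp add: o_def)

lemma wedge_Nil [simp]: "(v \<and>\<^sub>w w) [] = v [] * w []"
  by (simp add: form_apply wedge_def shuffle_inversions_def)

text \<open>No position lies below 0, so 0 itself takes part in no inversion as a member of the set;
  all other inversions are merely shifted.\<close>

lemma shuffle_inversions_insert_0:
  "shuffle_inversions (insert 0 (Suc ` S)) (Suc N) = shuffle_inversions S N"
proof -
  have "{(i, j). i \<in> insert 0 (Suc ` S) \<and> j \<notin> insert 0 (Suc ` S) \<and> j < i \<and> i < Suc N} =
      map_prod Suc Suc ` {(i, j). i \<in> S \<and> j \<notin> S \<and> j < i \<and> i < N}" (is "?L = ?R")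
  proof (intro set_eqI iffI)
    fix x assume "x \<in> ?L"
    then obtain i j where "x = (i, j)" "i \<in> insert 0 (Suc ` S)" "j \<notin> insert 0 (Suc ` S)" "j < i" "i < Suc N"
      by auto
    then show "x \<in> ?R" by (cases i; cases j) (auto simp: image_iff)
  qed (auto simp: image_iff)
  then show ?thesis
    by (simp add: shuffle_inversions_def card_image prod.inj_map inj_on_subset[OF prod.inj_map])
qed

text \<open>When position 0 goes to the right factor, each of the \<open>card S\<close> arguments of
  the left factor jumps over it. This count is the origin of \<open>grade_inv v\<close> in
  \<open>wedge_Cons\<close>.\<close>

lemma shuffle_inversions_Suc:
  assumes "S \<subseteq> {..<N}"
  shows "shuffle_inversions (Suc ` S) (Suc N) = card S + shuffle_inversions S N"
proof -
  have "{(i, j). i \<in> Suc ` S \<and> j \<notin> Suc ` S \<and> j < i \<and> i < Suc N} =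
      (\<lambda>i. (Suc i, 0)) ` S \<union> map_prod Suc Suc ` {(i, j). i \<in> S \<and> j \<notin> S \<and> j < i \<and> i < N}"
    (is "?L = ?A \<union> ?B")
  proof (intro set_eqI iffI)
    fix x assume "x \<in> ?L"
    then obtain i j where "x = (i, j)" "i \<in> Suc ` S" "j \<notin> Suc ` S" "j < i" "i < Suc N"
      by auto
    then show "x \<in> ?A \<union> ?B" by (cases i; cases j) (auto simp: image_iff)
  qed (use assms in \<open>auto simp: image_iff\<close>)
  moreover have "finite {(i, j). i \<in> S \<and> j \<notin> S \<and> j < i \<and> i < N}"
    by (rule finite_subset[of _ "{..<N} \<times> {..<N}"]) auto
  moreover have "finite S" using assms finite_subset by blast
  moreover have "?A \<inter> ?B = {}" by auto
  ultimately show ?thesis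
    by (simp add: shuffle_inversions_def card_Un_disjoint card_image inj_on_def
        inj_on_subset[OF prod.inj_map])
qed

lemma length_nths_subset:
  assumes "S \<subseteq> {..<length Xs}"
  shows "length (nths Xs S) = card S"
proof -
  have "{i. i < length Xs \<and> i \<in> S} = S" using assms by auto
  then show ?thesis by (simp add: length_nths)
qed

text \<open>Shuffles split according to which factor receives the first argument. The identity
  concerns arbitrary functions on lists, so the algebra of the wedge product reduces to induction on
  the arguments.\<close>

lemma wedge_Cons: "(v \<and>\<^sub>w w) (X # Xs) = (iprod X v \<and>\<^sub>w w) Xs + (grade_inv v \<and>\<^sub>w iprod X w) Xs"
proof -
  let ?N = "length Xs"
  let ?F = "\<lambda>S. (-1) ^ shuffle_inversions S (Suc ?N) * v (nths (X # Xs) S) * w (nths (X # Xs) (- S))"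
  have "Pow (Suc ` {..<?N}) = image Suc ` Pow {..<?N}"
    by (simp add: image_Pow_surj)
  then have P: "Pow {..<Suc ?N} = image Suc ` Pow {..<?N} \<union> (\<lambda>S. insert 0 (Suc ` S)) ` Pow {..<?N}"
    by (simp only: lessThan_Suc_eq_insert_0 Pow_insert image_image)
  have "(v \<and>\<^sub>w w) (X # Xs) = (\<Sum>S\<in>image Suc ` Pow {..<?N}. ?F S) +
      (\<Sum>S\<in>(\<lambda>S. insert 0 (Suc ` S)) ` Pow {..<?N}. ?F S)"
    unfolding wedge_def by (simp only: length_Cons P, rule sum.union_disjoint) auto
  also have "(\<Sum>S\<in>image Suc ` Pow {..<?N}. ?F S) = (\<Sum>S\<in>Pow {..<?N}. ?F (Suc ` S))"
    by (subst sum.reindex) (auto intro!: inj_on_image simp: inj_on_def)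
  also have "\<dots> = (grade_inv v \<and>\<^sub>w iprod X w) Xs"
    unfolding wedge_def grade_inv_def
  proof (rule sum.cong)
    fix S assume "S \<in> Pow {..<?N}"
    then have S: "S \<subseteq> {..<?N}" by simp
    have "{j. Suc j \<in> Suc ` S} = S" "{j. Suc j \<in> - Suc ` S} = - S" by auto
    then show "?F (Suc ` S) = (-1) ^ shuffle_inversions S ?N * ((-1) ^ length (nths Xs S) *
        v (nths Xs S)) * iprod X w (nths Xs (- S))"
      by (simp add: nths_Cons image_iff shuffle_inversions_Suc[OF S] length_nths_subset[OF S]
          power_add iprod_def mult_ac)
  qed simp
  also have "(\<Sum>S\<in>(\<lambda>S. insert 0 (Suc ` S)) ` Pow {..<?N}. ?F S) =
      (\<Sum>S\<in>Pow {..<?N}. ?F (insert 0 (Suc ` S)))"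
  proof (subst sum.reindex)
    have "S = T" if "insert 0 (Suc ` S) = insert 0 (Suc ` T)" for S T
      using that by (metis insert_ident inj_Suc inj_image_eq_iff image_iff nat.distinct(1))
    then show "inj_on (\<lambda>S. insert 0 (Suc ` S)) (Pow {..<?N})" by (intro inj_onI)
  qed simp
  also have "\<dots> = (iprod X v \<and>\<^sub>w w) Xs"
    unfolding wedge_def
  proof (rule sum.cong)
    fix S
    have "{j. Suc j \<in> insert 0 (Suc ` S)} = S" "{j. Suc j \<in> - insert 0 (Suc ` S)} = - S" by auto
    then show "?F (insert 0 (Suc ` S)) = (-1) ^ shuffle_inversions S ?N *
        iprod X v (nths Xs S) * w (nths Xs (- S))"
      by (simp add: nths_Cons shuffle_inversions_insert_0 iprod_def)
  qed simp
  finally show ?thesis by (simp add: add.commute)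
qed

lemma iprod_wedge [simp]: "iprod X (v \<and>\<^sub>w w) = iprod X v \<and>\<^sub>w w + grade_inv v \<and>\<^sub>w iprod X w"
  by (rule ext) (simp add: plus_fun_apply iprod_def[of X "v \<and>\<^sub>w w"] wedge_Cons)

lemma grade_inv_wedge [simp]: "grade_inv (v \<and>\<^sub>w w) = grade_inv v \<and>\<^sub>w grade_inv w"
proof
  fix Xs show "grade_inv (v \<and>\<^sub>w w) Xs = (grade_inv v \<and>\<^sub>w grade_inv w) Xs"
  proof (induction Xs arbitrary: v w)
    case Nil show ?case by simp
  next
    case (Cons X Xs) then show ?case by (simp add: form_apply Cons_iprod)
  qed
qed

text \<open>Contraction yields the same three terms on both sides, each with one factor contracted,
  and the hypothesis for all triples settles them. On the empty list only associativity of pointwise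
  multiplication remains.\<close>

lemma wedge_assoc: "(u \<and>\<^sub>w v) \<and>\<^sub>w w = u \<and>\<^sub>w v \<and>\<^sub>w w"
proof
  fix Xs show "((u \<and>\<^sub>w v) \<and>\<^sub>w w) Xs = (u \<and>\<^sub>w v \<and>\<^sub>w w) Xs"
  proof (induction Xs arbitrary: u v w)
    case Nil show ?case by (simp add: mult.assoc)
  next
    case (Cons X Xs) then show ?case by (simp add: form_apply Cons_iprod add.assoc)
  qed
qed

text \<open>Contraction swaps the parity of u, so neither half can be proved alone: the odd case
  uses the even one for \<open>iprod X u\<close>, and conversely.\<close>

lemma wedge_parity_commute:
  "(grade_inv u = - u \<longrightarrow> u \<and>\<^sub>w v = grade_inv v \<and>\<^sub>w u) \<and> (grade_inv u = u \<longrightarrow> u \<and>\<^sub>w v = v \<and>\<^sub>w u)"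
proof -
  have "\<forall>u v::'a form. (grade_inv u = - u \<longrightarrow> (u \<and>\<^sub>w v) Xs = (grade_inv v \<and>\<^sub>w u) Xs) \<and>
      (grade_inv u = u \<longrightarrow> (u \<and>\<^sub>w v) Xs = (v \<and>\<^sub>w u) Xs)" for Xs
  proof (rule list.induct[where list = Xs and P = "\<lambda>Xs. \<forall>u v::'a form.
      (grade_inv u = - u \<longrightarrow> (u \<and>\<^sub>w v) Xs = (grade_inv v \<and>\<^sub>w u) Xs) \<and>
      (grade_inv u = u \<longrightarrow> (u \<and>\<^sub>w v) Xs = (v \<and>\<^sub>w u) Xs)"], goal_cases)
    case 1 show ?case by (simp add: mult.commute)
  next
    case (2 X Xs)
    note IH = this
    have 1: "grade_inv (iprod X u) = iprod X u" if "grade_inv u = - u" for u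
      using arg_cong[OF that, of "iprod X"] by (simp only: iprod_grade_inv iprod_uminus neg_equal_iff_equal)
    have 3: "grade_inv (iprod X u) = - iprod X u" if "grade_inv u = u" for u
      using arg_cong[OF that, of "iprod X"] by (simp only: iprod_grade_inv minus_equation_iff[of "grade_inv _"])
    show ?case
    proof (intro allI conjI impI)
      fix u v :: "'a form"
      show "(u \<and>\<^sub>w v) (X # Xs) = (grade_inv v \<and>\<^sub>w u) (X # Xs)" if "grade_inv u = - u"
        using IH[rule_format, of "iprod X u" v] IH[rule_format, of u "iprod X v"] 1[OF that] that
        by (simp add: form_apply Cons_iprod)
      show "(u \<and>\<^sub>w v) (X # Xs) = (v \<and>\<^sub>w u) (X # Xs)" if "grade_inv u = u"
        using IH[rule_format, of "iprod X u" v] IH[rule_format, of u "iprod X v"] 3[OF that] that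
        by (simp add: form_apply Cons_iprod)
    qed
  qed
  then show ?thesis by blast
qed

lemma odd_wedge_anticommute: "grade_inv u = - u \<Longrightarrow> grade_inv v = - v \<Longrightarrow> u \<and>\<^sub>w v = - (v \<and>\<^sub>w u)"
  using wedge_parity_commute[of u v] by simp


section \<open>Function algebras, their derivations, and forms via iterated contraction\<close>

locale fun_algebra =
  fixes C :: "('m \<Rightarrow> real) set"
  assumes C_zero [simp, intro]: "0 \<in> C"
    and C_add [simp, intro]: "f \<in> C \<Longrightarrow> g \<in> C \<Longrightarrow> f + g \<in> C"
    and C_mult [simp, intro]: "f \<in> C \<Longrightarrow> g \<in> C \<Longrightarrow> f * g \<in> C"
    and C_scale: "f \<in> C \<Longrightarrow> (\<lambda>m. a * f m) \<in> C"
begin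

abbreviation "vf \<equiv> vector_fields C"
abbreviation "d \<equiv> ext_d C"

lemma C_uminus [simp, intro]: "f \<in> C \<Longrightarrow> - f \<in> C"
  using C_scale[of f "-1"] by (simp add: fun_Compl_def)

lemma C_diff [simp, intro]: "f \<in> C \<Longrightarrow> g \<in> C \<Longrightarrow> f - g \<in> C"
  using C_add[of f "- g"] by simp

lemma vf_in: "X \<in> vf \<Longrightarrow> f \<in> C \<Longrightarrow> X f \<in> C"
  and vf_out: "X \<in> vf \<Longrightarrow> f \<notin> C \<Longrightarrow> X f = 0"
  and vf_add: "X \<in> vf \<Longrightarrow> f \<in> C \<Longrightarrow> g \<in> C \<Longrightarrow> X (f + g) = X f + X g"
  and vf_scale: "X \<in> vf \<Longrightarrow> f \<in> C \<Longrightarrow> X (\<lambda>m. a * f m) = (\<lambda>m. a * X f m)"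
  and vf_mult: "X \<in> vf \<Longrightarrow> f \<in> C \<Longrightarrow> g \<in> C \<Longrightarrow> X (f * g) = X f * g + f * X g"
  by (auto simp: vector_fields_def)

text \<open>The default value 0 off \<open>C\<close> makes the membership unconditional, which
  spares side conditions in nested applications.\<close>

lemma vf_C: "X \<in> vf \<Longrightarrow> X f \<in> C"
  by (cases "f \<in> C") (auto simp: vf_in vf_out)

lemma vf_zero: "X \<in> vf \<Longrightarrow> X 0 = 0"
  using vf_add[of X 0 0] by simp

lemma vf_uminus: "X \<in> vf \<Longrightarrow> f \<in> C \<Longrightarrow> X (- f) = - X f"
  using vf_scale[of X f "-1"] by (simp add: fun_Compl_def)

lemma vf_diff: "X \<in> vf \<Longrightarrow> f \<in> C \<Longrightarrow> g \<in> C \<Longrightarrow> X (f - g) = X f - X g"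
  using vf_add[of X f "- g"] by (simp add: vf_uminus)

lemmas vf_simps = vf_C vf_add vf_zero vf_uminus vf_diff vf_mult vf_out

text \<open>Scalars become constant factors, so that \<open>algebra_simps\<close> can treat them
  like any other function.\<close>

lemma scale_mult: "(\<lambda>m. a * f m) = (\<lambda>m. a) * (f :: 'm \<Rightarrow> real)"
  by (simp add: times_fun_def)

lemma vfI:
  assumes "\<And>f. f \<in> C \<Longrightarrow> X f \<in> C" "\<And>f. f \<notin> C \<Longrightarrow> X f = 0"
    "\<And>f g. f \<in> C \<Longrightarrow> g \<in> C \<Longrightarrow> X (f + g) = X f + X g"
    "\<And>f a. f \<in> C \<Longrightarrow> X ((\<lambda>m. a) * f) = (\<lambda>m. a) * X f"
    "\<And>f g. f \<in> C \<Longrightarrow> g \<in> C \<Longrightarrow> X (f * g) = X f * g + f * X g"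
  shows "X \<in> vf"
  using assms by (auto simp: vector_fields_def scale_mult)

lemma vf_const_mult: "X \<in> vf \<Longrightarrow> f \<in> C \<Longrightarrow> X ((\<lambda>m. a) * f) = (\<lambda>m. a) * X f"
  using vf_scale[of X f a] by (simp add: scale_mult)

lemma vf_mult_const: "X \<in> vf \<Longrightarrow> f \<in> C \<Longrightarrow> X (f * (\<lambda>m. a)) = X f * (\<lambda>m. a)"
  using vf_const_mult[of X f a] by (simp add: mult.commute)

lemma vfield_apply:
  fixes X Y :: "'m vfield"
  shows "(X + Y) f = X f + Y f" "(X - Y) f = X f - Y f" "(- X) f = - X f" "(0 :: 'm vfield) f = 0"
  by (simp_all add: plus_fun_apply minus_apply uminus_apply zero_fun_apply)

lemma vf_0 [simp]: "0 \<in> vf"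
  by (rule vfI) (simp_all add: vfield_apply)

lemma vf_plus [simp]: "X \<in> vf \<Longrightarrow> Y \<in> vf \<Longrightarrow> X + Y \<in> vf"
  by (rule vfI) (simp_all add: vfield_apply vf_simps vf_const_mult vf_mult_const algebra_simps)

lemma vf_fmul [simp]: "f \<in> C \<Longrightarrow> X \<in> vf \<Longrightarrow> fmul f X \<in> vf"
  by (rule vfI) (simp_all add: fmul_def vf_simps vf_const_mult vf_mult_const algebra_simps)

abbreviation "br \<equiv> lie_bracket"

lemma vf_bracket [simp]: "X \<in> vf \<Longrightarrow> Y \<in> vf \<Longrightarrow> br X Y \<in> vf"
  by (rule vfI) (simp_all add: lie_bracket_def vf_simps vf_const_mult vf_mult_const algebra_simps)

lemma br_self: "br X X = 0"
  by (simp add: lie_bracket_def zero_fun_def)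

lemma br_add_right: "X \<in> vf \<Longrightarrow> Y \<in> vf \<Longrightarrow> Z \<in> vf \<Longrightarrow> br X (Y + Z) = br X Y + br X Z"
  by (rule ext) (simp add: lie_bracket_def vfield_apply vf_simps)

lemma br_add_left: "X \<in> vf \<Longrightarrow> Y \<in> vf \<Longrightarrow> Z \<in> vf \<Longrightarrow> br (X + Y) Z = br X Z + br Y Z"
  by (rule ext) (simp add: lie_bracket_def vfield_apply vf_simps)

lemma br_fmul_right:
  assumes "X \<in> vf" "Y \<in> vf" "f \<in> C"
  shows "br X (fmul f Y) = fmul (X f) Y + fmul f (br X Y)"
proof
  fix g
  show "br X (fmul f Y) g = (fmul (X f) Y + fmul f (br X Y)) g"
    using assms by (simp add: lie_bracket_def fmul_def vfield_apply vf_simps algebra_simps)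
qed

lemma br_fmul_left:
  assumes "X \<in> vf" "Y \<in> vf" "f \<in> C"
  shows "br (fmul f X) Y = fmul f (br X Y) + fmul (- Y f) X"
proof
  fix g
  show "br (fmul f X) Y g = (fmul f (br X Y) + fmul (- Y f) X) g"
    using assms by (simp add: lie_bracket_def fmul_def vfield_apply vf_simps algebra_simps)
qed

lemma br_jacobi:
  assumes "X \<in> vf" "Y \<in> vf" "Z \<in> vf"
  shows "br X (br Y Z) = br (br X Y) Z + br Y (br X Z)"
proof
  fix g
  show "br X (br Y Z) g = (br (br X Y) Z + br Y (br X Z)) g"
    using assms by (simp add: lie_bracket_def fmul_def vfield_apply vf_simps algebra_simps)
qed

text \<open>\<open>is_form\<close> characterises alternating multilinear maps of arbitrary, possibly mixed, degree by
  iterated interior products; \<open>form_upto n\<close> inspects the first \<open>n\<close> arguments.  This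
  presentation turns closure properties into inductions on \<open>n\<close>; \<open>form_iff_alt_form\<close> compares
  it with the conditions in \<open>Omega\<close>.\<close>

primrec form_upto :: "nat \<Rightarrow> 'm form \<Rightarrow> bool" where
  "form_upto 0 w \<longleftrightarrow> w [] \<in> C"
| "form_upto (Suc n) w \<longleftrightarrow> w [] \<in> C \<and> (\<forall>X. X \<notin> vf \<longrightarrow> iprod X w = 0) \<and>
     (\<forall>X\<in>vf. form_upto n (iprod X w) \<and> iprod X (iprod X w) = 0 \<and>
        (\<forall>Y\<in>vf. iprod (X + Y) w = iprod X w + iprod Y w) \<and>
        (\<forall>f\<in>C. iprod (fmul f X) w = smul f (iprod X w)))"

definition is_form :: "'m form \<Rightarrow> bool" where
  "is_form w \<longleftrightarrow> (\<forall>n. form_upto n w)"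

text \<open>Stripping one argument lowers the bound by one, which a condition at all bounds does not
  notice. This fixed point equation lets later proofs pass to contractions without counting
  arguments.\<close>

lemma form_iff:
  "is_form w \<longleftrightarrow> w [] \<in> C \<and> (\<forall>X. X \<notin> vf \<longrightarrow> iprod X w = 0) \<and>
     (\<forall>X\<in>vf. is_form (iprod X w) \<and> iprod X (iprod X w) = 0 \<and>
        (\<forall>Y\<in>vf. iprod (X + Y) w = iprod X w + iprod Y w) \<and>
        (\<forall>f\<in>C. iprod (fmul f X) w = smul f (iprod X w)))" (is "_ = ?R")
proof
  assume "is_form w"
  then have "\<And>n. form_upto (Suc n) w" by (simp only: is_form_def)
  then show ?R by (auto simp: is_form_def)
next
  assume ?R
  then have "form_upto n w" for n by (cases n) (auto simp: is_form_def)
  then show "is_form w" by (simp add: is_form_def)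
qed

lemma form_Nil: "is_form w \<Longrightarrow> w [] \<in> C"
  and form_iprod_out: "is_form w \<Longrightarrow> X \<notin> vf \<Longrightarrow> iprod X w = 0"
  and form_iprod_iprod: "is_form w \<Longrightarrow> X \<in> vf \<Longrightarrow> iprod X (iprod X w) = 0"
  and form_iprod_add: "is_form w \<Longrightarrow> X \<in> vf \<Longrightarrow> Y \<in> vf \<Longrightarrow> iprod (X + Y) w = iprod X w + iprod Y w"
  and form_iprod_fmul: "is_form w \<Longrightarrow> X \<in> vf \<Longrightarrow> f \<in> C \<Longrightarrow> iprod (fmul f X) w = smul f (iprod X w)"
  by (subst (asm) form_iff, blast)+

lemma form_0 [simp]: "is_form 0"
proof -
  have "form_upto n 0" for n
    by (rule nat.induct[where P = "\<lambda>n. form_upto n 0" and nat = n]) (simp_all add: form_apply)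
  then show ?thesis by (simp add: is_form_def)
qed

lemma form_iprod [simp]: "is_form w \<Longrightarrow> is_form (iprod X w)"
proof (cases "X \<in> vf")
  case True
  moreover assume "is_form w"
  ultimately show ?thesis by (subst (asm) form_iff) blast
qed (simp add: form_iprod_out)

lemma form_iprod_0: "is_form w \<Longrightarrow> iprod 0 w = 0"
  using form_iprod_add[of w 0 0] by simp

text \<open>Polarisation: expand the vanishing double contraction with X + Y.\<close>

lemma form_iprod_swap:
  assumes w: "is_form w" and "X \<in> vf" "Y \<in> vf"
  shows "iprod X (iprod Y w) = - iprod Y (iprod X w)"
  using form_iprod_iprod[OF w, of "X + Y"] assms
  by (simp add: form_iprod_add form_iprod_iprod eq_neg_iff_add_eq_0 add.commute)

lemma form_upto_add: "form_upto n v \<Longrightarrow> form_upto n w \<Longrightarrow> form_upto n (v + w)"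
  by (induction n arbitrary: v w) (simp_all add: form_apply)

lemma form_upto_uminus: "form_upto n w \<Longrightarrow> form_upto n (- w)"
  by (induction n arbitrary: w) (simp_all add: form_apply)

lemma form_upto_diff: "form_upto n v \<Longrightarrow> form_upto n w \<Longrightarrow> form_upto n (v - w)"
  using form_upto_add[of n v "- w"] form_upto_uminus by simp

lemma form_upto_smul: "f \<in> C \<Longrightarrow> form_upto n w \<Longrightarrow> form_upto n (smul f w)"
  by (induction n arbitrary: w) (simp_all add: smul_smul mult.commute)

lemma form_upto_grade_inv: "form_upto n w \<Longrightarrow> form_upto n (grade_inv w)"
  by (induction n arbitrary: w) (simp_all add: form_upto_uminus)

lemma form_add [simp]: "is_form v \<Longrightarrow> is_form w \<Longrightarrow> is_form (v + w)"
  and form_uminus [simp]: "is_form w \<Longrightarrow> is_form (- w)"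
  and form_diff [simp]: "is_form v \<Longrightarrow> is_form w \<Longrightarrow> is_form (v - w)"
  and form_smul [simp]: "f \<in> C \<Longrightarrow> is_form w \<Longrightarrow> is_form (smul f w)"
  and form_grade_inv [simp]: "is_form w \<Longrightarrow> is_form (grade_inv w)"
  by (simp_all add: is_form_def form_upto_add form_upto_uminus form_upto_diff form_upto_smul form_upto_grade_inv)

lemma form_wedge [simp]:
  assumes "is_form v" "is_form w"
  shows "is_form (v \<and>\<^sub>w w)"
proof -
  have "form_upto n (v \<and>\<^sub>w w)" if "is_form v" "is_form w" for n v w
    using that
  proof (induction n arbitrary: v w)
    case 0 then show ?case by (simp add: form_Nil)
  next
    case (Suc n)
    \<comment> \<open>For alternation, contracting twice with X leaves two cross terms
      \<open>grade_inv (iprod X v) \<and>\<^sub>w iprod X w\<close> of opposite sign, because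
      contraction anticommutes with \<open>grade_inv\<close>.\<close>
    then show ?case
      by (simp add: form_Nil form_iprod_out form_iprod_iprod form_iprod_add form_iprod_fmul form_upto_add)
  qed
  then show ?thesis using assms by (simp add: is_form_def)
qed

end

section \<open>Lie derivative, Cartan's formula and its consequences for d\<close>

section \<open>Cartan calculus\<close>

context fun_algebra begin

lemma form_out: "is_form w \<Longrightarrow> \<not> set Xs \<subseteq> vf \<Longrightarrow> w Xs = 0"
proof (induction Xs arbitrary: w)
  case Nil then show ?case by simp
next
  case (Cons X Xs)
  show ?case
  proof (cases "X \<in> vf")
    case True
    then show ?thesis using Cons.IH[of "iprod X w"] Cons.prems by (simp add: Cons_iprod)
  next
    case False
    then show ?thesis using Cons.prems by (simp add: Cons_iprod form_iprod_out form_apply)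
  qed
qed

text \<open>The recursion \<open>i_Y L_X = L_X i_Y - i_[X,Y]\<close> serves as the definition of the Lie derivative.\<close>

primrec lie_list :: "'m vfield \<Rightarrow> 'm vfield list \<Rightarrow> 'm form \<Rightarrow> 'm \<Rightarrow> real" where
  "lie_list X [] w = X (w [])"
| "lie_list X (Y # Ys) w = (if Y \<in> vf then lie_list X Ys (iprod Y w) - w (br X Y # Ys) else 0)"

definition Lie :: "'m vfield \<Rightarrow> 'm form \<Rightarrow> 'm form" where
  "Lie X w = (\<lambda>Ys. lie_list X Ys w)"

lemma Lie_Nil [simp]: "Lie X w [] = X (w [])"
  by (simp add: Lie_def)

lemma iprod_Lie: "Y \<in> vf \<Longrightarrow> iprod Y (Lie X w) = Lie X (iprod Y w) - iprod (br X Y) w"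
  and iprod_Lie_out: "Y \<notin> vf \<Longrightarrow> iprod Y (Lie X w) = 0"
  by (rule ext, simp add: Lie_def iprod_def form_apply)+

lemma lie_simps: "iprod Y (Lie X w) = (if Y \<in> vf then Lie X (iprod Y w) - iprod (br X Y) w else 0)"
  by (simp add: iprod_Lie iprod_Lie_out)

lemma form_ext:
  assumes "\<And>Xs. set Xs \<subseteq> vf \<Longrightarrow> v Xs = w Xs" "\<And>Xs. \<not> set Xs \<subseteq> vf \<Longrightarrow> v Xs = w Xs"
  shows "v = w"
  using assms by - (rule ext, blast)

lemma Lie_out:
  assumes "is_form w" "\<not> set Xs \<subseteq> vf"
  shows "Lie X w Xs = 0"
  using assms
proof (induction Xs arbitrary: w)
  case Nil then show ?case by simp
next
  case (Cons Y Ys)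
  show ?case
  proof (cases "Y \<in> vf")
    case True
    then show ?thesis using Cons.IH[of "iprod Y w"] Cons.prems form_out[of "iprod (br X Y) w" Ys]
      by (simp add: Cons_iprod iprod_Lie form_apply)
  next
    case False
    then show ?thesis by (simp add: Cons_iprod iprod_Lie_out form_apply)
  qed
qed

lemma Lie_add:
  assumes "X \<in> vf" "is_form v" "is_form w"
  shows "Lie X (v + w) = Lie X v + Lie X w"
proof -
  have "\<forall>v w. is_form v \<longrightarrow> is_form w \<longrightarrow> Lie X (v + w) Xs = (Lie X v + Lie X w) Xs" for Xs
    by (rule list.induct[where list = Xs and P = "\<lambda>Xs. \<forall>v w. is_form v \<longrightarrow> is_form w \<longrightarrow>
        Lie X (v + w) Xs = (Lie X v + Lie X w) Xs"], goal_cases)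
      (use assms(1) in \<open>auto simp: form_apply Cons_iprod vf_simps form_Nil lie_simps\<close>)
  then show ?thesis using assms(2,3) by - (rule ext, blast)
qed

lemma Lie_uminus:
  assumes "X \<in> vf" "is_form w"
  shows "Lie X (- w) = - Lie X w"
proof -
  have "\<forall>w. is_form w \<longrightarrow> Lie X (- w) Xs = (- Lie X w) Xs" for Xs
    by (rule list.induct[where list = Xs and P = "\<lambda>Xs. \<forall>w. is_form w \<longrightarrow>
        Lie X (- w) Xs = (- Lie X w) Xs"], goal_cases)
      (use assms(1) in \<open>auto simp: form_apply Cons_iprod vf_simps form_Nil lie_simps\<close>)
  then show ?thesis using assms(2) by - (rule ext, blast)
qed

lemma Lie_0: "X \<in> vf \<Longrightarrow> Lie X 0 = 0"
  using Lie_add[of X 0 0] by simp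

lemma Lie_diff: "X \<in> vf \<Longrightarrow> is_form v \<Longrightarrow> is_form w \<Longrightarrow> Lie X (v - w) = Lie X v - Lie X w"
  using Lie_add[of X v "- w"] by (simp add: Lie_uminus)

lemma Lie_grade_inv:
  assumes "X \<in> vf" "is_form w"
  shows "Lie X (grade_inv w) = grade_inv (Lie X w)"
proof
  fix Xs show "Lie X (grade_inv w) Xs = (grade_inv (Lie X w)) Xs"
    using assms
  proof (induction Xs arbitrary: w)
    case Nil then show ?case by simp
  next
    case (Cons Y Ys)
    then show ?case
      by (cases "Y \<in> vf") (simp_all add: Cons_iprod iprod_Lie iprod_Lie_out form_apply Lie_uminus)
  qed
qed

lemma Lie_smul:
  assumes "X \<in> vf" "f \<in> C" "is_form w"
  shows "Lie X (smul f w) = smul (X f) w + smul f (Lie X w)"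
proof
  fix Xs show "Lie X (smul f w) Xs = (smul (X f) w + smul f (Lie X w)) Xs"
    using assms
  proof (induction Xs arbitrary: w)
    case Nil then show ?case by (simp add: form_apply vf_simps form_Nil)
  next
    case (Cons Y Ys)
    then show ?case
      by (cases "Y \<in> vf") (simp_all add: Cons_iprod iprod_Lie iprod_Lie_out form_iprod_out form_apply)
  qed
qed

lemma form_Lie [simp]:
  assumes "X \<in> vf" "is_form w"
  shows "is_form (Lie X w)"
proof -
  have "form_upto n (Lie X w)" if "is_form w" for n w
    using that
  proof (induction n arbitrary: w)
    case 0 then show ?case using assms(1) by (simp add: form_Nil vf_simps)
  next
    case (Suc n)
    have "form_upto n (Lie X (iprod Y w) - iprod (br X Y) w)" for Y
      using Suc by (simp add: form_upto_diff is_form_def[THEN iffD1, rule_format])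
    \<comment> \<open>The recursion gives L_X i_Y i_Y w minus the two mixed contractions with Y and
      [X,Y], which cancel by anticommutation.\<close>
    moreover have "iprod Y (iprod Y (Lie X w)) = 0" if "Y \<in> vf" for Y
      using assms(1) that Suc.prems form_iprod_swap[of w Y "br X Y"]
      by (simp add: iprod_Lie Lie_0 form_iprod_iprod)
    \<comment> \<open>Linearity over \<open>C\<close> in the contracted field: the derivative of the
      coefficient produced by \<open>Lie_smul\<close> cancels the one produced by
      \<open>br_fmul_right\<close>.\<close>
    ultimately show ?case
      using Suc.prems assms(1)
      by (simp add: form_Nil vf_simps iprod_Lie iprod_Lie_out form_iprod_add form_iprod_fmul Lie_add
          Lie_smul br_add_right br_fmul_right)
  qed
  then show ?thesis using assms by (simp add: is_form_def)
qed

lemma Lie_wedge: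
  assumes "X \<in> vf" "is_form v" "is_form w"
  shows "Lie X (v \<and>\<^sub>w w) = Lie X v \<and>\<^sub>w w + v \<and>\<^sub>w Lie X w"
proof
  fix Xs show "Lie X (v \<and>\<^sub>w w) Xs = (Lie X v \<and>\<^sub>w w + v \<and>\<^sub>w Lie X w) Xs"
    using assms
  proof (induction Xs arbitrary: v w)
    case Nil then show ?case by (simp add: form_apply vf_simps form_Nil)
  next
    case (Cons Y Ys)
    then show ?case
      by (cases "Y \<in> vf")
        (simp_all add: Cons_iprod iprod_Lie iprod_Lie_out form_iprod_out form_apply Lie_add Lie_grade_inv
          algebra_simps)
  qed
qed

lemma Lie_add_left:
  assumes "X \<in> vf" "Y \<in> vf" "is_form w"
  shows "Lie (X + Y) w = Lie X w + Lie Y w"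
proof
  fix Xs show "Lie (X + Y) w Xs = (Lie X w + Lie Y w) Xs"
    using assms
  proof (induction Xs arbitrary: w)
    case Nil then show ?case by (simp add: form_apply vfield_apply)
  next
    case (Cons Z Zs)
    then show ?case
      by (cases "Z \<in> vf")
        (simp_all add: Cons_iprod iprod_Lie iprod_Lie_out form_apply br_add_left form_iprod_add)
  qed
qed

text \<open>After contraction with Z, mixed terms cancel and the hypothesis covers
  \<open>iprod Z w\<close>; the contractions with iterated brackets that remain match by the Jacobi
  identity.\<close>

lemma Lie_bracket:
  assumes "X \<in> vf" "Y \<in> vf" "is_form w"
  shows "Lie (br X Y) w = Lie X (Lie Y w) - Lie Y (Lie X w)"
proof
  fix Xs show "Lie (br X Y) w Xs = (Lie X (Lie Y w) - Lie Y (Lie X w)) Xs"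
    using assms
  proof (induction Xs arbitrary: w)
    case Nil then show ?case by (simp add: form_apply lie_bracket_def)
  next
    case (Cons Z Zs)
    then show ?case
      by (cases "Z \<in> vf")
        (simp_all add: Cons_iprod iprod_Lie iprod_Lie_out form_apply form_iprod_add Lie_diff br_jacobi[of X Y Z])
  qed
qed

lemma nths_compl_Cons:
  "nths (Y # Ys) (- {0}) = Ys"
  "nths (Y # Ys) (- {Suc j}) = Y # nths Ys (- {j})"
  "nths (Y # Ys) (- {0, Suc j}) = nths Ys (- {j})"
  "nths (Y # Ys) (- {Suc i, Suc j}) = Y # nths Ys (- {i, j})"
proof -
  have "{i. Suc i \<in> - {0}} = UNIV" "{i. Suc i \<in> - {Suc j}} = - {j}" "{i. Suc i \<in> - {0, Suc j}} = - {j}"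
    "{k. Suc k \<in> - {Suc i, Suc j}} = - {i, j}" by auto
  then show "nths (Y # Ys) (- {0}) = Ys"
    "nths (Y # Ys) (- {Suc j}) = Y # nths Ys (- {j})"
    "nths (Y # Ys) (- {0, Suc j}) = nths Ys (- {j})"
    "nths (Y # Ys) (- {Suc i, Suc j}) = Y # nths Ys (- {i, j})"
    by (simp_all add: nths_Cons nths_all)
qed

text \<open>The closed formula allows the recursive Lie derivative to be recognised inside the
  Koszul formula. In the induction the new head Y is brought in front of the bracket, and the sign
  of this swap is absorbed by the shift of j.\<close>

lemma Lie_explicit:
  assumes "X \<in> vf" "is_form w" "set Ys \<subseteq> vf"
  shows "Lie X w Ys = X (w Ys) -
    (\<Sum>j<length Ys. (-1) ^ j * w (br X (Ys ! j) # nths Ys (- {j})))"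
  using assms(2,3)
proof (induction Ys arbitrary: w)
  case Nil then show ?case by simp
next
  case (Cons Y Ys)
  have "(-1) ^ Suc j * w (br X (Ys ! j) # Y # L) = (-1) ^ j * iprod Y w (br X (Ys ! j) # L)"
    if "j < length Ys" for j L
  proof -
    have "Ys ! j \<in> vf" using Cons.prems that by (auto dest: nth_mem)
    then show ?thesis
      using form_iprod_swap[of w "br X (Ys ! j)" Y] Cons.prems assms(1) by (simp add: Cons_iprod form_apply)
  qed
  then have "(\<Sum>j<length Ys. (-1) ^ Suc j * w (br X (Ys ! j) # Y # nths Ys (- {j}))) =
      (\<Sum>j<length Ys. (-1) ^ j * iprod Y w (br X (Ys ! j) # nths Ys (- {j})))"
    by (intro sum.cong) auto
  moreover have "Lie X w (Y # Ys) = Lie X (iprod Y w) Ys - w (br X Y # Ys)"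
    using Cons.prems by (simp add: Cons_iprod iprod_Lie form_apply)
  moreover have "X (w (Y # Ys)) = X (iprod Y w Ys)" by (simp add: iprod_def)
  ultimately show ?case
    using Cons.IH[of "iprod Y w"] Cons.prems
    by (simp add: sum.lessThan_Suc_shift nths_compl_Cons del: sum.lessThan_Suc power_Suc)
qed

lemma d_Nil [simp]: "d w [] = 0"
  by (simp add: ext_d_def)

lemma d_out: "\<not> set Xs \<subseteq> vf \<Longrightarrow> d w Xs = 0"
  by (simp add: ext_d_def)

lemma iprod_d_out: "X \<notin> vf \<Longrightarrow> iprod X (d w) = 0"
  by (rule ext) (simp add: iprod_def ext_d_def form_apply)

text \<open>Pairs containing the first position are separated because they give the bracket terms of
  the Lie derivative; the others give those of \<open>d (iprod X w)\<close>.\<close>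

lemma sum_pairs_Suc:
  fixes F :: "nat \<Rightarrow> nat \<Rightarrow> 'b::comm_monoid_add"
  shows "(\<Sum>(i, j)\<in>{(i, j). i < j \<and> j < Suc n}. F i j) =
    (\<Sum>j<n. F 0 (Suc j)) + (\<Sum>(i, j)\<in>{(i, j). i < j \<and> j < n}. F (Suc i) (Suc j))"
proof -
  let ?A = "(\<lambda>j. (0::nat, Suc j)) ` {..<n}" and ?B = "map_prod Suc Suc ` {(i, j). i < j \<and> j < n}"
  have "{(i, j). i < j \<and> j < Suc n} = ?A \<union> ?B"
  proof (intro set_eqI iffI)
    fix x assume "x \<in> {(i, j). i < j \<and> j < Suc n}"
    then obtain i j where "x = (i, j)" "i < j" "j < Suc n" by auto
    then show "x \<in> ?A \<union> ?B" by (cases i; cases j) (auto simp: image_iff)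
  qed auto
  moreover have fin: "finite {(i, j). i < j \<and> j < n}"
    by (rule finite_subset[of _ "{..<n} \<times> {..<n}"]) auto
  moreover have "?A \<inter> ?B = {}" by auto
  ultimately have "(\<Sum>(i, j)\<in>{(i, j). i < j \<and> j < Suc n}. F i j) =
      (\<Sum>(i, j)\<in>?A. F i j) + (\<Sum>(i, j)\<in>?B. F i j)"
    by (simp add: sum.union_disjoint)
  also have "(\<Sum>(i, j)\<in>?A. F i j) = (\<Sum>j<n. F 0 (Suc j))"
    by (subst sum.reindex) (auto simp: inj_on_def)
  also have "(\<Sum>(i, j)\<in>?B. F i j) = (\<Sum>(i, j)\<in>{(i, j). i < j \<and> j < n}. F (Suc i) (Suc j))"
    by (subst sum.reindex) (auto simp: inj_on_def intro!: sum.cong)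
  finally show ?thesis .
qed

text \<open>In the Koszul sum for X # Ys the term i = 0 and the pairs (0, j) form
  \<open>Lie X w\<close>. Every other term is the negative of a term of
  \<open>d (iprod X w)\<close>: for the derivative terms through the shifted exponent, for the
  bracket terms because X must be moved in front of the bracket.\<close>

lemma cartan:
  assumes X: "X \<in> vf" and w: "is_form w"
  shows "iprod X (d w) = Lie X w - d (iprod X w)"
proof (rule form_ext)
  fix Ys assume "\<not> set Ys \<subseteq> vf"
  then show "iprod X (d w) Ys = (Lie X w - d (iprod X w)) Ys"
    using assms Lie_out[of w Ys X] by (simp add: d_out form_apply) (simp add: iprod_def d_out)
next
  fix Ys assume Ys: "set Ys \<subseteq> vf"
  let ?n = "length Ys"
  let ?P = "{(i, j). i < j \<and> j < ?n}"
  have sw: "w (br (Ys ! i) (Ys ! j) # X # L) = - iprod X w (br (Ys ! i) (Ys ! j) # L)"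
    if "i < j" "j < ?n" for i j L
  proof -
    have "Ys ! i \<in> vf" "Ys ! j \<in> vf" using Ys that by (auto dest: nth_mem)
    then show ?thesis
      using form_iprod_swap[of w X "br (Ys ! i) (Ys ! j)"] X w by (simp add: Cons_iprod form_apply)
  qed
  have "iprod X (d w) Ys = d w (X # Ys)" by (simp add: iprod_def)
  also have "\<dots> = X (w Ys) + (\<Sum>i<?n. (-1) ^ Suc i * (Ys ! i) (w (X # nths Ys (- {i})))) +
      ((\<Sum>j<?n. (-1) ^ Suc j * w (br X (Ys ! j) # nths Ys (- {j}))) +
       (\<Sum>(i, j)\<in>?P. (-1) ^ (Suc i + Suc j) * w (br (Ys ! i) (Ys ! j) # X # nths Ys (- {i, j}))))"
    using X Ys by (simp add: ext_d_def sum.lessThan_Suc_shift sum_pairs_Suc nths_compl_Cons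
        del: sum.lessThan_Suc power_Suc)
  also have "(\<Sum>(i, j)\<in>?P. (-1) ^ (Suc i + Suc j) * w (br (Ys ! i) (Ys ! j) # X # nths Ys (- {i, j}))) =
      - (\<Sum>(i, j)\<in>?P. (-1) ^ (i + j) * iprod X w (br (Ys ! i) (Ys ! j) # nths Ys (- {i, j})))"
    unfolding sum_negf[symmetric] by (intro sum.cong) (auto simp: sw)
  also have "X (w Ys) + (\<Sum>i<?n. (-1) ^ Suc i * (Ys ! i) (w (X # nths Ys (- {i})))) +
      ((\<Sum>j<?n. (-1) ^ Suc j * w (br X (Ys ! j) # nths Ys (- {j}))) + - (\<Sum>(i, j)\<in>?P.
        (-1) ^ (i + j) * iprod X w (br (Ys ! i) (Ys ! j) # nths Ys (- {i, j})))) =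
      (Lie X w - d (iprod X w)) Ys"
    using Ys by (simp add: form_apply Lie_explicit[OF X w Ys] ext_d_def sum_negf iprod_def[of X w])
  finally show "iprod X (d w) Ys = (Lie X w - d (iprod X w)) Ys" .
qed

text \<open>Cartan's formula turns a contraction of \<open>d\<close> into the Lie derivative and
  \<open>d\<close> of a contracted form. So identities for \<open>d\<close> follow from those for
  \<open>Lie\<close> by induction on the arguments; on the empty list \<open>d\<close>
  vanishes.\<close>

lemma d_add:
  assumes "is_form v" "is_form w"
  shows "d (v + w) = d v + d w"
proof -
  have "\<forall>v w. is_form v \<longrightarrow> is_form w \<longrightarrow> d (v + w) Xs = (d v + d w) Xs" for Xs
  proof (rule list.induct[where list = Xs and P = "\<lambda>Xs. \<forall>v w. is_form v \<longrightarrow> is_form w \<longrightarrow>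
        d (v + w) Xs = (d v + d w) Xs"], goal_cases)
    case (2 Y Ys) then show ?case
      by (cases "Y \<in> vf") (simp_all add: form_apply Cons_iprod cartan iprod_d_out Lie_add)
  qed (simp add: form_apply)
  then show ?thesis using assms by - (rule ext, blast)
qed

lemma d_0 [simp]: "d 0 = 0"
  using d_add[of 0 0] by simp

lemma d_uminus: "is_form w \<Longrightarrow> d (- w) = - d w"
  using d_add[of w "- w"] by (simp add: eq_neg_iff_add_eq_0 add.commute)

lemma d_diff: "is_form v \<Longrightarrow> is_form w \<Longrightarrow> d (v - w) = d v - d w"
  using d_add[of v "- w"] by (simp add: d_uminus)

lemma d_grade_inv:
  assumes "is_form w"
  shows "d (grade_inv w) = - grade_inv (d w)"
proof
  fix Xs show "d (grade_inv w) Xs = (- grade_inv (d w)) Xs"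
    using assms
  proof (induction Xs arbitrary: w)
    case Nil then show ?case by (simp add: form_apply)
  next
    case (Cons Y Ys)
    then show ?case
      by (cases "Y \<in> vf") (simp_all add: Cons_iprod cartan iprod_d_out form_apply Lie_grade_inv d_uminus)
  qed
qed

text \<open>Contracted, the left side is the Leibniz rule for \<open>Lie\<close> minus
  \<open>d\<close> of the two products from \<open>iprod_wedge\<close>. One of these contains
  \<open>grade_inv v\<close>, which is why the induction ranges over all forms and
  \<open>d_grade_inv\<close> comes first.\<close>

lemma d_wedge:
  assumes "is_form v" "is_form w"
  shows "d (v \<and>\<^sub>w w) = d v \<and>\<^sub>w w + grade_inv v \<and>\<^sub>w d w"
proof
  fix Xs show "d (v \<and>\<^sub>w w) Xs = (d v \<and>\<^sub>w w + grade_inv v \<and>\<^sub>w d w) Xs"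
    using assms
  proof (induction Xs arbitrary: v w)
    case Nil then show ?case by (simp add: form_apply)
  next
    case (Cons Y Ys)
    then show ?case
      by (cases "Y \<in> vf")
        (simp_all add: Cons_iprod cartan iprod_d_out form_iprod_out form_apply Lie_wedge d_add d_grade_inv
          algebra_simps)
  qed
qed

text \<open>Functions as forms of degree 0; \<open>d (scal f)\<close> is then the differential of
  f.\<close>

definition scal :: "('m \<Rightarrow> real) \<Rightarrow> 'm form" where
  "scal f = (\<lambda>Xs. if Xs = [] then f else 0)"

lemma scal_Nil [simp]: "scal f [] = f" and iprod_scal [simp]: "iprod X (scal f) = 0"
  by (auto simp: scal_def iprod_def zero_fun_def)

lemma form_scal [simp]: "f \<in> C \<Longrightarrow> is_form (scal f)"
  by (subst form_iff) simp

lemma grade_inv_scal [simp]: "grade_inv (scal f) = scal f"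
  by (rule ext) (simp add: grade_inv_def scal_def)

lemma scal_wedge [simp]: "scal f \<and>\<^sub>w w = smul f w"
proof
  fix Xs show "(scal f \<and>\<^sub>w w) Xs = smul f w Xs"
  proof (induction Xs arbitrary: w)
    case Nil show ?case by simp
  next
    case (Cons X Xs) then show ?case by (simp add: Cons_iprod form_apply)
  qed
qed

lemma Lie_scal: 
  assumes "X \<in> vf"
  shows "Lie X (scal f) = scal (X f)"
proof
  fix Xs show "Lie X (scal f) Xs = scal (X f) Xs"
    by (cases Xs) (simp, cases "hd Xs \<in> vf", simp_all add: Cons_iprod iprod_Lie iprod_Lie_out assms Lie_0)
qed

lemma iprod_d_scal: "X \<in> vf \<Longrightarrow> f \<in> C \<Longrightarrow> iprod X (d (scal f)) = scal (X f)"
  by (simp add: cartan Lie_scal)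

lemma d_smul: "f \<in> C \<Longrightarrow> is_form w \<Longrightarrow> d (smul f w) = d (scal f) \<and>\<^sub>w w + smul f (d w)"
  using d_wedge[of "scal f" w] by simp

lemma grade_inv_d_scal: "f \<in> C \<Longrightarrow> grade_inv (d (scal f)) = - d (scal f)"
  using d_grade_inv[of "scal f"] by (metis form_scal minus_minus grade_inv_scal)

text \<open>The term that breaks linearity over \<open>C\<close> in the field is exactly the one
  that \<open>d_smul\<close> produces in \<open>d (smul f (iprod X w))\<close>, so the two cancel in
  Cartan's formula and \<open>d w\<close> is linear in its first argument.\<close>

lemma Lie_fmul:
  assumes "X \<in> vf" "f \<in> C" "is_form w"
  shows "Lie (fmul f X) w = smul f (Lie X w) + d (scal f) \<and>\<^sub>w iprod X w"
proof
  fix Xs show "Lie (fmul f X) w Xs = (smul f (Lie X w) + d (scal f) \<and>\<^sub>w iprod X w) Xs"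
    using assms
  proof (induction Xs arbitrary: w)
    case Nil then show ?case by (simp add: form_apply fmul_def)
  next
    case (Cons Y Ys)
    show ?case
    proof (cases "Y \<in> vf")
      case True
      then show ?thesis
        using Cons form_iprod_swap[of w X Y]
        by (simp add: Cons_iprod iprod_Lie form_apply br_fmul_left form_iprod_add form_iprod_fmul vf_simps
          iprod_d_scal grade_inv_d_scal smul_uminus_left)
    next
      case False
      then show ?thesis
        using Cons by (simp add: Cons_iprod iprod_Lie_out iprod_d_out form_iprod_out form_apply)
    qed
  qed
qed

lemma form_d [simp]:
  assumes "is_form w"
  shows "is_form (d w)"
proof -
  have "form_upto n (d w)" if "is_form w" for n w
    using that
  proof (induction n arbitrary: w)
    case 0 then show ?case by (simp add: form_Nil)
  next
    case (Suc n)
    have "form_upto n (Lie X w - d (iprod X w))" if "X \<in> vf" for X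
      using Suc that by (simp add: form_upto_diff is_form_def[THEN iffD1, rule_format])
    \<comment> \<open>Both i_X L_X w and i_X d i_X w equal L_X i_X w: the bracket [X,X] is zero, and
      so is the double contraction.\<close>
    moreover have "iprod X (iprod X (d w)) = 0" if "X \<in> vf" for X
      using that Suc.prems by (simp add: cartan iprod_Lie br_self form_iprod_0 form_iprod_iprod)
    ultimately show ?case
      using Suc.prems by (simp add: cartan iprod_d_out form_iprod_add form_iprod_fmul Lie_add_left d_add
          Lie_fmul d_smul)
  qed
  then show ?thesis using assms by (simp add: is_form_def)
qed

text \<open>Contraction with Y and Cartan's formula leave the commutator of L_X and L_Y, which is
  L_[X,Y], and the claim for \<open>iprod Y w\<close>.\<close>

lemma d_Lie:
  assumes "X \<in> vf" "is_form w"
  shows "Lie X (d w) = d (Lie X w)"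
proof
  fix Xs show "Lie X (d w) Xs = d (Lie X w) Xs"
    using assms
  proof (induction Xs arbitrary: w)
    case Nil then show ?case by (simp add: vf_zero)
  next
    case (Cons Y Ys)
    then show ?case
      by (cases "Y \<in> vf") (simp_all add: Cons_iprod cartan iprod_Lie iprod_Lie_out iprod_d_out form_apply
          Lie_diff d_diff Lie_bracket)
  qed
qed

text \<open>Cartan's formula applied twice shows that i_Y d d w is d d i_Y w up to the commutator of
  L_Y and d, which is zero.\<close>

lemma d_d:
  assumes "is_form w"
  shows "d (d w) = 0"
proof
  fix Xs show "d (d w) Xs = 0 Xs"
    using assms
  proof (induction Xs arbitrary: w)
    case Nil then show ?case by (simp add: form_apply)
  next
    case (Cons Y Ys)
    then show ?case
      by (cases "Y \<in> vf") (simp_all add: Cons_iprod cartan iprod_d_out form_apply d_Lie d_diff)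
  qed
qed

end

section \<open>Comparison with \<open>Omega\<close>, and the degrees of d and of wedge
  products\<close>

section \<open>Homogeneous components\<close>

context fun_algebra begin

definition alt_form :: "'m form \<Rightarrow> bool" where
  "alt_form w \<longleftrightarrow> (\<forall>Xs. \<not> set Xs \<subseteq> vf \<longrightarrow> w Xs = 0) \<and>
     (\<forall>Xs. set Xs \<subseteq> vf \<longrightarrow> w Xs \<in> C \<and>
        (\<forall>i j. i < j \<and> j < length Xs \<and> Xs ! i = Xs ! j \<longrightarrow> w Xs = 0) \<and>
        (\<forall>i<length Xs. \<forall>X\<in>vf.
           (\<forall>Y\<in>vf. w (Xs[i := X + Y]) = w (Xs[i := X]) + w (Xs[i := Y])) \<and>
           (\<forall>f\<in>C. w (Xs[i := fmul f X]) = f * w (Xs[i := X]))))"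

lemma Omega_alt_form:
  "Omega C p = {w. alt_form w \<and> (\<forall>Xs. int (length Xs) \<noteq> p \<longrightarrow> w Xs = 0)}"
  unfolding Omega_def alt_form_def fmul_def by blast

lemma alt_formD:
  assumes "alt_form w"
  shows "\<not> set Xs \<subseteq> vf \<Longrightarrow> w Xs = 0"
    and "set Xs \<subseteq> vf \<Longrightarrow> w Xs \<in> C"
    and "set Xs \<subseteq> vf \<Longrightarrow> i < j \<Longrightarrow> j < length Xs \<Longrightarrow> Xs ! i = Xs ! j \<Longrightarrow> w Xs = 0"
    and "set Xs \<subseteq> vf \<Longrightarrow> i < length Xs \<Longrightarrow> X \<in> vf \<Longrightarrow> Y \<in> vf \<Longrightarrow>
      w (Xs[i := X + Y]) = w (Xs[i := X]) + w (Xs[i := Y])"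
    and "set Xs \<subseteq> vf \<Longrightarrow> i < length Xs \<Longrightarrow> X \<in> vf \<Longrightarrow> f \<in> C \<Longrightarrow>
      w (Xs[i := fmul f X]) = f * w (Xs[i := X])"
  using assms unfolding alt_form_def by blast+

lemma alt_form_iprod:
  assumes "alt_form w" "X \<in> vf"
  shows "alt_form (iprod X w)"
  unfolding alt_form_def
proof (intro conjI allI impI ballI)
  fix Xs assume "\<not> set Xs \<subseteq> vf"
  then show "iprod X w Xs = 0" using alt_formD(1)[OF assms(1), of "X # Xs"] by (simp add: iprod_def)
next
  fix Xs assume Xs: "set Xs \<subseteq> vf"
  then have XXs: "set (X # Xs) \<subseteq> vf" using assms by simp
  then show "iprod X w Xs \<in> C" using alt_formD(2)[OF assms(1)] by (simp add: iprod_def)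
  show "iprod X w Xs = 0" if "i < j \<and> j < length Xs \<and> Xs ! i = Xs ! j" for i j
    using alt_formD(3)[OF assms(1) XXs, of "Suc i" "Suc j"] that by (simp add: iprod_def)
  fix i Y assume "i < length Xs" "Y \<in> vf"
  then show "iprod X w (Xs[i := Y + Z]) = iprod X w (Xs[i := Y]) + iprod X w (Xs[i := Z])" if "Z \<in> vf" for Z
    using alt_formD(4)[OF assms(1) XXs, of "Suc i"] that by (simp add: iprod_def)
  show "iprod X w (Xs[i := fmul f Y]) = f * iprod X w (Xs[i := Y])" if "f \<in> C" for f
    using alt_formD(5)[OF assms(1) XXs, of "Suc i"] that \<open>i < length Xs\<close> \<open>Y \<in> vf\<close> by (simp add: iprod_def)
qed

lemma alt_form_imp_form:
  assumes "alt_form w"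
  shows "is_form w"
proof -
  have "form_upto n w" if "alt_form w" for n w
    using that
  proof (induction n arbitrary: w)
    case 0 then show ?case using alt_formD(2)[of w "[]"] by simp
  next
    case (Suc n)
    note w = alt_formD[OF Suc.prems]
    have "iprod X w = 0" if "X \<notin> vf" for X
      by (rule ext) (use w(1) that in \<open>simp add: iprod_def form_apply\<close>)
    moreover have "iprod X (iprod X w) = 0" if "X \<in> vf" for X
    proof (rule form_ext)
      fix Xs
      show "iprod X (iprod X w) Xs = 0 Xs" if "set Xs \<subseteq> vf"
        using w(3)[of "X # X # Xs" 0 1] that \<open>X \<in> vf\<close> by (simp add: iprod_def form_apply)
      show "iprod X (iprod X w) Xs = 0 Xs" if "\<not> set Xs \<subseteq> vf"
        using w(1)[of "X # X # Xs"] that by (simp add: iprod_def form_apply)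
    qed
    moreover have "iprod (X + Y) w = iprod X w + iprod Y w" if "X \<in> vf" "Y \<in> vf" for X Y
    proof (rule form_ext)
      fix Xs
      show "iprod (X + Y) w Xs = (iprod X w + iprod Y w) Xs" if "set Xs \<subseteq> vf"
        using w(4)[of "X # Xs" 0 X Y] that \<open>X \<in> vf\<close> \<open>Y \<in> vf\<close> by (simp add: iprod_def form_apply)
      show "iprod (X + Y) w Xs = (iprod X w + iprod Y w) Xs" if "\<not> set Xs \<subseteq> vf"
        using that by (simp add: iprod_def form_apply w(1))
    qed
    moreover have "iprod (fmul f X) w = smul f (iprod X w)" if "X \<in> vf" "f \<in> C" for X f
    proof (rule form_ext)
      fix Xs
      show "iprod (fmul f X) w Xs = smul f (iprod X w) Xs" if "set Xs \<subseteq> vf"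
        using w(5)[of "X # Xs" 0 X f] that \<open>X \<in> vf\<close> \<open>f \<in> C\<close> by (simp add: iprod_def smul_def)
      show "iprod (fmul f X) w Xs = smul f (iprod X w) Xs" if "\<not> set Xs \<subseteq> vf"
        using that by (simp add: iprod_def smul_def w(1))
    qed
    moreover have "w [] \<in> C" using w(2)[of "[]"] by simp
    ultimately show ?case using Suc.IH alt_form_iprod[OF Suc.prems] by simp
  qed
  then show ?thesis using assms by (simp add: is_form_def)
qed

lemma form_in_C: "is_form w \<Longrightarrow> w Xs \<in> C"
proof (induction Xs arbitrary: w)
  case Nil then show ?case by (simp add: form_Nil)
next
  case (Cons X Xs) then show ?case by (simp add: Cons_iprod)
qed

text \<open>X is moved past heads different from it, at the cost of a sign, until it meets its
  copy.\<close>

lemma form_repeat_head: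
  assumes "is_form w" "X \<in> set Ys" "set Ys \<subseteq> vf"
  shows "iprod X w Ys = 0"
  using assms
proof (induction Ys arbitrary: w)
  case Nil then show ?case by simp
next
  case (Cons Y Ys)
  show ?case
  proof (cases "X = Y")
    case True
    then show ?thesis using Cons.prems by (simp add: Cons_iprod form_iprod_iprod form_apply)
  next
    case False
    then have "iprod X (iprod Y w) Ys = 0" "X \<in> vf" "Y \<in> vf" using Cons by auto
    then show ?thesis
      using form_iprod_swap[of w Y X] Cons.prems by (simp add: Cons_iprod form_apply)
  qed
qed

lemma form_repeat:
  assumes "is_form w" "set Xs \<subseteq> vf" "i < j" "j < length Xs" "Xs ! i = Xs ! j"
  shows "w Xs = 0"
  using assms
proof (induction Xs arbitrary: w i j)
  case Nil then show ?case by simp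
next
  case (Cons X Xs)
  then obtain j' where j: "j = Suc j'" by (cases j) auto
  show ?case
  proof (cases i)
    case 0
    then have "X \<in> set Xs" using Cons.prems j by auto
    then show ?thesis using form_repeat_head[of w X Xs] Cons.prems by (simp add: Cons_iprod)
  next
    case (Suc i')
    then show ?thesis using Cons.IH[of "iprod X w" i' j'] Cons.prems j by (simp add: Cons_iprod)
  qed
qed

lemma form_slot:
  assumes "is_form w" "set Xs \<subseteq> vf" "i < length Xs" "X \<in> vf"
  shows "Y \<in> vf \<Longrightarrow> w (Xs[i := X + Y]) = w (Xs[i := X]) + w (Xs[i := Y])"
    and "f \<in> C \<Longrightarrow> w (Xs[i := fmul f X]) = f * w (Xs[i := X])"
proof -
  have "(Y \<in> vf \<longrightarrow> w (Xs[i := X + Y]) = w (Xs[i := X]) + w (Xs[i := Y])) \<and>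
      (f \<in> C \<longrightarrow> w (Xs[i := fmul f X]) = f * w (Xs[i := X]))"
    using assms(1-3)
  proof (induction Xs arbitrary: w i)
    case Nil then show ?case by simp
  next
    case (Cons Z Zs)
    then show ?case
      using assms(4) Cons.IH[of "iprod Z w" "i - 1"]
      by (cases i) (simp_all add: Cons_iprod form_iprod_add form_iprod_fmul form_apply smul_def)
  qed
  then show "Y \<in> vf \<Longrightarrow> w (Xs[i := X + Y]) = w (Xs[i := X]) + w (Xs[i := Y])"
    and "f \<in> C \<Longrightarrow> w (Xs[i := fmul f X]) = f * w (Xs[i := X])" by blast+
qed

lemma form_iff_alt_form: "is_form w \<longleftrightarrow> alt_form w"
proof
  assume w: "is_form w"
  show "alt_form w"
    unfolding alt_form_def
  proof (intro conjI allI impI ballI)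
    show "w Xs = 0" if "\<not> set Xs \<subseteq> vf" for Xs using form_out[OF w that] .
    show "w Xs \<in> C" for Xs using form_in_C[OF w] .
    show "w Xs = 0" if "set Xs \<subseteq> vf" "i < j \<and> j < length Xs \<and> Xs ! i = Xs ! j" for Xs i j
      using form_repeat[OF w that(1)] that(2) by blast
  qed (use form_slot[OF w] in simp_all)
qed (rule alt_form_imp_form)

lemma Omega_iff: "w \<in> Omega C p \<longleftrightarrow> is_form w \<and> (\<forall>Xs. int (length Xs) \<noteq> p \<longrightarrow> w Xs = 0)"
  by (simp add: Omega_alt_form form_iff_alt_form)

lemma hom_part_Omega: "w \<in> Omega C p \<Longrightarrow> hom_part k w = (if k = p then w else 0)"
  by (rule ext) (auto simp: Omega_iff hom_part_def form_apply)

lemma hom_part_add [simp]: "hom_part k (v + w) = hom_part k v + hom_part k w"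
  and hom_part_uminus [simp]: "hom_part k (- w) = - hom_part k w"
  and hom_part_diff [simp]: "hom_part k (v - w) = hom_part k v - hom_part k w"
  and hom_part_0 [simp]: "hom_part k (0 :: 'm form) = 0"
  by (rule ext, simp add: hom_part_def form_apply)+

lemma iprod_hom_part: "iprod X (hom_part k w) = hom_part (k - 1) (iprod X w)"
  by (rule ext) (auto simp: iprod_def hom_part_def)

lemma hom_part_in_Omega: "is_form w \<Longrightarrow> hom_part k w \<in> Omega C k"
proof -
  have "form_upto n (hom_part k w)" if "is_form w" for n k w
    using that
  proof (induction n arbitrary: k w)
    case 0 then show ?case by (simp add: hom_part_def form_Nil)
  next
    case (Suc n)
    have "iprod X (iprod X (hom_part k w)) = 0" if "X \<in> vf" for X
      using Suc.prems that by (simp add: iprod_hom_part form_iprod_iprod)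
    moreover have "smul f (hom_part k w) = hom_part k (smul f w)" for f k and w :: "'m form"
      by (rule ext) (simp add: smul_def hom_part_def)
    ultimately show ?case
      using Suc by (simp add: iprod_hom_part form_iprod_out form_iprod_add form_iprod_fmul)
        (simp add: hom_part_def form_Nil)
  qed
  moreover assume "is_form w"
  ultimately have "is_form (hom_part k w)" by (simp add: is_form_def)
  then show ?thesis by (simp add: Omega_iff hom_part_def)
qed

text \<open>Each condition on an alternating multilinear map compares values on lists of one length,
  so it can be read off in the component of that degree.\<close>

lemma Omega_all_iff: "w \<in> Omega_all C \<longleftrightarrow> is_form w \<and> finite {k. hom_part k w \<noteq> 0}"
proof -
  have "is_form w" if "\<And>k. hom_part k w \<in> Omega C k"
  proof -
    have eq: "hom_part (int (length Xs)) w Ys = w Ys" if "length Ys = length Xs" for Xs Ys :: "'m vfield list"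
      using that by (simp add: hom_part_def)
    have "alt_form (hom_part k w)" for k using that[of k] by (simp add: Omega_alt_form)
    note A = alt_formD[OF this]
    have "alt_form w"
      unfolding alt_form_def
    proof (intro conjI allI impI ballI)
      fix Xs :: "'m vfield list"
      let ?k = "int (length Xs)"
      show "w Xs = 0" if "\<not> set Xs \<subseteq> vf" using A(1)[OF that, of ?k] by (simp add: eq)
      assume Xs: "set Xs \<subseteq> vf"
      show "w Xs \<in> C" using A(2)[OF Xs, of ?k] by (simp add: eq)
      show "w Xs = 0" if "i < j \<and> j < length Xs \<and> Xs ! i = Xs ! j" for i j
        using A(3)[OF Xs, of i j ?k] that by (simp add: eq)
      fix i Y assume i: "i < length Xs" and Y: "Y \<in> vf"
      show "w (Xs[i := Y + Z]) = w (Xs[i := Y]) + w (Xs[i := Z])" if "Z \<in> vf" for Z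
        using A(4)[OF Xs i Y that, of ?k] by (simp add: eq)
      show "w (Xs[i := fmul f Y]) = f * w (Xs[i := Y])" if "f \<in> C" for f
        using A(5)[OF Xs i Y that, of ?k] by (simp add: eq)
    qed
    then show ?thesis by (rule alt_form_imp_form)
  qed
  then show ?thesis using hom_part_in_Omega by (auto simp: Omega_all_def)
qed

text \<open>Each term of the Koszul formula evaluates w on a list with one entry fewer.\<close>

lemma hom_part_d:
  assumes "is_form w"
  shows "hom_part k (d w) = d (hom_part (k - 1) w)"
proof
  fix Xs show "hom_part k (d w) Xs = d (hom_part (k - 1) w) Xs"
  proof (cases "set Xs \<subseteq> vf")
    case True
    have len: "i < length Xs \<Longrightarrow> length (nths Xs (- {i})) = length Xs - 1" for i
    proof -
      assume "i < length Xs"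
      then have "{k. k < length Xs \<and> k \<in> - {i}} = {..<length Xs} - {i}" by auto
      then show ?thesis using \<open>i < length Xs\<close> by (simp add: length_nths)
    qed
    have len2: "i < j \<Longrightarrow> j < length Xs \<Longrightarrow> Suc (length (nths Xs (- {i, j}))) = length Xs - 1" for i j
    proof -
      assume *: "i < j" "j < length Xs"
      then have "{k. k < length Xs \<and> k \<in> - {i, j}} = {..<length Xs} - {i, j}" by auto
      then show ?thesis using * by (simp add: length_nths card_Diff_subset)
    qed
    \<comment> \<open>The subtraction truncates only for the empty list, where both Koszul sums are
      empty.\<close>
    have h: "int (length Xs - 1) = k - 1 \<longleftrightarrow> int (length Xs) = k" if "0 < length Xs"
      using that by linarith
    have a: "(\<Sum>i<length Xs. (-1) ^ i * (Xs ! i) (hom_part (k - 1) w (nths Xs (- {i})))) =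
        (if int (length Xs) = k then (\<Sum>i<length Xs. (-1) ^ i * (Xs ! i) (w (nths Xs (- {i})))) else 0)"
    proof (cases "int (length Xs) = k")
      case True
      then show ?thesis by (auto intro!: sum.cong simp: hom_part_def len h)
    next
      case False
      have "(-1) ^ i * (Xs ! i) (hom_part (k - 1) w (nths Xs (- {i}))) = 0" if "i < length Xs" for i
      proof -
        have "Xs ! i \<in> vf" using \<open>set Xs \<subseteq> vf\<close> that by (auto dest: nth_mem)
        moreover have "int (length Xs - 1) \<noteq> k - 1" using False that by linarith
        ultimately show ?thesis using that by (simp add: hom_part_def len vf_zero)
      qed
      then show ?thesis using False by simp
    qed
    have b: "(\<Sum>(i, j)\<in>{(i, j). i < j \<and> j < length Xs}.
          (-1) ^ (i + j) * hom_part (k - 1) w (br (Xs ! i) (Xs ! j) # nths Xs (- {i, j}))) =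
        (if int (length Xs) = k then (\<Sum>(i, j)\<in>{(i, j). i < j \<and> j < length Xs}.
          (-1) ^ (i + j) * w (br (Xs ! i) (Xs ! j) # nths Xs (- {i, j}))) else 0)"
    proof (cases "int (length Xs) = k")
      case True
      show ?thesis
        unfolding if_P[OF True]
      proof (rule sum.cong[OF refl], clarify)
        fix i j assume "i < j" "j < length Xs"
        then have "int (length (br (Xs ! i) (Xs ! j) # nths Xs (- {i, j}))) = k - 1"
          using len2[of i j] True by simp
        then show "(-1) ^ (i + j) * hom_part (k - 1) w (br (Xs ! i) (Xs ! j) # nths Xs (- {i, j})) =
          (-1) ^ (i + j) * w (br (Xs ! i) (Xs ! j) # nths Xs (- {i, j}))"
          by (simp only: hom_part_def if_P)
      qed
    next
      case False
      show ?thesis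
        unfolding if_not_P[OF False]
      proof (rule sum.neutral, clarify)
        fix i j assume "i < j" "j < length Xs"
        then have "int (length (br (Xs ! i) (Xs ! j) # nths Xs (- {i, j}))) \<noteq> k - 1"
          using len2[of i j] False by simp
        then show "(-1) ^ (i + j) * hom_part (k - 1) w (br (Xs ! i) (Xs ! j) # nths Xs (- {i, j})) = 0"
          by (simp only: hom_part_def if_False mult_zero_right)
      qed
    qed
    have "hom_part k (d w) Xs = (if int (length Xs) = k then d w Xs else 0)"
      by (simp add: hom_part_def)
    then show ?thesis using True a b by (simp add: ext_d_def)
  qed (simp add: hom_part_def d_out)
qed

text \<open>The two sublists of a shuffle have complementary lengths, so the total length and the
  degree of u determine the degree in which w is evaluated.\<close>

lemma hom_part_wedge:
  fixes u w :: "'m form"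
  assumes "\<And>Xs. int (length Xs) \<noteq> a \<Longrightarrow> u Xs = 0"
  shows "hom_part k (u \<and>\<^sub>w w) = u \<and>\<^sub>w hom_part (k - a) w"
proof
  fix Xs :: "'m vfield list"
  have len: "length (nths Xs S) + length (nths Xs (- S)) = length Xs" for S
  proof -
    have "{i. i < length Xs \<and> i \<in> S} \<union> {i. i < length Xs \<and> i \<in> - S} = {..<length Xs}" by auto
    moreover have "card ({i. i < length Xs \<and> i \<in> S} \<union> {i. i < length Xs \<and> i \<in> - S}) =
        card {i. i < length Xs \<and> i \<in> S} + card {i. i < length Xs \<and> i \<in> - S}"
      by (rule card_Un_disjoint) auto
    ultimately show ?thesis by (simp add: length_nths)
  qed
  have "u (nths Xs S) * hom_part (k - a) w (nths Xs (- S)) =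
      (if int (length Xs) = k then u (nths Xs S) * w (nths Xs (- S)) else 0)" for S
    using assms[of "nths Xs S"] len[of S] by (auto simp: hom_part_def)
  then show "hom_part k (u \<and>\<^sub>w w) Xs = (u \<and>\<^sub>w hom_part (k - a) w) Xs"
    by (simp add: wedge_def mult.assoc) (simp add: hom_part_def wedge_def mult.assoc)
qed

lemma d_Omega: "w \<in> Omega C a \<Longrightarrow> d w \<in> Omega C (a + 1)"
  using hom_part_d[of w "a + 1"] hom_part_in_Omega[of "d w" "a + 1"] hom_part_Omega[of w a a]
  by (simp add: Omega_iff)

lemma Omega_uminus: "w \<in> Omega C a \<Longrightarrow> - w \<in> Omega C a"
  and Omega_0 [simp]: "0 \<in> Omega C a"
  by (simp_all add: Omega_iff form_apply)

lemma form_sum: "(\<And>i. i \<in> I \<Longrightarrow> is_form (w i)) \<Longrightarrow> is_form (\<Sum>i\<in>I. w i)"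
  by (induction I rule: infinite_finite_induct) simp_all

lemma d_sum: "(\<And>i. i \<in> I \<Longrightarrow> is_form (w i)) \<Longrightarrow> d (\<Sum>i\<in>I. w i) = (\<Sum>i\<in>I. d (w i))"
  by (induction I rule: infinite_finite_induct) (simp_all add: d_add form_sum)

lemma hom_part_sum:
  fixes w :: "'i \<Rightarrow> 'm form"
  shows "hom_part k (\<Sum>i\<in>I. w i) = (\<Sum>i\<in>I. hom_part k (w i))"
  using sum_comp_morphism[of "hom_part k :: 'm form \<Rightarrow> 'm form" w I] by (simp add: o_def)

end

section \<open>Smooth functions form a real algebra\<close>

section \<open>Smooth functions\<close>

text \<open>\<open>partial_deriv\<close> differentiates along a coordinate line, so facts on W have
  to be turned into facts near \<open>x i\<close> on that line.\<close>

lemma openin_slice: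
  assumes W: "openin (Euclidean_space n) W" and x: "x \<in> W" and i: "i < n"
  shows "open {s. x(i := s) \<in> W}"
proof -
  have "x \<in> topspace (Euclidean_space n)" using W x openin_subset by blast
  then have x0: "\<forall>j\<ge>n. x j = 0" by (simp add: topspace_Euclidean_space)
  have "continuous_map euclideanreal (Euclidean_space n) (\<lambda>s. x(i := s))"
    unfolding Euclidean_space_def continuous_map_in_subtopology
  proof
    show "continuous_map euclideanreal (powertop_real UNIV) (\<lambda>s. x(i := s))"
      unfolding continuous_map_componentwise_UNIV
    proof
      fix k show "continuous_map euclideanreal euclideanreal (\<lambda>s. (x(i := s)) k)"
        by (cases "k = i") (auto simp: continuous_map_id[unfolded id_def])
    qed
    \<comment> \<open>Moving a coordinate below n leaves the coordinates from n on equal to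
      zero.\<close>
    show "(\<lambda>s. x(i := s)) \<in> topspace euclideanreal \<rightarrow> {x. \<forall>i\<ge>n. x i = 0}"
      using x0 i by auto
  qed
  from openin_continuous_map_preimage[OF this W] show ?thesis by simp
qed

text \<open>The sum and product rules for \<open>partial_deriv\<close> are available only where the
  functions are differentiable, that is on W, whereas \<open>Ck_on\<close> takes functions defined
  everywhere.\<close>

lemma Ck_on_cong:
  assumes W: "openin (Euclidean_space n) W"
    and "Ck_on n k W f" "\<And>x. x \<in> W \<Longrightarrow> f x = g x"
  shows "Ck_on n k W g"
  using assms(2,3)
proof (induction k arbitrary: f g)
  case 0
  then show ?case
    by (auto elim!: continuous_map_eq)
next
  case (Suc k)
  have cont: "continuous_map (subtopology (Euclidean_space n) W) euclideanreal g"
    using Suc.prems by (auto elim!: continuous_map_eq)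
  have ev: "\<forall>\<^sub>F s in nhds (x i). f (x(i := s)) = g (x(i := s))" if "x \<in> W" "i < n" for x i
    unfolding eventually_nhds
    using openin_slice[OF W that] that Suc.prems(2)
    by (intro exI[of _ "{s. x(i := s) \<in> W}"]) auto
  have dif: "(\<lambda>s. g (x(i := s))) field_differentiable (at (x i))" if "x \<in> W" "i < n" for x i
  proof -
    have "(\<lambda>s. f (x(i := s))) field_differentiable (at (x i))" using Suc.prems that by simp
    then obtain D where "((\<lambda>s. f (x(i := s))) has_field_derivative D) (at (x i))"
      unfolding field_differentiable_def by blast
    then have "((\<lambda>s. g (x(i := s))) has_field_derivative D) (at (x i))"
      using DERIV_cong_ev[OF refl ev[OF that] refl] by simp
    then show ?thesis unfolding field_differentiable_def by blast
  qed
  have "Ck_on n k W (partial_deriv i g)" if "i < n" for i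
  proof (rule Suc.IH[of "partial_deriv i f"])
    show "Ck_on n k W (partial_deriv i f)" using Suc.prems that by simp
    show "partial_deriv i f x = partial_deriv i g x" if "x \<in> W" for x
      unfolding partial_deriv_def using deriv_cong_ev[OF ev[OF \<open>x \<in> W\<close> \<open>i < n\<close>] refl] by simp
  qed
  then show ?case using cont dif by simp
qed

lemma Ck_on_const: "Ck_on n k W (\<lambda>x. a)"
proof (induction k arbitrary: a)
  case (Suc k)
  have "partial_deriv i (\<lambda>x. a) = (\<lambda>x. 0)" for i by (rule ext) (simp add: partial_deriv_def)
  then show ?case using Suc by simp
qed simp

lemma Ck_on_pred: "Ck_on n (Suc k) W f \<Longrightarrow> Ck_on n k W f"
  by (induction k arbitrary: f) auto

lemma Ck_on_add:
  assumes W: "openin (Euclidean_space n) W"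
  shows "Ck_on n k W f \<Longrightarrow> Ck_on n k W g \<Longrightarrow> Ck_on n k W (\<lambda>x. f x + g x)"
proof (induction k arbitrary: f g)
  case 0 then show ?case by (auto intro: continuous_map_add)
next
  case (Suc k)
  have "Ck_on n k W (partial_deriv i (\<lambda>x. f x + g x))" if "i < n" for i
  proof (rule Ck_on_cong[OF W Suc.IH[of "partial_deriv i f" "partial_deriv i g"]])
    show "partial_deriv i f x + partial_deriv i g x = partial_deriv i (\<lambda>x. f x + g x) x" if "x \<in> W" for x
      unfolding partial_deriv_def using Suc.prems that \<open>i < n\<close> by (subst deriv_add) auto
  qed (use Suc.prems that in auto)
  then show ?case using Suc.prems by (auto intro: continuous_map_add field_differentiable_add)
qed

lemma Ck_on_mult:
  assumes W: "openin (Euclidean_space n) W"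
  shows "Ck_on n k W f \<Longrightarrow> Ck_on n k W g \<Longrightarrow> Ck_on n k W (\<lambda>x. f x * g x)"
proof (induction k arbitrary: f g)
  case 0 then show ?case by (auto intro: continuous_map_real_mult)
next
  case (Suc k)
  have "Ck_on n k W (partial_deriv i (\<lambda>x. f x * g x))" if "i < n" for i
  proof (rule Ck_on_cong[OF W Ck_on_add[OF W Suc.IH[of f "partial_deriv i g"] Suc.IH[of "partial_deriv i f" g]]])
    show "f x * partial_deriv i g x + partial_deriv i f x * g x = partial_deriv i (\<lambda>x. f x * g x) x" if "x \<in> W" for x
      unfolding partial_deriv_def using Suc.prems that \<open>i < n\<close> by (subst deriv_mult) auto
  qed (use Suc.prems that Ck_on_pred in auto)
  then show ?case using Suc.prems by (auto intro: continuous_map_real_mult field_differentiable_mult)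
qed

lemma fun_algebra_smooth:
  assumes "closed_smooth_manifold n M \<A>"
  shows "fun_algebra (smooth_functions n M \<A>)"
proof -
  have W: "openin (Euclidean_space n) (\<phi> ` U)" if "(U, \<phi>) \<in> \<A>" for U \<phi>
    using assms that by (auto simp: closed_smooth_manifold_def smooth_atlas_def is_chart_def)
  show ?thesis
  proof
    fix f g :: "'a \<Rightarrow> real" and a
    show "0 \<in> smooth_functions n M \<A>"
      by (auto simp: smooth_functions_def smooth_on_def Ck_on_const pointwise)
    assume f: "f \<in> smooth_functions n M \<A>"
    show "(\<lambda>m. a * f m) \<in> smooth_functions n M \<A>"
      using f W by (auto simp: smooth_functions_def smooth_on_def intro!: Ck_on_mult Ck_on_const)
    assume g: "g \<in> smooth_functions n M \<A>"
    show "f + g \<in> smooth_functions n M \<A>" "f * g \<in> smooth_functions n M \<A>"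
      using f g W by (auto simp: smooth_functions_def smooth_on_def pointwise intro!: Ck_on_add Ck_on_mult)
  qed
qed

section \<open>Cosets, the filtration, and the derived couples in closed form\<close>

section \<open>The pages of the spectral sequence\<close>

definition add_subgroup :: "'a::ab_group_add set \<Rightarrow> bool" where
  "add_subgroup S \<longleftrightarrow> 0 \<in> S \<and> (\<forall>x\<in>S. \<forall>y\<in>S. x - y \<in> S)"

lemma add_subgroup_0: "add_subgroup S \<Longrightarrow> 0 \<in> S"
  and add_subgroup_diff: "add_subgroup S \<Longrightarrow> x \<in> S \<Longrightarrow> y \<in> S \<Longrightarrow> x - y \<in> S"
  by (simp_all add: add_subgroup_def)

lemma add_subgroup_uminus: "add_subgroup S \<Longrightarrow> x \<in> S \<Longrightarrow> - x \<in> S"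
  using add_subgroup_diff[of S 0 x] by (simp add: add_subgroup_0)

lemma add_subgroup_add: "add_subgroup S \<Longrightarrow> x \<in> S \<Longrightarrow> y \<in> S \<Longrightarrow> x + y \<in> S"
  using add_subgroup_diff[of S x "- y"] by (simp add: add_subgroup_uminus)

lemma coset_iff: "y \<in> x +o S \<longleftrightarrow> y - x \<in> S" for x :: "'a::ab_group_add"
  by (simp add: set_minus_plus)

lemma coset_eq_iff:
  assumes "add_subgroup S"
  shows "x +o S = y +o S \<longleftrightarrow> x - y \<in> S"
proof
  assume "x +o S = y +o S"
  moreover have "x \<in> x +o S" by (simp add: coset_iff add_subgroup_0 assms)
  ultimately show "x - y \<in> S" by (simp add: coset_iff)
next
  assume xy: "x - y \<in> S"
  have "z - x \<in> S \<longleftrightarrow> z - y \<in> S" for z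
    using add_subgroup_add[OF assms xy, of "z - x"] add_subgroup_diff[OF assms _ xy, of "z - y"] by auto
  then show "x +o S = y +o S" by (intro set_eqI) (simp add: coset_iff)
qed

lemma coset_add: "add_subgroup S \<Longrightarrow> (x +o S) + (y +o S) = (x + y) +o S"
proof -
  assume S: "add_subgroup S"
  have "S + S = S"
  proof
    show "S + S \<subseteq> S" using S by (auto simp: set_plus_def add_subgroup_add)
    show "S \<subseteq> S + S" using S by (intro set_zero_plus2 add_subgroup_0)
  qed
  then show ?thesis by (simp add: set_plus_rearrange)
qed

lemma induced_coset:
  assumes S: "add_subgroup S" and B: "add_subgroup B" and f: "\<And>s. s \<in> S \<Longrightarrow> f (z + s) - f z \<in> B"
  shows "induced f B (z +o S) = f z +o B"
proof -
  have "f y +o B = f z +o B" if "y \<in> z +o S" for y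
    using f[of "y - z"] that coset_eq_iff[OF B] by (simp add: coset_iff)
  moreover have "z \<in> z +o S" using S by (simp add: coset_iff add_subgroup_0)
  ultimately show ?thesis unfolding induced_def by blast
qed

text \<open>The axioms concern all i and the family is zero beyond N, because the entries
  \<open>H (2 * k + 3)\<close> of an admissible system may exceed the dimension of the
  manifold.\<close>

locale twisted = fun_algebra C for C :: "('m \<Rightarrow> real) set" +
  fixes H :: "nat \<Rightarrow> 'm form" and N :: nat and h :: "'m form"
  assumes H_Omega: "\<And>i. 1 \<le> i \<Longrightarrow> H (2 * i + 1) \<in> Omega C (int (2 * i + 1))"
    and d_H: "\<And>i. 1 \<le> i \<Longrightarrow> ext_d C (H (2 * i + 1)) = 0"
    and H_high: "\<And>i. N < i \<Longrightarrow> H (2 * i + 1) = 0"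
    and h_sum: "h = (\<Sum>i = 1..N. H (2 * i + 1))"
begin

abbreviation "D \<equiv> twisted_d C h"

lemma form_H: "1 \<le> i \<Longrightarrow> is_form (H (2 * i + 1))"
  using H_Omega[of i] by (simp add: Omega_iff)

lemma grade_inv_H: 
  assumes "1 \<le> i"
  shows "grade_inv (H (2 * i + 1)) = - H (2 * i + 1)"
proof
  fix Xs
  have "H (2 * i + 1) Xs = 0" if "length Xs \<noteq> 2 * i + 1"
    using H_Omega[OF assms] that unfolding Omega_iff by (metis of_nat_eq_iff)
  then show "grade_inv (H (2 * i + 1)) Xs = (- H (2 * i + 1)) Xs"
    by (cases "length Xs = 2 * i + 1") (auto simp: grade_inv_def form_apply)
qed

lemma form_h [simp]: "is_form h"
  unfolding h_sum by (rule form_sum) (use form_H in simp)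

lemma d_h: "d h = 0"
proof -
  have "d h = (\<Sum>i = 1..N. d (H (2 * i + 1)))"
    unfolding h_sum by (rule d_sum) (use form_H in simp)
  then show ?thesis using d_H by simp
qed

lemma grade_inv_h: "grade_inv h = - h"
proof -
  have "grade_inv h = (\<Sum>i = 1..N. grade_inv (H (2 * i + 1)))"
    using sum_comp_morphism[of "grade_inv :: 'm form \<Rightarrow> 'm form" "\<lambda>i. H (2 * i + 1)" "{1..N}"] unfolding h_sum by (simp add: o_def)
  also have "\<dots> = (\<Sum>i = 1..N. - H (2 * i + 1))" by (rule sum.cong) (simp_all only: grade_inv_H atLeastAtMost_iff)
  finally show ?thesis unfolding h_sum by (simp add: sum_negf)
qed

lemma form_eq_uminus_iff: "u = - u \<longleftrightarrow> u = 0" for u :: "'m form"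
  by (simp add: fun_eq_iff pointwise) 

text \<open>All degrees in h are odd, so h anticommutes with itself; its square equals its own
  negative and hence is zero over the reals.\<close>

lemma h_h: "h \<and>\<^sub>w h = 0"
  using odd_wedge_anticommute[OF grade_inv_h grade_inv_h] by (simp add: form_eq_uminus_iff)

lemma D_add: "is_form v \<Longrightarrow> is_form w \<Longrightarrow> D (v + w) = D v + D w"
  by (simp add: twisted_d_def d_add)

lemma D_0 [simp]: "D 0 = 0"
  by (simp add: twisted_d_def)

lemma D_diff: "is_form v \<Longrightarrow> is_form w \<Longrightarrow> D (v - w) = D v - D w"
  by (simp add: twisted_d_def d_diff)

lemma D_uminus: "is_form w \<Longrightarrow> D (- w) = - D w"
  by (simp add: twisted_d_def d_uminus)

lemma form_D [simp]: "is_form w \<Longrightarrow> is_form (D w)"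
  by (simp add: twisted_d_def)

lemma D_D: 
  assumes "is_form w"
  shows "D (D w) = 0"
proof -
  have "D (D w) = h \<and>\<^sub>w (h \<and>\<^sub>w w)"
    using assms by (simp add: twisted_d_def d_add d_d d_wedge d_h grade_inv_h)
  then show ?thesis by (simp add: wedge_assoc[symmetric] h_h)
qed

lemma h_wedge: "h \<and>\<^sub>w w = (\<Sum>i = 1..N. H (2 * i + 1) \<and>\<^sub>w w)"
  unfolding h_sum by (rule wedge_sum_left)

lemma hom_part_H_wedge:
  assumes "1 \<le> i"
  shows "hom_part k (H (2 * i + 1) \<and>\<^sub>w w) = H (2 * i + 1) \<and>\<^sub>w hom_part (k - (2 * int i + 1)) w"
  by (rule hom_part_wedge) (use H_Omega[OF assms] in \<open>auto simp: Omega_iff\<close>)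

lemma hom_part_D:
  assumes "is_form w"
  shows "hom_part k (D w) = d (hom_part (k - 1) w) +
    (\<Sum>i = 1..N. H (2 * i + 1) \<and>\<^sub>w hom_part (k - (2 * int i + 1)) w)"
proof -
  have "(\<Sum>i = 1..N. hom_part k (H (2 * i + 1) \<and>\<^sub>w w)) =
      (\<Sum>i = 1..N. H (2 * i + 1) \<and>\<^sub>w hom_part (k - (2 * int i + 1)) w)"
    by (rule sum.cong) (simp_all only: hom_part_H_wedge atLeastAtMost_iff)
  then show ?thesis using assms
    by (simp add: twisted_d_def hom_part_d h_wedge hom_part_sum)
qed

lemma K_iff: "w \<in> K C p i \<longleftrightarrow> is_form w \<and> finite {k. hom_part k w \<noteq> 0} \<and>
    (\<forall>k. k < p \<or> odd (k - i) \<longrightarrow> hom_part k w = 0)"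
  by (simp add: K_def Omega_all_iff)

lemma K_form: "w \<in> K C p i \<Longrightarrow> is_form w"
  by (simp add: K_iff)

lemma K_hom_part: "w \<in> K C p i \<Longrightarrow> k < p \<or> odd (k - i) \<Longrightarrow> hom_part k w = 0"
  unfolding K_iff by blast

lemma add_subgroup_K: "add_subgroup (K C p i)"
  unfolding add_subgroup_def
proof (intro conjI ballI)
  fix x y assume x: "x \<in> K C p i" and y: "y \<in> K C p i"
  have "finite {k. hom_part k (x - y) \<noteq> 0}"
    by (rule finite_subset[of _ "{k. hom_part k x \<noteq> 0} \<union> {k. hom_part k y \<noteq> 0}"])
      (use x y in \<open>auto simp: K_iff\<close>)
  then show "x - y \<in> K C p i" using x y by (simp add: K_iff)
qed (simp add: K_iff)

lemma K_mono: "p \<le> p' \<Longrightarrow> K C p' i \<subseteq> K C p i"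
  by (auto simp: K_iff)

lemma Omega_subset_K:
  assumes "w \<in> Omega C k" "p \<le> k" "even (k - i)"
  shows "w \<in> K C p i"
proof -
  have "finite {j. hom_part j w \<noteq> 0}"
    by (rule finite_subset[of _ "{k}"]) (auto simp: hom_part_Omega[OF assms(1)])
  then show ?thesis
    using assms Omega_iff[of w k] by (auto simp: K_iff hom_part_Omega[OF assms(1)])
qed

text \<open>Degrees are raised by 1 or by 2i+1 with i at most N: odd amounts, which flips the
  parity; positive ones, which keeps the filtration; finitely many, which keeps the support
  finite.\<close>

lemma D_K: 
  assumes w: "w \<in> K C p i"
  shows "D w \<in> K C p (i + 1)"
proof -
  note is_form = K_form[OF w]
  let ?F = "{k. hom_part k w \<noteq> 0}"
  have fin: "finite ?F" using w by (simp add: K_iff)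
  have "{k. hom_part k (D w) \<noteq> 0} \<subseteq> (\<lambda>k. k + 1) ` ?F \<union> (\<Union>i\<in>{1..N}. (\<lambda>k. k + (2 * int i + 1)) ` ?F)"
    (is "_ \<subseteq> ?R")
  proof
    fix k assume k: "k \<in> {k. hom_part k (D w) \<noteq> 0}"
    show "k \<in> ?R"
    proof (rule ccontr)
      assume *: "k \<notin> ?R"
      have "hom_part (k - 1) w = 0"
        using * by (auto simp: image_iff dest: spec[of _ "k - 1"])
      moreover have "hom_part (k - (2 * int i + 1)) w = 0" if "i \<in> {1..N}" for i
      proof (rule ccontr)
        assume "hom_part (k - (2 * int i + 1)) w \<noteq> 0"
        then have "k \<in> (\<lambda>k. k + (2 * int i + 1)) ` ?F" by (intro image_eqI[of _ _ "k - (2 * int i + 1)"]) auto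
        then show False using * that by blast
      qed
      ultimately have "hom_part k (D w) = 0" by (simp add: hom_part_D[OF is_form])
      then show False using k by simp
    qed
  qed
  then have "finite {k. hom_part k (D w) \<noteq> 0}" by (rule finite_subset) (use fin in auto)
  moreover have "hom_part k (D w) = 0" if k: "k < p \<or> odd (k - (i + 1))" for k
  proof -
    have "hom_part (k - 1) w = 0" using k by (intro K_hom_part[OF w]) auto
    moreover have "hom_part (k - (2 * int j + 1)) w = 0" for j
      using k by (intro K_hom_part[OF w]) auto
    ultimately show ?thesis by (simp add: hom_part_D[OF is_form])
  qed
  ultimately show ?thesis using is_form by (simp add: K_iff)
qed

definition Z :: "int \<Rightarrow> int \<Rightarrow> int \<Rightarrow> 'm form set" where
  "Z r p i = {z \<in> K C p i. D z \<in> K C (p + r) (i + 1)}"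

text \<open>The condition on \<open>D y\<close> is not automatic, since \<open>y\<close> starts in lower filtration.\<close>

definition B :: "int \<Rightarrow> int \<Rightarrow> int \<Rightarrow> 'm form set" where
  "B r p i = {D y + u | y u. y \<in> K C (p - r + 1) (i - 1) \<and> D y \<in> K C p i \<and> u \<in> K C (p + 1) i}"

abbreviation "BD' \<equiv> BD C h"

lemma add_subgroup_BD: "add_subgroup (BD' p i)"
  unfolding add_subgroup_def BD_def
proof (intro conjI ballI)
  show "0 \<in> D ` K C p (i - 1)" by (rule image_eqI[of _ _ 0]) (simp_all add: add_subgroup_0[OF add_subgroup_K])
  fix x y assume "x \<in> D ` K C p (i - 1)" "y \<in> D ` K C p (i - 1)"
  then show "x - y \<in> D ` K C p (i - 1)"
    by (auto simp: D_diff[symmetric] K_form intro!: imageI add_subgroup_diff[OF add_subgroup_K])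
qed

lemma BI: "y \<in> K C (p - r + 1) (i - 1) \<Longrightarrow> D y \<in> K C p i \<Longrightarrow> u \<in> K C (p + 1) i \<Longrightarrow> D y + u \<in> B r p i"
  by (auto simp: B_def)

lemma K_sub_B: "u \<in> K C (p + 1) i \<Longrightarrow> u \<in> B r p i"
  using BI[of 0 p r i u] by (simp add: add_subgroup_0[OF add_subgroup_K])

lemma D_in_B: "y \<in> K C (p - r + 1) (i - 1) \<Longrightarrow> D y \<in> K C p i \<Longrightarrow> D y \<in> B r p i"
  using BI[of y p r i 0] by (simp add: add_subgroup_0[OF add_subgroup_K])

lemma add_subgroup_B: "add_subgroup (B r p i)"
  unfolding add_subgroup_def
proof (intro conjI ballI)
  show "0 \<in> B r p i" by (rule K_sub_B) (simp add: add_subgroup_0[OF add_subgroup_K])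
  fix a b assume "a \<in> B r p i" "b \<in> B r p i"
  then obtain y u y' u' where a: "a = D y + u" "y \<in> K C (p - r + 1) (i - 1)" "D y \<in> K C p i" "u \<in> K C (p + 1) i"
    and b: "b = D y' + u'" "y' \<in> K C (p - r + 1) (i - 1)" "D y' \<in> K C p i" "u' \<in> K C (p + 1) i"
    by (auto simp: B_def)
  have eq: "D (y - y') = D y - D y'" using a b by (simp add: D_diff K_form)
  have "D (y - y') + (u - u') \<in> B r p i"
    using a b by (intro BI add_subgroup_diff[OF add_subgroup_K]) (simp_all add: eq add_subgroup_diff[OF add_subgroup_K])
  moreover have "D (y - y') + (u - u') = a - b" by (simp add: a(1) b(1) eq)
  ultimately show "a - b \<in> B r p i" by simp
qed

lemma B_mono: "r \<le> r' \<Longrightarrow> B r p i \<subseteq> B r' p i"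
  unfolding B_def using K_mono[of "p - r' + 1" "p - r + 1" "i - 1"] by fastforce

text \<open>For r = 1 the condition on D y in \<open>B\<close> holds by itself, as y starts in
  filtration p.\<close>

lemma BE_eq: "BE C h p i = B 1 p i"
proof -
  have "D y \<in> K C p i" if "y \<in> K C p (i - 1)" for y using D_K[OF that] by simp
  then show ?thesis by (auto simp: BE_def B_def set_plus_def)
qed

text \<open>The induction invariant. In filtration p, \<open>Dgrp\<close> consists of those
  cohomology classes of K_p that come from K_(p+r-1), after r - 1 applications of
  \<open>imap\<close>. Since \<open>jmap\<close> inverts these steps, it is described only on
  representatives lying that deep.\<close>

definition is_page :: "nat \<Rightarrow> 'm form couple \<Rightarrow> bool" where
  "is_page r Q \<longleftrightarrow> jdeg Q = int r - 1 \<and>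
    (\<forall>p q. Dgrp Q p q = (\<lambda>z. z +o BD' p (p + q)) ` {z \<in> K C (p + int r - 1) (p + q). D z = 0}) \<and>
    (\<forall>p q. Egrp Q p q = (\<lambda>z. z +o B (int r) p (p + q)) ` Z (int r) p (p + q)) \<and>
    (\<forall>p q z. imap Q p q (z +o BD' p (p + q)) = z +o BD' (p - 1) (p + q)) \<and>
    (\<forall>p q z. z \<in> K C (p + int r - 1) (p + q) \<longrightarrow> D z = 0 \<longrightarrow>
      jmap Q p q (z +o BD' p (p + q)) = z +o B (int r) (p + int r - 1) (p + q)) \<and>
    (\<forall>p q z. z \<in> Z (int r) p (p + q) \<longrightarrow>
      kmap Q p q (z +o B (int r) p (p + q)) = D z +o BD' (p + 1) (p + q + 1))"

lemma is_pageD: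
  assumes "is_page r Q"
  shows "jdeg Q = int r - 1"
    and "Dgrp Q p q = (\<lambda>z. z +o BD' p (p + q)) ` {z \<in> K C (p + int r - 1) (p + q). D z = 0}"
    and "Egrp Q p q = (\<lambda>z. z +o B (int r) p (p + q)) ` Z (int r) p (p + q)"
    and "imap Q p q (z +o BD' p (p + q)) = z +o BD' (p - 1) (p + q)"
    and "z \<in> K C (p + int r - 1) (p + q) \<Longrightarrow> D z = 0 \<Longrightarrow>
      jmap Q p q (z +o BD' p (p + q)) = z +o B (int r) (p + int r - 1) (p + q)"
    and "z \<in> Z (int r) p (p + q) \<Longrightarrow>
      kmap Q p q (z +o B (int r) p (p + q)) = D z +o BD' (p + 1) (p + q + 1)"
  using assms unfolding is_page_def by blast+

lemma is_page_couple1: "is_page 1 (couple1 C h)"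
  unfolding is_page_def
proof (intro conjI allI impI)
  show "jdeg (couple1 C h) = int 1 - 1" by (simp add: couple1_def)
  fix p q
  show "Dgrp (couple1 C h) p q = (\<lambda>z. z +o BD' p (p + q)) ` {z \<in> K C (p + int 1 - 1) (p + q). D z = 0}"
    by (simp add: couple1_def)
  show "Egrp (couple1 C h) p q = (\<lambda>z. z +o B (int 1) p (p + q)) ` Z (int 1) p (p + q)"
    by (simp add: couple1_def BE_eq Z_def)
  fix z
  have "BD' p (p + q) \<subseteq> BD' (p - 1) (p + q)"
    unfolding BD_def by (intro image_mono K_mono) simp
  then have "induced (\<lambda>z. z) (BD' (p - 1) (p + q)) (z +o BD' p (p + q)) = z +o BD' (p - 1) (p + q)"
    by (intro induced_coset add_subgroup_BD) auto
  then show "imap (couple1 C h) p q (z +o BD' p (p + q)) = z +o BD' (p - 1) (p + q)"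
    by (simp add: couple1_def)
  have "BD' p (p + q) \<subseteq> B 1 p (p + q)"
    by (auto simp: BD_def intro!: D_in_B) (use D_K[of _ p "p + q - 1"] in simp)
  then have "induced (\<lambda>z. z) (B 1 p (p + q)) (z +o BD' p (p + q)) = z +o B 1 p (p + q)"
    by (intro induced_coset add_subgroup_BD add_subgroup_B) auto
  then show "jmap (couple1 C h) p q (z +o BD' p (p + q)) = z +o B (int 1) (p + int 1 - 1) (p + q)"
    by (simp add: couple1_def BE_eq)
  assume z: "z \<in> Z (int 1) p (p + q)"
  show "kmap (couple1 C h) p q (z +o B (int 1) p (p + q)) = D z +o BD' (p + 1) (p + q + 1)"
  proof -
    \<comment> \<open>Here s = D y + u; \<open>D\<close> kills D y, and D u is the boundary of an
      element of filtration p + 1.\<close>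
    have "D (z + s) - D z \<in> BD' (p + 1) (p + q + 1)" if "s \<in> B 1 p (p + q)" for s
    proof -
      obtain y u where s: "s = D y + u" "y \<in> K C (p - 1 + 1) (p + q - 1)" "u \<in> K C (p + 1) (p + q)"
        using \<open>s \<in> B 1 p (p + q)\<close> unfolding B_def by auto
      moreover have "is_form z" using z by (auto simp: Z_def intro: K_form)
      moreover have "is_form y" "is_form u" using s by (auto intro: K_form)
      ultimately have "D (z + s) - D z = D u" by (simp add: D_add D_D)
      then show ?thesis using s by (simp add: BD_def)
    qed
    then have "induced D (BD' (p + 1) (p + q + 1)) (z +o B 1 p (p + q)) = D z +o BD' (p + 1) (p + q + 1)"
      by (intro induced_coset add_subgroup_BD add_subgroup_B)
    then show ?thesis by (simp add: couple1_def)
  qed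
qed

text \<open>\<open>kmap\<close> leads to filtration p + 1 with the representative D z in K_(p+r),
  which is precisely the depth (p + 1) + r - 1 at which \<open>jmap\<close> is known.\<close>

lemma is_page_dmap:
  assumes Q: "is_page r Q" and z: "z \<in> Z (int r) p (p + q)"
  shows "dmap Q p q (z +o B (int r) p (p + q)) = D z +o B (int r) (p + int r) (p + q + 1)"
proof -
  have "p + 1 + q = p + q + 1" "p + 1 + int r - 1 = p + int r" by simp_all
  moreover have "D z \<in> K C (p + int r) (p + q + 1)" "D (D z) = 0"
    using z D_D[OF K_form, of z p "p + q"] by (simp_all add: Z_def)
  ultimately show ?thesis
    unfolding dmap_def is_pageD(6)[OF Q z]
    using is_pageD(5)[OF Q, of "D z" "p + 1" q] by (simp only:)
qed

text \<open>The incoming differential starts at filtration p - r, so the union over its images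
  adjoins all D y in K_p with y in K_(p-r). This is what increasing r by one does to
  \<open>B\<close>.\<close>

lemma is_page_hclass:
  assumes Q: "is_page r Q"
  shows "hclass Q p q (z +o B (int r) p (p + q)) = z +o B (int r + 1) p (p + q)"
proof -
  let ?i = "p + q"
  have j: "p - 1 - jdeg Q = p - int r" "q + jdeg Q = q + int r - 1"
    by (simp_all add: is_pageD(1)[OF Q])
  have s: "p - int r + (q + int r - 1) = ?i - 1" by simp
  have "hclass Q p q (z +o B (int r) p ?i) =
      (\<Union>y\<in>Z (int r) (p - int r) (?i - 1). (z +o B (int r) p ?i) +
         dmap Q (p - int r) (q + int r - 1) (y +o B (int r) (p - int r) (?i - 1)))"
    unfolding hclass_def j is_pageD(3)[OF Q] s by simp
  also have "\<dots> = (\<Union>y\<in>Z (int r) (p - int r) (?i - 1). (z + D y) +o B (int r) p ?i)"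
  proof (rule SUP_cong)
    fix y assume "y \<in> Z (int r) (p - int r) (?i - 1)"
    then have "dmap Q (p - int r) (q + int r - 1) (y +o B (int r) (p - int r) (?i - 1)) = D y +o B (int r) p ?i"
      using is_page_dmap[OF Q, of y "p - int r" "q + int r - 1"] s by (simp add: algebra_simps)
    then show "(z +o B (int r) p ?i) + dmap Q (p - int r) (q + int r - 1) (y +o B (int r) (p - int r) (?i - 1)) =
      (z + D y) +o B (int r) p ?i" by (simp add: coset_add add_subgroup_B)
  qed simp
  also have "\<dots> = z +o B (int r + 1) p ?i"
  proof (intro set_eqI iffI)
    fix x assume "x \<in> (\<Union>y\<in>Z (int r) (p - int r) (?i - 1). (z + D y) +o B (int r) p ?i)"
    then obtain y where y: "y \<in> Z (int r) (p - int r) (?i - 1)" "x - (z + D y) \<in> B (int r) p ?i"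
      by (auto simp: coset_iff)
    then have "D y \<in> B (int r + 1) p ?i" by (intro D_in_B) (simp_all add: Z_def)
    moreover have "x - (z + D y) \<in> B (int r + 1) p ?i" using y B_mono[of "int r" "int r + 1"] by auto
    ultimately have "(x - (z + D y)) + D y \<in> B (int r + 1) p ?i" by (intro add_subgroup_add[OF add_subgroup_B])
    then show "x \<in> z +o B (int r + 1) p ?i" by (simp add: coset_iff algebra_simps)
  next
    fix x assume "x \<in> z +o B (int r + 1) p ?i"
    then obtain y u where y: "x - z = D y + u" "y \<in> K C (p - int r) (?i - 1)" "D y \<in> K C p ?i"
        "u \<in> K C (p + 1) ?i"
      by (auto simp: coset_iff B_def)
    then have "y \<in> Z (int r) (p - int r) (?i - 1)" by (simp add: Z_def)
    moreover have "x - (z + D y) \<in> B (int r) p ?i" using K_sub_B[OF y(4)] y(1) by (simp add: algebra_simps)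
    ultimately show "x \<in> (\<Union>y\<in>Z (int r) (p - int r) (?i - 1). (z + D y) +o B (int r) p ?i)"
      by (auto simp: coset_iff)
  qed
  finally show ?thesis .
qed

text \<open>If d_r kills the coset of z, then D z = D y + u with y of filtration (p + r) - r + 1 = p
  + 1. Hence z - y lies in the same coset, and D (z - y) = u starts one step deeper.\<close>

lemma is_page_ecycles:
  assumes Q: "is_page r Q"
  shows "ecycles Q p q = (\<lambda>z. z +o B (int r) p (p + q)) ` Z (int r + 1) p (p + q)"
proof (intro set_eqI iffI)
  let ?i = "p + q"
  fix b assume "b \<in> ecycles Q p q"
  then obtain z where z: "z \<in> Z (int r) p ?i" and b: "b = z +o B (int r) p ?i"
    and "0 \<in> dmap Q p q b"
    by (auto simp: ecycles_def is_pageD(3)[OF Q])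
  then have "- D z \<in> B (int r) (p + int r) (?i + 1)"
    by (simp add: is_page_dmap[OF Q] coset_iff)
  then have "D z \<in> B (int r) (p + int r) (?i + 1)" using add_subgroup_uminus[OF add_subgroup_B] by fastforce
  then obtain y u where y: "D z = D y + u" "y \<in> K C (p + 1) ?i" "u \<in> K C (p + int r + 1) (?i + 1)"
    by (auto simp: B_def)
  have y': "y \<in> K C p ?i" using y(2) K_mono[of p "p + 1"] by auto
  have zK: "z \<in> K C p ?i" using z by (simp add: Z_def)
  have "D (z - y) = u" using y zK by (simp add: D_diff K_form)
  then have "z - y \<in> Z (int r + 1) p ?i"
    using y(3) zK y' by (simp add: Z_def add_subgroup_diff[OF add_subgroup_K] add.assoc)
  moreover have "b = (z - y) +o B (int r) p ?i"
    unfolding b by (subst coset_eq_iff[OF add_subgroup_B]) (simp add: K_sub_B y(2))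
  ultimately show "b \<in> (\<lambda>z. z +o B (int r) p ?i) ` Z (int r + 1) p ?i" by blast
next
  let ?i = "p + q"
  fix b assume "b \<in> (\<lambda>z. z +o B (int r) p ?i) ` Z (int r + 1) p ?i"
  then obtain z where z: "z \<in> Z (int r + 1) p ?i" and b: "b = z +o B (int r) p ?i" by auto
  have z': "z \<in> Z (int r) p ?i" using z K_mono[of "p + int r" "p + (int r + 1)"] by (auto simp: Z_def)
  have "- D z \<in> B (int r) (p + int r) (?i + 1)"
    using z by (intro add_subgroup_uminus[OF add_subgroup_B] K_sub_B) (simp add: Z_def add.assoc)
  then show "b \<in> ecycles Q p q"
    using z' by (auto simp: ecycles_def b is_pageD(3)[OF Q] is_page_dmap[OF Q] coset_iff)
qed

lemma Z_mono: "r \<le> r' \<Longrightarrow> Z r' p i \<subseteq> Z r p i"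
  using K_mono[of "p + r" "p + r'"] by (auto simp: Z_def)

text \<open>The \<open>THE\<close> terms in \<open>derived_couple\<close> demand independence of
  choices; in closed form this becomes a comparison of two representatives.\<close>

lemma is_page_derived:
  assumes Q: "is_page r Q"
  shows "is_page (Suc r) (derived_couple Q)"
  unfolding is_page_def
proof (intro conjI allI impI)
  have r: "int (Suc r) = int r + 1" by simp
  show "jdeg (derived_couple Q) = int (Suc r) - 1" by (simp add: derived_couple_def is_pageD(1)[OF Q])
  fix p q :: int
  let ?i = "p + q"
  have s: "p + 1 + (q - 1) = ?i" "p + 1 + int r - 1 = p + int r" by simp_all
  have s3: "p + int r + (q - int r) = ?i" by simp
  note D1 = is_pageD(2)[OF Q, of "p + 1" "q - 1", unfolded s]
  note i1 = is_pageD(4)[OF Q, of "p + 1" "q - 1", unfolded s]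
  have img: "imap Q (p + 1) (q - 1) (z +o BD' (p + 1) ?i) = z +o BD' p ?i" for z using i1 by simp
  show "Dgrp (derived_couple Q) p q =
      (\<lambda>z. z +o BD' p ?i) ` {z \<in> K C (p + int (Suc r) - 1) ?i. D z = 0}"
    by (simp add: derived_couple_def D1 image_image img)
  show "Egrp (derived_couple Q) p q = (\<lambda>z. z +o B (int (Suc r)) p ?i) ` Z (int (Suc r)) p ?i"
    by (simp add: derived_couple_def is_page_ecycles[OF Q] image_image is_page_hclass[OF Q] add.commute)
  fix z
  show "imap (derived_couple Q) p q (z +o BD' p ?i) = z +o BD' (p - 1) ?i"
    by (simp add: derived_couple_def is_pageD(4)[OF Q])
  have hc: "hclass Q (p + 1 + jdeg Q) (q - 1 - jdeg Q) (jmap Q (p + 1) (q - 1) (z' +o BD' (p + 1) ?i)) =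
      z' +o B (int r + 1) (p + int r) ?i" if "z' \<in> K C (p + int r) ?i" "D z' = 0" for z'
  proof -
    have "jmap Q (p + 1) (q - 1) (z' +o BD' (p + 1) ?i) = z' +o B (int r) (p + int r) ?i"
      using is_pageD(5)[OF Q, of z' "p + 1" "q - 1"] that unfolding s by simp
    moreover have "p + 1 + jdeg Q = p + int r" "q - 1 - jdeg Q = q - int r"
      by (simp_all add: is_pageD(1)[OF Q])
    ultimately show ?thesis using is_page_hclass[OF Q, of "p + int r" "q - int r" z']
      by (simp only: s3)
  qed
  show "jmap (derived_couple Q) p q (z +o BD' p ?i) = z +o B (int (Suc r)) (p + int (Suc r) - 1) ?i"
    if "z \<in> K C (p + int (Suc r) - 1) ?i" "D z = 0"
  proof -
    have z: "z \<in> K C (p + int r) ?i" using that(1) by (simp add: algebra_simps)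
    have "(THE e. \<exists>a\<in>Dgrp Q (p + 1) (q - 1). imap Q (p + 1) (q - 1) a = z +o BD' p ?i \<and>
        e = hclass Q (p + 1 + jdeg Q) (q - 1 - jdeg Q) (jmap Q (p + 1) (q - 1) a)) =
        z +o B (int r + 1) (p + int r) ?i"
    proof (rule the_equality)
      show "\<exists>a\<in>Dgrp Q (p + 1) (q - 1). imap Q (p + 1) (q - 1) a = z +o BD' p ?i \<and>
        z +o B (int r + 1) (p + int r) ?i = hclass Q (p + 1 + jdeg Q) (q - 1 - jdeg Q) (jmap Q (p + 1) (q - 1) a)"
        using z that(2) by (intro bexI[of _ "z +o BD' (p + 1) ?i"]) (simp_all add: img hc D1)
    next
      fix e assume "\<exists>a\<in>Dgrp Q (p + 1) (q - 1). imap Q (p + 1) (q - 1) a = z +o BD' p ?i \<and>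
        e = hclass Q (p + 1 + jdeg Q) (q - 1 - jdeg Q) (jmap Q (p + 1) (q - 1) a)"
      then obtain z' where z': "z' \<in> K C (p + int r) ?i" "D z' = 0" "z' +o BD' p ?i = z +o BD' p ?i"
        and e: "e = z' +o B (int r + 1) (p + int r) ?i"
        by (auto simp: D1 img hc)
      \<comment> \<open>Two lifts of one class differ by D y with y only in K_p. Both lifts have
        filtration p + r, so D y has it too, and p = (p + r) - (r + 1) + 1 places it in the new
        \<open>B\<close>.\<close>
      then have "z' - z \<in> BD' p ?i" by (simp add: coset_eq_iff[OF add_subgroup_BD])
      then obtain y where y: "y \<in> K C p (?i - 1)" "z' - z = D y" by (auto simp: BD_def)
      have "z' - z \<in> B (int r + 1) (p + int r) ?i"
        unfolding y(2)
      proof (rule D_in_B)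
        show "D y \<in> K C (p + int r) ?i" unfolding y(2)[symmetric] by (rule add_subgroup_diff[OF add_subgroup_K z'(1) z])
      qed (use y(1) in simp)
      then show "e = z +o B (int r + 1) (p + int r) ?i" unfolding e by (simp add: coset_eq_iff[OF add_subgroup_B])
    qed
    then show ?thesis by (simp add: derived_couple_def algebra_simps)
  qed
  have kz: "kmap Q p q (z' +o B (int r) p ?i) = D z' +o BD' (p + 1) (?i + 1)" if "z' \<in> Z (int r + 1) p ?i" for z'
  proof (rule is_pageD(6)[OF Q])
    show "z' \<in> Z (int r) p ?i" using that Z_mono[of "int r" "int r + 1"] by auto
  qed
  show "kmap (derived_couple Q) p q (z +o B (int (Suc r)) p ?i) = D z +o BD' (p + 1) (?i + 1)"
    if "z \<in> Z (int (Suc r)) p ?i"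
  proof -
    have z: "z \<in> Z (int r + 1) p ?i" using that by (simp add: add.commute)
    have "(THE c. \<exists>b\<in>ecycles Q p q. hclass Q p q b = z +o B (int r + 1) p ?i \<and> c = kmap Q p q b) =
        D z +o BD' (p + 1) (?i + 1)"
    proof (rule the_equality)
      show "\<exists>b\<in>ecycles Q p q. hclass Q p q b = z +o B (int r + 1) p ?i \<and>
          D z +o BD' (p + 1) (?i + 1) = kmap Q p q b"
        using z by (intro bexI[of _ "z +o B (int r) p ?i"])
          (simp_all add: is_page_hclass[OF Q] kz is_page_ecycles[OF Q])
    next
      fix c assume "\<exists>b\<in>ecycles Q p q. hclass Q p q b = z +o B (int r + 1) p ?i \<and> c = kmap Q p q b"
      then obtain z' where z': "z' \<in> Z (int r + 1) p ?i" "z' +o B (int r + 1) p ?i = z +o B (int r + 1) p ?i"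
        and c: "c = D z' +o BD' (p + 1) (?i + 1)"
        by (auto simp: is_page_ecycles[OF Q] is_page_hclass[OF Q] kz)
      \<comment> \<open>The difference is D y + u; applying \<open>D\<close> leaves D u with u in
        K_(p+1), a coboundary in the target of \<open>kmap\<close>.\<close>
      then have "z' - z \<in> B (int r + 1) p ?i" by (simp add: coset_eq_iff[OF add_subgroup_B])
      then obtain y u where y: "z' - z = D y + u" "y \<in> K C (p - int r) (?i - 1)" "u \<in> K C (p + 1) ?i"
        by (auto simp: B_def)
      have is_form: "is_form z" "is_form z'" "is_form y" "is_form u"
        using z z' y by (auto simp: Z_def intro: K_form)
      then have "D z' - D z = D (z' - z)" by (simp add: D_diff)
      also have "\<dots> = D u" unfolding y(1) using is_form by (simp add: D_add D_D)
      finally have "D z' - D z \<in> BD' (p + 1) (?i + 1)" using y by (simp add: BD_def)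
      then show "c = D z +o BD' (p + 1) (?i + 1)" unfolding c by (simp add: coset_eq_iff[OF add_subgroup_BD])
    qed
    then show ?thesis by (simp add: derived_couple_def add.commute)
  qed
qed

lemma is_page_ss: "1 \<le> r \<Longrightarrow> is_page r (ss C h r)"
proof (induction r rule: nat_induct_at_least)
  case base show ?case using is_page_couple1 by (simp add: ss_def)
next
  case (Suc r)
  then have "ss C h (Suc r) = derived_couple (ss C h r)"
    by (cases r) (simp_all add: ss_def)
  then show ?case using is_page_derived[OF Suc.IH] by simp
qed

text \<open>A class keeps its representative on later pages; only the subgroup grows.\<close>

lemma class_at_coset:
  assumes "1 \<le> s" "s \<le> r"
  shows "class_at C h p q s (z +o B (int s) p (p + q)) r = z +o B (int r) p (p + q)"
  using assms(2)
proof (induction r rule: dec_induct)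
  case base show ?case by (simp add: class_at_def)
next
  case (step r)
  then show ?case
    using is_page_hclass[OF is_page_ss, of r p q z] assms(1)
    by (simp add: class_at_def add.commute)
qed

text \<open>The form z need not lie in \<open>Z\<close>. At each page the kernel condition provides
  another representative that does, and the equality of cosets persists because \<open>B\<close>
  grows with the page.\<close>

lemma survives_imp_Egrp:
  assumes "1 \<le> s" "s \<le> r" "survives C h p q s (z +o B (int s) p (p + q)) r"
  shows "z +o B (int r) p (p + q) \<in> Egrp (ss C h r) p q"
  using assms(2,3)
proof (induction r rule: dec_induct)
  case base then show ?case by (simp add: survives_def)
next
  case (step r)
  have r: "is_page r (ss C h r)" and Sr: "is_page (Suc r) (ss C h (Suc r))"
    using step.hyps assms(1) by (intro is_page_ss; simp)+
  have "z +o B (int r) p (p + q) \<in> Egrp (ss C h r) p q"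
    using step by (auto simp: survives_def)
  moreover have "0 \<in> dmap (ss C h r) p q (z +o B (int r) p (p + q))"
  proof -
    have "r \<in> {s..<Suc r}" using step.hyps by simp
    then have "0 \<in> dmap (ss C h r) p q (class_at C h p q s (z +o B (int s) p (p + q)) r)"
      using step.prems unfolding survives_def by blast
    then show ?thesis using class_at_coset[of s r p q z] assms(1) step.hyps by simp
  qed
  ultimately have "z +o B (int r) p (p + q) \<in> ecycles (ss C h r) p q"
    by (simp add: ecycles_def)
  then obtain z' where z': "z' \<in> Z (int r + 1) p (p + q)"
    and eq: "z +o B (int r) p (p + q) = z' +o B (int r) p (p + q)"
    by (auto simp: is_page_ecycles[OF r])
  have "z - z' \<in> B (int (Suc r)) p (p + q)"
    using eq B_mono[of "int r" "int (Suc r)" p "p + q"] by (auto simp: coset_eq_iff[OF add_subgroup_B])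
  then have "z +o B (int (Suc r)) p (p + q) = z' +o B (int (Suc r)) p (p + q)"
    by (simp only: coset_eq_iff[OF add_subgroup_B])
  then show ?case using z' by (auto simp: is_pageD(3)[OF Sr] add.commute)
qed

text \<open>A closed z lies in every \<open>Z\<close>, and all its differentials are represented by
  0.\<close>

lemma survives_closed:
  assumes "1 \<le> s" "s \<le> r" "z \<in> K C p (p + q)" "D z = 0"
  shows "survives C h p q s (z +o B (int s) p (p + q)) r"
proof -
  have z: "z \<in> Z k p (p + q)" for k using assms by (simp add: Z_def add_subgroup_0[OF add_subgroup_K])
  have "0 \<in> dmap (ss C h u) p q (class_at C h p q s (z +o B (int s) p (p + q)) u)" if "u \<in> {s..<r}" for u
    using that assms class_at_coset[of s u] is_page_dmap[OF is_page_ss z, of u]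
    by (simp add: coset_iff add_subgroup_0[OF add_subgroup_B])
  then show ?thesis using z is_pageD(3)[OF is_page_ss[OF assms(1)]] by (auto simp: survives_def)
qed

end

section \<open>Lifts, admissible systems and the differential\<close>

section \<open>Massey products\<close>

lemma minus_one_power_form: "(-1) ^ k * w = (if even k then w else - w)" for w :: "'m form"
  by (simp add: minus_one_power_iff)

lemma minus_one_power_image_coset:
  fixes x :: "'m form"
  assumes "add_subgroup S"
  shows "(*) ((-1) ^ t) ` (x +o S) = ((-1) ^ t * x) +o S"
proof -
  have "uminus ` (x +o S) = (- x) +o S"
  proof (intro set_eqI iffI)
    fix y assume "y \<in> uminus ` (x +o S)"
    then obtain z where "y = - z" "z - x \<in> S" by (auto simp: coset_iff)
    then show "y \<in> (- x) +o S" using add_subgroup_uminus[OF assms, of "z - x"] by (simp add: coset_iff)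
  next
    fix y assume "y \<in> (- x) +o S"
    then have "- y \<in> x +o S" using add_subgroup_uminus[OF assms, of "y + x"] by (simp add: coset_iff)
    then show "y \<in> uminus ` (x +o S)" by (intro image_eqI[of _ _ "- y"]) simp_all
  qed
  moreover have "(*) ((-1) ^ t) = (if even t then (\<lambda>w. w) else uminus :: 'm form \<Rightarrow> 'm form)"
    by (rule ext) (simp add: minus_one_power_form)
  ultimately show ?thesis by (simp add: minus_one_power_form)
qed

lemma bar_eq: "bar w = - grade_inv w"
  by (rule ext) (simp add: bar_def grade_inv_def form_apply)

text \<open>Reversing the index shows that the sum is its own negative; this also disposes of the
  middle term for odd k.\<close>

lemma sum_antisymmetric:
  fixes F :: "nat \<Rightarrow> 'm form"
  assumes "\<And>l. l < k \<Longrightarrow> F (k - Suc l) = - F l"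
  shows "(\<Sum>l<k. F l) = 0"
proof -
  have "(\<Sum>l<k. F l) = (\<Sum>l<k. F (k - Suc l))" by (rule sum.nat_diff_reindex[symmetric])
  also have "\<dots> = - (\<Sum>l<k. F l)" using assms by (simp add: sum_negf)
  finally have "(\<Sum>l<k. F l) = - (\<Sum>l<k. F l)" .
  then show ?thesis by (simp add: fun_eq_iff pointwise)
qed

lemma sum_H3_degrees:
  "j \<le> t + 1 \<Longrightarrow> i \<le> j + 1 \<Longrightarrow> (\<Sum>k=i..j. H3_degrees t p k) = 3 * (int j + 1 - int i)"
  "i \<le> t + 2 \<Longrightarrow> (\<Sum>k=i..t + 2. H3_degrees t p k) = 3 * (int t + 2 - int i) + p"
proof -
  have *: "(\<Sum>k=i..j. H3_degrees t p k) = 3 * (int j + 1 - int i)" if "j \<le> t + 1" "i \<le> j + 1" for j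
  proof -
    have "(\<Sum>k=i..j. H3_degrees t p k) = (\<Sum>k=i..j. 3)"
      using that by (intro sum.cong) (auto simp: H3_degrees_def)
    then show ?thesis using that by simp
  qed
  then show "j \<le> t + 1 \<Longrightarrow> i \<le> j + 1 \<Longrightarrow> (\<Sum>k=i..j. H3_degrees t p k) = 3 * (int j + 1 - int i)" .
  assume "i \<le> t + 2"
  then have "(\<Sum>k=i..Suc (t + 1). H3_degrees t p k) = (\<Sum>k=i..t + 1. H3_degrees t p k) + H3_degrees t p (t + 2)"
    by (subst sum.cl_ivl_Suc) simp
  then show "(\<Sum>k=i..t + 2. H3_degrees t p k) = 3 * (int t + 2 - int i) + p"
    using *[of "t + 1"] \<open>i \<le> t + 2\<close> by (simp add: H3_degrees_def)
qed

context twisted begin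

lemma H_odd:
  "H (2 * k + 3) \<in> Omega C (2 * int k + 3)" "is_form (H (2 * k + 3))" "d (H (2 * k + 3)) = 0"
  "grade_inv (H (2 * k + 3)) = - H (2 * k + 3)"
proof -
  have eq: "2 * k + 3 = 2 * (k + 1) + 1" by simp
  have "int (2 * (k + 1) + 1) = 2 * int k + 3" by simp
  then show "H (2 * k + 3) \<in> Omega C (2 * int k + 3)" using H_Omega[of "k + 1"] unfolding eq by (simp only:)
  show "is_form (H (2 * k + 3))" "d (H (2 * k + 3)) = 0" "grade_inv (H (2 * k + 3)) = - H (2 * k + 3)"
    unfolding eq by (rule form_H d_H grade_inv_H, simp)+
qed

lemma K_step:
  assumes w: "w \<in> K C p i" and 0: "hom_part p w = 0"
  shows "w \<in> K C (p + 1) i"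
proof -
  have "hom_part k w = 0" if "k < p + 1 \<or> odd (k - i)" for k
    using K_hom_part[OF w, of k] that 0 by (cases "k = p") auto
  then show ?thesis using w unfolding K_iff by blast
qed

text \<open>The bound N comes from the dimension, the bound j from the filtration: the family H
  vanishes beyond the first, the components of w beyond the second. The right side has the shape of
  the equations of an admissible system.\<close>

lemma hom_part_D_low:
  assumes w: "w \<in> K C p i"
  shows "hom_part (p + 2 * int j + 1) (D w) = d (hom_part (p + 2 * int j) w) +
    (\<Sum>l = 1..j. H (2 * l + 1) \<and>\<^sub>w hom_part (p + 2 * int (j - l)) w)"
proof -
  let ?F = "\<lambda>l. H (2 * l + 1) \<and>\<^sub>w hom_part (p + 2 * int j + 1 - (2 * int l + 1)) w"
  have "(\<Sum>l = 1..N. ?F l) = (\<Sum>l = 1..max N j. ?F l)"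
  proof (rule sum.mono_neutral_left)
    show "\<forall>l\<in>{1..max N j} - {1..N}. ?F l = 0" using H_high by auto
  qed auto
  also have "\<dots> = (\<Sum>l = 1..j. ?F l)"
  proof (rule sum.mono_neutral_right)
    show "\<forall>l\<in>{1..max N j} - {1..j}. ?F l = 0"
      using K_hom_part[OF w] by auto
  qed auto
  also have "\<dots> = (\<Sum>l = 1..j. H (2 * l + 1) \<and>\<^sub>w hom_part (p + 2 * int (j - l)) w)"
    by (rule sum.cong) (auto simp: of_nat_diff algebra_simps)
  finally show ?thesis using K_form[OF w] by (simp add: hom_part_D)
qed

text \<open>The equations say that \<open>D\<close> of the sum of the forms x j has no component in
  the degrees p+1, p+3, ..., p+2t+1. At j = 0 the sum is empty and x 0 is required to be
  closed.\<close>

definition partial_lift :: "nat \<Rightarrow> int \<Rightarrow> (nat \<Rightarrow> 'm form) \<Rightarrow> bool" where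
  "partial_lift t p x \<longleftrightarrow> (\<forall>j\<le>t. x j \<in> Omega C (p + 2 * int j) \<and>
     d (x j) + (\<Sum>i = 1..j. H (2 * i + 1) \<and>\<^sub>w x (j - i)) = 0)"

text \<open>The lowest component of \<open>D\<close> of that sum which may be nonzero; prolonging
  the lift by a form x (t+1) would require d (x (t+1)) = - \<open>obstruction t x\<close>.\<close>

definition obstruction :: "nat \<Rightarrow> (nat \<Rightarrow> 'm form) \<Rightarrow> 'm form" where
  "obstruction t x = (\<Sum>i = 1..t + 1. H (2 * i + 1) \<and>\<^sub>w x (t + 1 - i))"

text \<open>The coset gives x = z0 + D y + u. Moving D y over to z0 does not change D z0, and u has
  no component in degree p, so x is recovered exactly and not merely up to a boundary.\<close>

lemma survives_lift:
  assumes r: "1 \<le> r" and q: "even q" and x: "x \<in> Omega C p"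
    and s: "survives C h p q 1 (form_to_E1 C h p q x) r"
  obtains z where "z \<in> Z (int r) p (p + q)" "hom_part p z = x"
proof -
  have "x +o B (int r) p (p + q) \<in> Egrp (ss C h r) p q"
    using survives_imp_Egrp[of 1 r p q x] r s by (simp add: form_to_E1_def BE_eq)
  then obtain z0 where z0: "z0 \<in> Z (int r) p (p + q)" "x - z0 \<in> B (int r) p (p + q)"
    by (auto simp: is_pageD(3)[OF is_page_ss[OF r]] coset_eq_iff[OF add_subgroup_B])
  then obtain y u where y: "x - z0 = D y + u" "y \<in> K C (p - int r + 1) (p + q - 1)"
    "D y \<in> K C p (p + q)" "u \<in> K C (p + 1) (p + q)" by (auto simp: B_def)
  have is_form: "is_form z0" "is_form y" using z0 y by (auto simp: Z_def intro: K_form)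
  have "D (z0 + D y) = D z0" using is_form by (simp add: D_add D_D)
  then have "z0 + D y \<in> Z (int r) p (p + q)"
    using z0 y by (simp add: Z_def add_subgroup_add[OF add_subgroup_K])
  moreover have "hom_part p (z0 + D y) = x"
  proof -
    have "z0 + D y = x - u" using y(1) by (simp add: algebra_simps)
    moreover have "hom_part p u = 0" by (rule K_hom_part[OF y(4)]) simp
    ultimately show ?thesis by (simp add: hom_part_Omega[OF x])
  qed
  ultimately show ?thesis by (rule that)
qed

lemma partial_lift_components:
  assumes z: "z \<in> Z (2 * int t + 3) p i" and i: "even (p - i)"
  shows "partial_lift t p (\<lambda>j. hom_part (p + 2 * int j) z)"
  unfolding partial_lift_def
proof (intro allI impI conjI)
  fix j assume "j \<le> t"
  have zK: "z \<in> K C p i" using z by (simp add: Z_def)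
  show "hom_part (p + 2 * int j) z \<in> Omega C (p + 2 * int j)"
    using K_form[OF zK] by (rule hom_part_in_Omega)
  have "hom_part (p + 2 * int j + 1) (D z) = 0"
    using z \<open>j \<le> t\<close> by (intro K_hom_part[of _ "p + (2 * int t + 3)" "i + 1"]) (simp_all add: Z_def)
  then show "d (hom_part (p + 2 * int j) z) +
      (\<Sum>i = 1..j. H (2 * i + 1) \<and>\<^sub>w hom_part (p + 2 * int (j - i)) z) = 0"
    by (simp only: hom_part_D_low[OF zK])
qed

lemma partial_lift_sum:
  assumes x: "partial_lift t p x" and i: "even (p - i)"
  defines "z \<equiv> \<Sum>j\<le>t. x j"
  shows "z \<in> Z (2 * int t + 3) p i" "z - x 0 \<in> K C (p + 1) i"
    "D z - obstruction t x \<in> K C (p + 2 * int t + 4) (i + 1)"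
    "obstruction t x \<in> Omega C (p + 2 * int t + 3)" "d (obstruction t x) = 0"
proof -
  have xO: "x j \<in> Omega C (p + 2 * int j)" if "j \<le> t" for j
    using x that by (simp add: partial_lift_def)
  have xeq: "d (x j) + (\<Sum>i = 1..j. H (2 * i + 1) \<and>\<^sub>w x (j - i)) = 0" if "j \<le> t" for j
    using x that unfolding partial_lift_def by blast
  have xK: "x j \<in> K C p i" if "j \<le> t" for j
    using Omega_subset_K[OF xO[OF that], of p i] i by simp
  have "(\<Sum>j\<le>s. x j) \<in> K C p i" if "s \<le> t" for s
    using that by (induction s) (simp_all add: xK add_subgroup_add[OF add_subgroup_K])
  then have zK: "z \<in> K C p i" by (simp add: z_def)
  have comp: "hom_part (p + 2 * int j) z = (if j \<le> t then x j else 0)" for j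
  proof -
    have "hom_part (p + 2 * int j) z = (\<Sum>l\<le>t. hom_part (p + 2 * int j) (x l))"
      by (simp add: z_def hom_part_sum)
    also have "\<dots> = (\<Sum>l\<le>t. if l = j then x j else 0)"
      by (rule sum.cong) (auto simp: hom_part_Omega[OF xO])
    finally show ?thesis by (simp add: sum.delta)
  qed
  have DzK: "D z \<in> K C p (i + 1)" by (rule D_K[OF zK])
  have Dcomp: "hom_part (p + 2 * int j + 1) (D z) = 0" if "j \<le> t" for j
  proof -
    have "(\<Sum>l = 1..j. H (2 * l + 1) \<and>\<^sub>w hom_part (p + 2 * int (j - l)) z) =
        (\<Sum>i = 1..j. H (2 * i + 1) \<and>\<^sub>w x (j - i))"
    proof (rule sum.cong[OF refl])
      fix l show "H (2 * l + 1) \<and>\<^sub>w hom_part (p + 2 * int (j - l)) z = H (2 * l + 1) \<and>\<^sub>w x (j - l)"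
        unfolding comp using that by simp
    qed
    then show ?thesis using xeq[OF that] that by (simp only: hom_part_D_low[OF zK] comp if_True)
  qed
  have Dz0: "hom_part k (D z) = 0" if "k < p + 2 * int t + 3 \<or> odd (k - (i + 1))" for k
  proof (cases "k < p \<or> odd (k - (i + 1))")
    case True then show ?thesis using K_hom_part[OF DzK] by blast
  next
    case False
    then have "k \<ge> p" "odd (k - p)" using i by presburger+
    \<comment> \<open>Every degree from p on with the right parity is p + 2a + 1, so the equations
      of the lift cover all those below p + 2t + 3.\<close>
    then obtain a where "k - p = 2 * a + 1" by (elim oddE)
    then have "k = p + 2 * int (nat a) + 1" using \<open>k \<ge> p\<close> by simp
    then show ?thesis using that False Dcomp[of "nat a"] by auto
  qed
  have DzK': "D z \<in> K C (p + 2 * int t + 3) (i + 1)"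
    using DzK Dz0 unfolding K_iff by blast
  then show zZ: "z \<in> Z (2 * int t + 3) p i" using zK by (simp add: Z_def add.assoc)
  have x0: "x 0 \<in> K C p i" using xK[of 0] by simp
  show "z - x 0 \<in> K C (p + 1) i"
  proof (rule K_step)
    show "z - x 0 \<in> K C p i" by (rule add_subgroup_diff[OF add_subgroup_K zK x0])
    show "hom_part p (z - x 0) = 0" using comp[of 0] hom_part_Omega[OF xO[of 0], of p] by simp
  qed
  have lead: "hom_part (p + 2 * int t + 3) (D z) = obstruction t x"
  proof -
    have "p + 2 * int t + 3 = p + 2 * int (t + 1) + 1" by simp
    then have "hom_part (p + 2 * int t + 3) (D z) = d (hom_part (p + 2 * int (t + 1)) z) +
        (\<Sum>l = 1..t + 1. H (2 * l + 1) \<and>\<^sub>w hom_part (p + 2 * int (t + 1 - l)) z)"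
      using hom_part_D_low[OF zK, of "t + 1"] by (simp only:)
    also have "\<dots> = obstruction t x"
      \<comment> \<open>At the index t + 1 the component of z is 0, so the derivative term
        disappears; the sum involves only indices up to t.\<close>
      unfolding obstruction_def comp by (simp, rule sum.cong) auto
    finally show ?thesis .
  qed
  show O: "obstruction t x \<in> Omega C (p + 2 * int t + 3)"
    unfolding lead[symmetric] using K_form[OF DzK] by (rule hom_part_in_Omega)
  \<comment> \<open>As D z starts in degree p + 2t + 3, no wedge product with H reaches the next
    degree, where D (D z) = 0 therefore only sees d of the leading component.\<close>
  have "hom_part (p + 2 * int t + 3 + 2 * int 0 + 1) (D (D z)) = d (hom_part (p + 2 * int t + 3) (D z))"
    using hom_part_D_low[OF DzK', of 0] by simp
  then show "d (obstruction t x) = 0" using D_D[OF K_form[OF zK]] by (simp add: lead)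
  have "D z - obstruction t x \<in> K C (p + 2 * int t + 3) (i + 1)"
    using i by (intro add_subgroup_diff[OF add_subgroup_K DzK'] Omega_subset_K[OF O]) simp_all
  then have "D z - obstruction t x \<in> K C (p + 2 * int t + 3 + 1) (i + 1)"
    by (rule K_step) (simp add: lead hom_part_Omega[OF O])
  then show "D z - obstruction t x \<in> K C (p + 2 * int t + 4) (i + 1)" by (simp add: add.assoc)
qed

lemma admissible_exists:
  assumes x: "partial_lift t p x"
  shows "\<exists>A. admissible_system C H t p (x 0) A"
proof -
  define A where "A i j = (if j = t + 2 then (-1) ^ (t + 2 - i) * x (t + 2 - i)
     else (-1) ^ (j - i) * H (2 * (j - i) + 3))" for i j :: nat
  have "admissible_system C H t p (x 0) A"
    unfolding admissible_system_def
    using x by (intro exI[of _ x]) (auto simp: partial_lift_def A_def)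
  then show ?thesis by blast
qed

lemma admissible_lift:
  assumes A: "admissible_system C H t p xp A" and xp: "xp \<in> Omega C p" "d xp = 0"
  obtains x where "x 0 = xp" "partial_lift t p x"
    "\<And>i k. k \<le> t \<Longrightarrow> 1 \<le> i \<Longrightarrow> i + k \<le> t + 1 \<Longrightarrow> A i (i + k) = (-1) ^ k * H (2 * k + 3)"
    "\<And>i. 2 \<le> i \<Longrightarrow> i \<le> t + 2 \<Longrightarrow> A i (t + 2) = (-1) ^ (t + 2 - i) * x (t + 2 - i)"
proof -
  obtain x where x: "x 0 = xp" "\<forall>i\<in>{1..t}. x i \<in> Omega C (p + 2 * int i)"
     "\<forall>j\<in>{1..t}. d (x j) + (\<Sum>i=1..j. H (2 * i + 1) \<and>\<^sub>w x (j - i)) = 0"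
     "A (t + 2) (t + 2) = xp"
     "\<forall>k\<le>t. \<forall>i\<in>{1..t + 1 - k}. A i (i + k) = (-1) ^ k * H (2 * k + 3)"
     "\<forall>i\<in>{2..t + 1}. A i (t + 2) = (-1) ^ (t + 2 - i) * x (t + 2 - i)"
    using A unfolding admissible_system_def by blast
  have "partial_lift t p x"
    unfolding partial_lift_def
  proof (intro allI impI)
    fix j assume "j \<le> t"
    then show "x j \<in> Omega C (p + 2 * int j) \<and> d (x j) + (\<Sum>i = 1..j. H (2 * i + 1) \<and>\<^sub>w x (j - i)) = 0"
      using x(1-3) xp by (cases "j = 0") auto
  qed
  moreover have "A i (t + 2) = (-1) ^ (t + 2 - i) * x (t + 2 - i)" if "2 \<le> i" "i \<le> t + 2" for i
    using x(1,4,6) that by (cases "i = t + 2") auto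
  moreover have "A i (i + k) = (-1) ^ k * H (2 * k + 3)" if "k \<le> t" "1 \<le> i" "i + k \<le> t + 1" for i k
    using x(5) that by auto
  ultimately show ?thesis using that x(1) by blast
qed

text \<open>On forms of odd degree \<open>bar\<close> is the identity, so only the explicit signs
  remain in the sums of a defining system, whose left factors all come from H.\<close>

lemma bar_H: "bar ((-1) ^ k * H (2 * k + 3)) = (-1) ^ k * H (2 * k + 3)"
  using H_odd(4)[of k] by (simp add: bar_eq minus_one_power_form)

lemma sign_wedge: "((-1) ^ a * u) \<and>\<^sub>w ((-1) ^ b * v) = (-1) ^ (a + b) * (u \<and>\<^sub>w v)" for u v :: "'m form"
  by (simp add: minus_one_power_form)

text \<open>The exponents s - i and t + 1 - s add up to t + 1 - i whatever s is, so the sign leaves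
  the sum. The row i = 1 gives the related cocycle with the sign (-1)^t of the theorem; the rows
  with 2 <= i <= t + 1 give the structure equations of the last column.\<close>

lemma last_column:
  assumes A: "\<And>i k. k \<le> t \<Longrightarrow> 1 \<le> i \<Longrightarrow> i + k \<le> t + 1 \<Longrightarrow> A i (i + k) = (-1) ^ k * H (2 * k + 3)"
    "\<And>i. 2 \<le> i \<Longrightarrow> i \<le> t + 2 \<Longrightarrow> A i (t + 2) = (-1) ^ (t + 2 - i) * x (t + 2 - i)"
    and i: "1 \<le> i" "i \<le> t + 1"
  shows "(\<Sum>s=i..<t + 2. bar (A i s) \<and>\<^sub>w A (s + 1) (t + 2)) =
    (-1) ^ (t + 1 - i) * (\<Sum>l = 1..t + 2 - i. H (2 * l + 1) \<and>\<^sub>w x (t + 2 - i - l))"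
proof -
  have "bar (A i s) \<and>\<^sub>w A (s + 1) (t + 2) =
      (-1) ^ (t + 1 - i) * (H (2 * (s - i) + 3) \<and>\<^sub>w x (t + 1 - s))" if "s \<in> {i..<t + 2}" for s
  proof -
    have "A i s = (-1) ^ (s - i) * H (2 * (s - i) + 3)" using A(1)[of "s - i" i] that i by simp
    moreover have "A (s + 1) (t + 2) = (-1) ^ (t + 1 - s) * x (t + 1 - s)"
      using A(2)[of "s + 1"] that i by simp
    moreover have "s - i + (t + 1 - s) = t + 1 - i" using that i by auto
    ultimately show ?thesis by (simp only: bar_H sign_wedge)
  qed
  then have "(\<Sum>s=i..<t + 2. bar (A i s) \<and>\<^sub>w A (s + 1) (t + 2)) =
      (-1) ^ (t + 1 - i) * (\<Sum>s=i..<t + 2. H (2 * (s - i) + 3) \<and>\<^sub>w x (t + 1 - s))"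
    unfolding sum_distrib_left by (rule sum.cong[OF refl])
  also have "(\<Sum>s=i..<t + 2. H (2 * (s - i) + 3) \<and>\<^sub>w x (t + 1 - s)) =
      (\<Sum>l = 1..t + 2 - i. H (2 * l + 1) \<and>\<^sub>w x (t + 2 - i - l))"
  proof (rule sum.reindex_bij_witness[of _ "\<lambda>l. l + i - 1" "\<lambda>s. s + 1 - i"])
    fix s assume s: "s \<in> {i..<t + 2}"
    then have "2 * (s - i) + 3 = 2 * (s + 1 - i) + 1" "t + 1 - s = t + 2 - i - (s + 1 - i)" by auto
    then show "H (2 * (s + 1 - i) + 1) \<and>\<^sub>w x (t + 2 - i - (s + 1 - i)) = H (2 * (s - i) + 3) \<and>\<^sub>w x (t + 1 - s)"
      by (simp only:)
  qed (use i in auto)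
  finally show ?thesis .
qed

text \<open>Again the sign is constant. With k = j - i, the terms l and k - 1 - l are products of
  the same two odd forms in opposite order and cancel, in accordance with the closedness of the
  entries.\<close>

lemma H_columns:
  assumes A: "\<And>i k. k \<le> t \<Longrightarrow> 1 \<le> i \<Longrightarrow> i + k \<le> t + 1 \<Longrightarrow> A i (i + k) = (-1) ^ k * H (2 * k + 3)"
    and i: "1 \<le> i" "i \<le> j" "j \<le> t + 1"
  shows "(\<Sum>s=i..<j. bar (A i s) \<and>\<^sub>w A (s + 1) j) = 0"
proof -
  let ?k = "j - i"
  let ?F = "\<lambda>l. (-1) ^ (?k - 1) * (H (2 * l + 3) \<and>\<^sub>w H (2 * (?k - Suc l) + 3))"
  have "bar (A i s) \<and>\<^sub>w A (s + 1) j = ?F (s - i)" if "s \<in> {i..<j}" for s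
  proof -
    have "A i s = (-1) ^ (s - i) * H (2 * (s - i) + 3)" using A[of "s - i" i] that i by simp
    moreover have "A (s + 1) j = (-1) ^ (?k - Suc (s - i)) * H (2 * (?k - Suc (s - i)) + 3)"
      using A[of "?k - Suc (s - i)" "s + 1"] that i by simp
    moreover have "s - i + (?k - Suc (s - i)) = ?k - 1" using that i by auto
    ultimately show ?thesis by (simp only: bar_H sign_wedge)
  qed
  then have "(\<Sum>s=i..<j. bar (A i s) \<and>\<^sub>w A (s + 1) j) = (\<Sum>s=i..<j. ?F (s - i))"
    by (intro sum.cong) auto
  also have "\<dots> = (\<Sum>l<?k. ?F l)"
    by (rule sum.reindex_bij_witness[of _ "\<lambda>l. l + i" "\<lambda>s. s - i"]) (use i in auto)
  also have "\<dots> = 0"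
  proof (rule sum_antisymmetric)
    fix l assume l: "l < ?k"
    then have eq: "?k - Suc (?k - Suc l) = l" by simp
    have "H (2 * (?k - Suc l) + 3) \<and>\<^sub>w H (2 * l + 3) = - (H (2 * l + 3) \<and>\<^sub>w H (2 * (?k - Suc l) + 3))"
      by (rule odd_wedge_anticommute[OF H_odd(4) H_odd(4)])
    then show "?F (?k - Suc l) = - ?F l" unfolding eq by (simp only: mult_minus_right)
  qed
  finally show ?thesis .
qed

lemma sign_Omega: "w \<in> Omega C a \<Longrightarrow> (-1) ^ k * w \<in> Omega C a"
  by (simp add: minus_one_power_form Omega_uminus)

lemma d_sign: "w \<in> Omega C a \<Longrightarrow> d ((-1) ^ k * w) = (-1) ^ k * d w"
  by (simp add: minus_one_power_form d_uminus Omega_iff)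

lemma admissible_defining_system:
  assumes x: "x 0 = xp" "partial_lift t p x"
    and A: "\<And>i k. k \<le> t \<Longrightarrow> 1 \<le> i \<Longrightarrow> i + k \<le> t + 1 \<Longrightarrow> A i (i + k) = (-1) ^ k * H (2 * k + 3)"
    "\<And>i. 2 \<le> i \<Longrightarrow> i \<le> t + 2 \<Longrightarrow> A i (t + 2) = (-1) ^ (t + 2 - i) * x (t + 2 - i)"
  shows "defining_system C (t + 2) (H3_degrees t p) (H3_entries H t xp) A"
  unfolding defining_system_def
proof (intro allI impI)
  fix i j assume ij: "1 \<le> i \<and> i \<le> j \<and> j \<le> t + 2 \<and> (i, j) \<noteq> (1, t + 2)"
  show "A i j \<in> Omega C ((\<Sum>k=i..j. H3_degrees t p k) - int j + int i) \<and>
        (i = j \<longrightarrow> A i j = H3_entries H t xp i) \<and>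
        d (A i j) = (\<Sum>s=i..<j. bar (A i s) \<and>\<^sub>w A (s + 1) j)"
  proof (cases "j \<le> t + 1")
    case True
    have Aij: "A i j = (-1) ^ (j - i) * H (2 * (j - i) + 3)" using A(1)[of "j - i" i] ij True by simp
    have deg: "(\<Sum>k=i..j. H3_degrees t p k) - int j + int i = 2 * int (j - i) + 3"
      using sum_H3_degrees(1)[of j t i p] ij True by (simp add: of_nat_diff)
    show ?thesis
    proof (intro conjI impI)
      show "A i j \<in> Omega C ((\<Sum>k=i..j. H3_degrees t p k) - int j + int i)"
        unfolding deg Aij by (intro sign_Omega H_odd)
      show "A i j = H3_entries H t xp i" if "i = j"
        unfolding Aij using that True by (simp add: H3_entries_def)
      have "d (A i j) = 0" unfolding Aij by (simp only: d_sign[OF H_odd(1)] H_odd(3) mult_zero_right)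
      then show "d (A i j) = (\<Sum>s=i..<j. bar (A i s) \<and>\<^sub>w A (s + 1) j)"
        using H_columns[where t = t and A = A and i = i and j = j, OF A(1)] ij True by simp
    qed
  next
    case False
    then have j: "j = t + 2" and i: "2 \<le> i" "i \<le> t + 2" using ij by auto
    let ?J = "t + 2 - i"
    have Aij: "A i j = (-1) ^ ?J * x ?J" using A(2)[OF i] j by simp
    have J: "?J \<le> t" using i by simp
    have deg: "(\<Sum>k=i..j. H3_degrees t p k) - int j + int i = p + 2 * int ?J"
      using sum_H3_degrees(2)[of i t p] i j by (simp add: of_nat_diff)
    have xJ: "x ?J \<in> Omega C (p + 2 * int ?J)"
      and dxJ: "d (x ?J) + (\<Sum>l = 1..?J. H (2 * l + 1) \<and>\<^sub>w x (?J - l)) = 0"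
      using x(2) J unfolding partial_lift_def by blast+
    show ?thesis
    proof (intro conjI impI)
      show "A i j \<in> Omega C ((\<Sum>k=i..j. H3_degrees t p k) - int j + int i)"
        unfolding deg Aij by (intro sign_Omega xJ)
      show "A i j = H3_entries H t xp i" if "i = j"
        unfolding Aij using that j x(1) by (simp add: H3_entries_def)
      have dA: "d (A i j) = (-1) ^ ?J * d (x ?J)" unfolding Aij by (rule d_sign[OF xJ])
      show "d (A i j) = (\<Sum>s=i..<j. bar (A i s) \<and>\<^sub>w A (s + 1) j)"
      proof (cases "i = t + 2")
        case True
        then show ?thesis using dxJ dA j by simp
      next
        case False
        then have i': "1 \<le> i" "i \<le> t + 1" using i by auto
        \<comment> \<open>The exponents differ by one; this sign comes from moving the sum in the
          equation for \<open>d (x ?J)\<close> to the other side.\<close>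
        have "?J = Suc (t + 1 - i)" using i' by simp
        moreover have "d (x ?J) = - (\<Sum>l = 1..?J. H (2 * l + 1) \<and>\<^sub>w x (?J - l))"
          using dxJ by (simp only: eq_neg_iff_add_eq_0)
        ultimately have "d (A i j) = (-1) ^ (t + 1 - i) * (\<Sum>l = 1..?J. H (2 * l + 1) \<and>\<^sub>w x (?J - l))"
          unfolding dA by (simp add: minus_one_power_form)
        then show ?thesis unfolding j using last_column[where t = t and A = A and x = x and i = i, OF A i'] by simp
      qed
    qed
  qed
qed

text \<open>De Rham classes are taken modulo images of d, the second page modulo images of
  \<open>D\<close>. The difference h \<and> w of D w and d w has filtration m + 1 and is absorbed by
  \<open>B\<close>.\<close>

lemma deRham_class_to_E2:
  assumes "even q"
  shows "deRham_to_E2 C h m q (deRham_class C m c) = c +o B 2 m (m + q)"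
proof -
  have sub: "d w \<in> B 2 m (m + q)" if w: "w \<in> Omega C (m - 1)" for w
  proof -
    have wK: "w \<in> K C (m - 1) (m + q - 1)" using assms by (intro Omega_subset_K[OF w]) auto
    \<comment> \<open>Here w has degree m - 1, and every summand of h has degree at least 3.\<close>
    have "hom_part k (h \<and>\<^sub>w w) = 0" if "k < m + 1" for k
    proof -
      have "hom_part k (H (2 * l + 1) \<and>\<^sub>w w) = 0" if "l \<in> {1..N}" for l
        using that \<open>k < m + 1\<close> hom_part_H_wedge[of l k w] K_hom_part[OF wK, of "k - (2 * int l + 1)"] by simp
      then show ?thesis by (simp add: h_wedge hom_part_sum)
    qed
    moreover have dwK: "d w \<in> K C m (m + q)"
      using d_Omega[OF w] assms by (intro Omega_subset_K[of _ m]) auto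
    moreover have DwK: "D w \<in> K C (m - 1) (m + q)" using D_K[OF wK] by simp
    \<comment> \<open>Parity and finite support of this product are inherited from D w and d
      w.\<close>
    have hw: "h \<and>\<^sub>w w = D w - d w" by (simp add: twisted_d_def)
    have "d w \<in> K C (m - 1) (m + q)" using dwK K_mono[of "m - 1" m] by auto
    then have "h \<and>\<^sub>w w \<in> K C (m - 1) (m + q)" unfolding hw by (rule add_subgroup_diff[OF add_subgroup_K DwK])
    ultimately have hwK: "h \<and>\<^sub>w w \<in> K C (m + 1) (m + q)" unfolding K_iff by blast
    then have "h \<and>\<^sub>w w \<in> K C m (m + q)" using K_mono[of m "m + 1"] by auto
    then have "D w \<in> K C m (m + q)" using add_subgroup_add[OF add_subgroup_K dwK] by (simp add: twisted_d_def)
    then have "D w + - (h \<and>\<^sub>w w) \<in> B 2 m (m + q)"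
      using wK hwK by (intro BI add_subgroup_uminus[OF add_subgroup_K]) simp_all
    then show ?thesis by (simp add: twisted_d_def)
  qed
  have "class_at C h m q 1 (form_to_E1 C h m q z) 2 = c +o B 2 m (m + q)"
    if "z \<in> deRham_class C m c" for z
  proof -
    have "z - c \<in> B 2 m (m + q)" using that sub by (auto simp: deRham_class_def coset_iff)
    then have "z +o B 2 m (m + q) = c +o B 2 m (m + q)" by (simp add: coset_eq_iff[OF add_subgroup_B])
    then show ?thesis using class_at_coset[of 1 2 m q z] by (simp add: form_to_E1_def BE_eq)
  qed
  moreover have "c \<in> deRham_class C m c"
    by (simp add: deRham_class_def coset_iff) (rule image_eqI[of _ _ 0], simp_all)
  ultimately show ?thesis unfolding deRham_to_E2_def by blast
qed

text \<open>The related cocycle c is only known to be closed for d. It is traded for (-1)^t D z,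
  which is closed for \<open>D\<close> and differs from c in filtration m + 1; this yields survival
  and the value of the differential alike.\<close>

lemma massey_differential:
  assumes q: "even q" and xp: "xp \<in> Omega C p" and dxp: "d xp = 0"
    and m: "m = p + 2 * int t + 3" and q': "q' = q - 2 * int t - 2"
    and A: "admissible_system C H t p xp A"
  shows "defining_system C (t + 2) (H3_degrees t p) (H3_entries H t xp) A"
    "massey_class C (t + 2) (H3_degrees t p) A \<in> deRham C m"
    "survives C h m q' 2 (deRham_to_E2 C h m q' (massey_class C (t + 2) (H3_degrees t p) A)) (2 * t + 3)"
    "(*) ((-1) ^ t) ` class_at C h m q' 2
        (deRham_to_E2 C h m q' (massey_class C (t + 2) (H3_degrees t p) A)) (2 * t + 3) =
     dmap (ss C h (2 * t + 3)) p q (class_at C h p q 1 (form_to_E1 C h p q xp) (2 * t + 3))"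
proof -
  obtain x where x: "x 0 = xp" "partial_lift t p x"
    and A1: "\<And>i k. k \<le> t \<Longrightarrow> 1 \<le> i \<Longrightarrow> i + k \<le> t + 1 \<Longrightarrow> A i (i + k) = (-1) ^ k * H (2 * k + 3)"
    and A2: "\<And>i. 2 \<le> i \<Longrightarrow> i \<le> t + 2 \<Longrightarrow> A i (t + 2) = (-1) ^ (t + 2 - i) * x (t + 2 - i)"
    using admissible_lift[OF A xp dxp] by blast
  show "defining_system C (t + 2) (H3_degrees t p) (H3_entries H t xp) A"
    by (rule admissible_defining_system[OF x A1 A2])
  define y where "y = obstruction t x"
  define z where "z = (\<Sum>j\<le>t. x j)"
  define c where "c = (-1) ^ t * y"
  have par: "even (p - (p + q))" using q by simp
  note L = partial_lift_sum[OF x(2) par, folded y_def z_def]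
  let ?r = "2 * t + 3"
  let ?i = "p + q"
  have r: "int ?r = 2 * int t + 3" by simp
  have i: "m + q' = ?i + 1" and pr: "p + int ?r = m" by (simp_all add: m q')
  have "related_cocycle (t + 2) A = c"
    unfolding related_cocycle_def c_def y_def obstruction_def
    using last_column[where t = t and A = A and x = x and i = 1, OF A1 A2] by simp
  moreover have "(\<Sum>k=1..t + 2. H3_degrees t p k) - int (t + 2) + 2 = m"
    using sum_H3_degrees(2)[of 1 t p] by (simp add: m)
  ultimately have mc: "massey_class C (t + 2) (H3_degrees t p) A = deRham_class C m c"
    by (simp add: massey_class_def)
  have yO: "y \<in> Omega C m" using L(4) by (simp add: m)
  have "c \<in> Omega C m" "d c = 0"
    using L(5) unfolding c_def by (simp_all add: sign_Omega[OF yO] d_sign[OF yO])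
  then show "massey_class C (t + 2) (H3_degrees t p) A \<in> deRham C m"
    unfolding mc deRham_def by blast
  have E2: "deRham_to_E2 C h m q' (massey_class C (t + 2) (H3_degrees t p) A) = c +o B 2 m (m + q')"
    unfolding mc by (rule deRham_class_to_E2) (simp add: q' q)
  have yz: "(D z - y) \<in> B k m (m + q')" for k
    using L(3) by (intro K_sub_B) (simp add: m q' algebra_simps)
  define z' where "z' = (-1) ^ t * D z"
  have zK: "z \<in> K C p ?i" and DzK: "D z \<in> K C m (m + q')"
    using L(1) unfolding i Z_def by (simp_all only: m add.assoc mem_Collect_eq)
  have gz: "is_form z" using zK by (rule K_form)
  have z'K: "z' \<in> K C m (m + q')" and z'0: "D z' = 0"
    using DzK gz add_subgroup_uminus[OF add_subgroup_K DzK]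
    by (simp_all add: z'_def minus_one_power_form D_uminus D_D)
  have cz: "c +o B k m (m + q') = z' +o B k m (m + q')" for k
  proof -
    have "c - z' = (-1) ^ t * - (D z - y)" by (simp add: c_def z'_def algebra_simps)
    also have "\<dots> \<in> B k m (m + q')"
      using yz[of k] add_subgroup_uminus[OF add_subgroup_B yz] by (simp add: minus_one_power_form)
    finally show ?thesis by (simp add: coset_eq_iff[OF add_subgroup_B])
  qed
  show "survives C h m q' 2 (deRham_to_E2 C h m q' (massey_class C (t + 2) (H3_degrees t p) A)) ?r"
    using survives_closed[of 2 ?r z' m q'] z'K z'0 unfolding E2 cz by simp
  have "class_at C h m q' 2 (c +o B 2 m (m + q')) ?r = c +o B (int ?r) m (m + q')"
    using class_at_coset[of 2 ?r m q' c] by simp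
  then have rhs: "(*) ((-1) ^ t) ` class_at C h m q' 2
        (deRham_to_E2 C h m q' (massey_class C (t + 2) (H3_degrees t p) A)) ?r =
      y +o B (int ?r) m (m + q')"
  proof -
    have "(-1) ^ t * c = y" by (simp add: c_def minus_one_power_form)
    then show ?thesis
      unfolding E2 \<open>class_at _ _ _ _ _ _ _ = _\<close> minus_one_power_image_coset[OF add_subgroup_B] by simp
  qed
  \<comment> \<open>The forms added to xp in z have degree at least p + 2, so z represents the class
    of xp on every page, and unlike xp it is known to lie in \<open>Z\<close>.\<close>
  have "xp - z \<in> B (int ?r) p ?i"
    using add_subgroup_uminus[OF add_subgroup_K L(2)] x(1) by (intro K_sub_B) simp
  then have "xp +o B (int ?r) p ?i = z +o B (int ?r) p ?i" by (simp only: coset_eq_iff[OF add_subgroup_B])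
  then have "class_at C h p q 1 (form_to_E1 C h p q xp) ?r = z +o B (int ?r) p ?i"
    using class_at_coset[of 1 ?r p q xp] by (simp add: form_to_E1_def BE_eq)
  then have "dmap (ss C h ?r) p q (class_at C h p q 1 (form_to_E1 C h p q xp) ?r) =
      D z +o B (int ?r) (p + int ?r) (?i + 1)"
    using is_page_dmap[OF is_page_ss[of ?r], of z p q] L(1) by (simp only: r)
  also have "\<dots> = D z +o B (int ?r) m (m + q')" unfolding i pr ..
  also have "\<dots> = y +o B (int ?r) m (m + q')" using yz by (simp only: coset_eq_iff[OF add_subgroup_B])
  finally show "(*) ((-1) ^ t) ` class_at C h m q' 2
        (deRham_to_E2 C h m q' (massey_class C (t + 2) (H3_degrees t p) A)) ?r =
     dmap (ss C h ?r) p q (class_at C h p q 1 (form_to_E1 C h p q xp) ?r)"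
    using rhs by simp
qed

end

theorem theorem1p1:
  fixes M :: "'m topology" and \<A> :: "'m chart set" and n t :: nat and p q m q' :: int
    and C :: "('m \<Rightarrow> real) set" and H :: "nat \<Rightarrow> 'm form" and h x\<^sub>p :: "'m form"
  assumes M: "closed_smooth_manifold n M \<A>"
    and C: "C = smooth_functions n M \<A>"
    and H_closed: "\<And>i. 1 \<le> i \<Longrightarrow> i \<le> (n - 1) div 2 \<Longrightarrow>
          H (2 * i + 1) \<in> Omega C (int (2 * i + 1)) \<and> ext_d C (H (2 * i + 1)) = 0"
    and H_zero: "\<And>i. 1 \<le> i \<Longrightarrow> n < 2 * i + 1 \<Longrightarrow> H (2 * i + 1) = 0"
    and h: "h = (\<Sum>i = 1..(n - 1) div 2. H (2 * i + 1))"
    and t: "t \<ge> 1"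
    and q: "even q"
    and x\<^sub>p: "x\<^sub>p \<in> Omega C p"
    and x\<^sub>p_survives: "survives C h p q 1 (form_to_E1 C h p q x\<^sub>p) (2 * t + 3)"
    and m: "m = p + 2 * int t + 3"
    and q': "q' = q - 2 * int t - 2"
  shows "(\<exists>A. admissible_system C H t p x\<^sub>p A) \<and>
    (\<forall>A. admissible_system C H t p x\<^sub>p A \<longrightarrow>
      defining_system C (t + 2) (H3_degrees t p) (H3_entries H t x\<^sub>p) A \<and>
      massey_class C (t + 2) (H3_degrees t p) A \<in> deRham C m \<and>
      survives C h m q' 2
        (deRham_to_E2 C h m q' (massey_class C (t + 2) (H3_degrees t p) A)) (2 * t + 3) \<and>
      dmap (ss C h (2 * t + 3)) p q
        (class_at C h p q 1 (form_to_E1 C h p q x\<^sub>p) (2 * t + 3)) =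
      (*) ((-1) ^ t) ` class_at C h m q' 2
        (deRham_to_E2 C h m q' (massey_class C (t + 2) (H3_degrees t p) A)) (2 * t + 3)) \<and>
    (\<forall>A A'. admissible_system C H t p x\<^sub>p A \<longrightarrow> admissible_system C H t p x\<^sub>p A' \<longrightarrow>
      class_at C h m q' 2
        (deRham_to_E2 C h m q' (massey_class C (t + 2) (H3_degrees t p) A)) (2 * t + 3) =
      class_at C h m q' 2
        (deRham_to_E2 C h m q' (massey_class C (t + 2) (H3_degrees t p) A')) (2 * t + 3))"
proof -
  interpret fun_algebra C unfolding C by (rule fun_algebra_smooth[OF M])
  \<comment> \<open>The bound forces 2i + 1 > n, also for n = 0, where the truncated subtraction
    makes the bound 0.\<close>
  have high: "H (2 * i + 1) = 0" if "(n - 1) div 2 < i" for i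
    using that by (intro H_zero) auto
  interpret twisted C H "(n - 1) div 2" h
  proof
    fix i :: nat assume i: "1 \<le> i"
    show "H (2 * i + 1) \<in> Omega C (int (2 * i + 1))" "ext_d C (H (2 * i + 1)) = 0"
      using H_closed[OF i] high[of i] by (cases "i \<le> (n - 1) div 2"; simp)+
  qed (rule high h; assumption?)+
  obtain z where z: "z \<in> Z (int (2 * t + 3)) p (p + q)" "hom_part p z = x\<^sub>p"
    using survives_lift[OF _ q x\<^sub>p x\<^sub>p_survives] by auto
  define x where "x j = hom_part (p + 2 * int j) z" for j
  have x: "partial_lift t p x"
    using partial_lift_components[of z t p "p + q"] z(1) q by (simp add: x_def[abs_def])
  have x0: "x 0 = x\<^sub>p" by (simp add: x_def z)
  \<comment> \<open>The equation of the lift at j = 0: closedness of the representative is a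
    consequence of survival.\<close>
  then have dx: "d x\<^sub>p = 0" using x unfolding partial_lift_def by force
  note diff = massey_differential[OF q x\<^sub>p dx m q']
  \<comment> \<open>Two admissible systems give the same signed class, namely the differential, in
    which A does not occur; injectivity removes the sign.\<close>
  have inj: "u = v" if "(*) ((-1) ^ t) ` u = (*) ((-1) ^ t) ` v" for u v :: "'m form set"
  proof -
    have "inj ((*) ((-1) ^ t :: 'm form))"
      by (rule injI) (simp add: minus_one_power_form split: if_splits)
    then show ?thesis using that by (simp add: inj_image_eq_iff)
  qed
  show ?thesis
    using admissible_exists[OF x] diff inj unfolding x0 by metis
qed

end
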